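(* Let $(S_n)$ be the multidimensional elephant random walk with stops on $\mathbb{Z}^d$ with parameters $p,q\in[0,1]$, $r\in(0,1)$, $p+(2d-1)q+r=1$, in the diffusive regime $p<p_{d,r}$, where $p_{d,r}=\left(\frac{2d+1}{4d}\right)(1-r)$. Let $\sigma_n^2=\sum_{k=1}^n\|X_k\|^2$ and $$v^2=\frac{(2d-1)(1-r)}{d\big((2d+1)(1-r)-4dp\big)}.$$ Then, as $n\to\infty$, one has the convergence in distribution $$\frac{S_n}{\sqrt{\sigma_n^2}}\longrightarrow \mathcal{N}\big(0,v^2I_d\big).$$ Moreover, as $n\to\infty$, one has the convergence in distribution $$\frac{S_n}{\sqrt{n^{1-r}}}\longrightarrow \sqrt{\Sigma'}\,Z,$$ where $Z$ has the Gaussian distribution $\mathcal{N}(0,v^2I_d)$, $\Sigma'$ has the Mittag-Leffler distribution $\mathcal{ML}(1-r)$, and $\Sigma'$ is independent of $Z$.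
   Context: Multidimensional elephant random walk with stops (MERWS). Let $d\ge1$ be an integer and $p,q\in[0,1]$, $r\in(0,1)$ with $p+(2d-1)q+r=1$. Let $I_d$ be the $d\times d$ identity matrix and $J_d$ the $d\times d$ cyclic permutation matrix with $(J_d)_{i,i+1}=1$ for $1\le i\le d-1$, $(J_d)_{d,1}=1$, and all other entries $0$. Let $(e_1,\dots,e_d)$ be the standard basis of $\mathbb{R}^d$. Set $S_0=0$, let $X_1$ be uniformly distributed on the $2d$ vectors $\pm e_1,\dots,\pm e_d$, and $S_1=X_1$. For all $n\ge1$, $X_{n+1}=A_{n+1}X_{U_{n+1}}$ and $S_{n+1}=S_n+X_{n+1}$, where $U_{n+1}$ is uniformly distributed on $\{1,\dots,n\}$ and $A_{n+1}$ is a random matrix equal to $I_d$ with probability $p$, to $-I_d$ with probability $q$, to each of $J_d^i$ and $-J_d^i$ ($1\le i\le d-1$) with probability $q$, and to the zero matrix with probability $r$; $A_{n+1}$ and $U_{n+1}$ are independent of each other and of $\mathcal{F}_n=\sigma(X_1,\dots,X_n)$. $\|\cdot\|$ is the Euclidean norm. $\sigma_n^2$ is the trace of the Gram matrix $\sum_{k=1}^nX_kX_k^T$. Mittag-Leffler distribution: for $\alpha\in(0,1)$, a positive random variable $X$ has the $\mathcal{ML}(\alpha)$ distribution if $\mathbb{E}[\exp(tX)]=\sum_{n=0}^\infty \frac{t^n}{\Gamma(1+n\alpha)}$ for all $t\in\mathbb{R}$. *)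

theory Defs
  imports "HOL-Probability.Probability"
begin

text \<open>
  The ambient space is \<^typ>\<open>real ^ 'n\<close> with \<open>d = CARD('n)\<close>.  Since an abstract finite index type
  has no order, the coordinates are numbered \<open>1, \<dots>, d\<close> by an arbitrary bijection \<open>lab\<close>
  from \<open>{1..d}\<close> onto \<open>'n\<close>; row and column \<open>i\<close> of a matrix are those with label \<open>lab i\<close>.
\<close>

definition cyc_mat :: "(nat \<Rightarrow> 'n::finite) \<Rightarrow> real ^ 'n ^ 'n" where
  "cyc_mat lab = (\<chi> a b.
     if (\<exists>i\<in>{1..<CARD('n)}. a = lab i \<and> b = lab (i + 1)) \<or> (a = lab CARD('n) \<and> b = lab 1)
     then 1 else 0)"

text \<open>The operations \<open>*\<close> and \<open>^\<close> on vectors of vectors are entrywise, so powers of a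
  matrix with respect to \<open>**\<close> have to be defined.\<close>

definition mat_power :: "real ^ 'n ^ 'n \<Rightarrow> nat \<Rightarrow> real ^ 'n ^ 'n::finite" where
  "mat_power B i = (((**) B) ^^ i) (mat 1)"

locale merws = prob_space M
  for M :: "'a measure" +
  fixes lab :: "nat \<Rightarrow> 'n::finite"
    and p q r :: real
    and X :: "nat \<Rightarrow> 'a \<Rightarrow> real ^ 'n"
    and A :: "nat \<Rightarrow> 'a \<Rightarrow> real ^ 'n ^ 'n"
    and U :: "nat \<Rightarrow> 'a \<Rightarrow> nat"
  assumes lab: "bij_betw lab {1..CARD('n)} UNIV"
    and p: "p \<in> {0..1}" and q: "q \<in> {0..1}" and r: "r \<in> {0<..<1}"
    and pqr: "p + (2 * real CARD('n) - 1) * q + r = 1"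
    and X_rv: "\<And>n. n \<ge> 1 \<Longrightarrow> X n \<in> borel_measurable M"
    and A_rv: "\<And>n. n \<ge> 1 \<Longrightarrow> A (n + 1) \<in> borel_measurable M"
    and U_rv: "\<And>n. n \<ge> 1 \<Longrightarrow> U (n + 1) \<in> measurable M (count_space UNIV)"
    and X1_pos: "\<And>i. prob {\<omega> \<in> space M. X 1 \<omega> = axis i 1} = 1 / (2 * real CARD('n))"
    and X1_neg: "\<And>i. prob {\<omega> \<in> space M. X 1 \<omega> = - axis i 1} = 1 / (2 * real CARD('n))"
    and X_step: "\<And>n \<omega>. n \<ge> 1 \<Longrightarrow> \<omega> \<in> space M \<Longrightarrow>
          X (n + 1) \<omega> = A (n + 1) \<omega> *v X (U (n + 1) \<omega>) \<omega>"
    and U_unif: "\<And>n k. n \<ge> 1 \<Longrightarrow> k \<in> {1..n} \<Longrightarrow>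
          prob {\<omega> \<in> space M. U (n + 1) \<omega> = k} = 1 / real n"
    and A_id: "\<And>n. n \<ge> 1 \<Longrightarrow> prob {\<omega> \<in> space M. A (n + 1) \<omega> = mat 1} = p"
    and A_neg: "\<And>n. n \<ge> 1 \<Longrightarrow> prob {\<omega> \<in> space M. A (n + 1) \<omega> = - mat 1} = q"
    and A_cyc: "\<And>n i. n \<ge> 1 \<Longrightarrow> i \<in> {1..<CARD('n)} \<Longrightarrow>
          prob {\<omega> \<in> space M. A (n + 1) \<omega> = mat_power (cyc_mat lab) i} = q"
    and A_neg_cyc: "\<And>n i. n \<ge> 1 \<Longrightarrow> i \<in> {1..<CARD('n)} \<Longrightarrow>
          prob {\<omega> \<in> space M. A (n + 1) \<omega> = - mat_power (cyc_mat lab) i} = q"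
    and A_zero: "\<And>n. n \<ge> 1 \<Longrightarrow> prob {\<omega> \<in> space M. A (n + 1) \<omega> = 0} = r"
    \<comment> \<open>mutual independence of \<open>\<sigma>(A\<^sub>n\<^sub>+\<^sub>1)\<close>, \<open>\<sigma>(U\<^sub>n\<^sub>+\<^sub>1)\<close> and \<open>\<sigma>(X\<^sub>1, \<dots>, X\<^sub>n)\<close>\<close>
    and AU_indep: "\<And>n. n \<ge> 1 \<Longrightarrow> indep_sets
          (\<lambda>j::nat. [sets (vimage_algebra (space M) (A (n + 1)) borel),
                sets (vimage_algebra (space M) (U (n + 1)) (count_space UNIV)),
                sets (vimage_algebra (space M) (\<lambda>\<omega>. \<lambda>k\<in>{1..n}. X k \<omega>)
                        (\<Pi>\<^sub>M k\<in>{1..n}. borel))] ! j) {0, 1, 2}"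

text \<open>The walk has its own recursion because the process \<open>X\<close> is meaningful only from time \<open>1\<close>
  on; the value \<open>X 0\<close> is never used.\<close>

primrec walk :: "(nat \<Rightarrow> 'a \<Rightarrow> real ^ 'n) \<Rightarrow> nat \<Rightarrow> 'a \<Rightarrow> real ^ 'n::finite" where
  "walk X 0 \<omega> = 0"
| "walk X (Suc n) \<omega> = walk X n \<omega> + X (Suc n) \<omega>"

definition sigma_sq :: "(nat \<Rightarrow> 'a \<Rightarrow> real ^ 'n) \<Rightarrow> nat \<Rightarrow> 'a \<Rightarrow> real" where
  "sigma_sq X n \<omega> = (\<Sum>k=1..n. (norm (X k \<omega>))\<^sup>2)"

text \<open>The library's \<^const>\<open>weak_conv_m\<close> covers only measures on the real line.\<close>

definition weak_conv_meas :: "(nat \<Rightarrow> 'b::topological_space measure) \<Rightarrow> 'b measure \<Rightarrow> bool" where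
  "weak_conv_meas \<mu> \<nu> \<longleftrightarrow>
     (\<forall>f :: 'b \<Rightarrow> real. continuous_on UNIV f \<and> bounded (range f) \<longrightarrow>
        (\<lambda>n. \<integral>x. f x \<partial>\<mu> n) \<longlonglongrightarrow> (\<integral>x. f x \<partial>\<nu>))"

definition converges_in_distribution ::
    "'a measure \<Rightarrow> (nat \<Rightarrow> 'a \<Rightarrow> 'b::topological_space) \<Rightarrow> 'b measure \<Rightarrow> bool" where
  "converges_in_distribution M Y \<nu> \<longleftrightarrow>
     (\<forall>n. Y n \<in> borel_measurable M) \<and> weak_conv_meas (\<lambda>n. distr M borel (Y n)) \<nu>"

text \<open>Gaussian law with mean \<open>m\<close> and covariance matrix \<open>C\<close>, for positive definite \<open>C\<close>.\<close>

definition gaussian :: "real ^ 'n \<Rightarrow> real ^ 'n ^ 'n \<Rightarrow> (real ^ 'n::finite) measure" where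
  "gaussian m C = density lborel (\<lambda>x. ennreal
     (exp (- (1 / 2) * ((x - m) \<bullet> (matrix_inv C *v (x - m)))) / sqrt ((2 * pi) ^ CARD('n) * det C)))"

definition has_mittag_leffler_law :: "'b measure \<Rightarrow> real \<Rightarrow> ('b \<Rightarrow> real) \<Rightarrow> bool" where
  "has_mittag_leffler_law N \<alpha> Y \<longleftrightarrow>
     Y \<in> borel_measurable N \<and> (AE \<omega> in N. Y \<omega> > 0) \<and>
     (\<forall>t. has_bochner_integral N (\<lambda>\<omega>. exp (t * Y \<omega>)) (\<Sum>n. t ^ n / Gamma (1 + real n * \<alpha>)))"

end

theory Submission
  imports Defs
begin

text \<open>
  Write \<open>\<alpha> = 1 - r\<close> and \<open>a = (p - q) / \<alpha>\<close>, and let \<open>m\<close> be the number of nonzero steps among the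
  first \<open>n\<close>; almost surely \<open>m = \<sigma>\<^sub>n\<^sup>2\<close>.  The idea is that the zero steps only slow the walk down:
  \<open>S\<^sub>n = W\<^sub>m\<close>, where \<open>W\<close> is an elephant walk that never stops and the clock \<open>m\<close> is independent of
  \<open>W\<close>.  This holds because for any two directions \<open>x, y\<close> among \<open>\<plusminus>e\<^sub>i\<close> exactly one of the \<open>2d\<close>
  nonzero values of the random matrix maps \<open>y\<close> to \<open>x\<close>.  Given the past, the next step therefore
  equals \<open>x\<close> with probability \<open>(q m + (p - q) c(x)) / n\<close>, where \<open>c(x)\<close> counts the earlier steps equal
  to \<open>x\<close> (\<open>markov_counts\<close>).  The step is nonzero with probability \<open>\<alpha> m / n\<close>, which depends on the clock
  only, and if it is nonzero, its direction is \<open>x\<close> with probability \<open>(1 - a) / (2d) + a c(x) / m\<close>,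
  which does not involve \<open>n\<close>.  The second probability is the transition law of an urn with \<open>2d\<close>
  colours, and \<open>expectation_urn\<close> is the resulting decomposition.

  For the urn walk \<open>W\<close>, the next step has conditional mean \<open>a W\<^sub>m / m\<close> and conditional covariance close
  to \<open>I / d\<close>, since second moment bounds balance the axes when \<open>a < 1/2\<close>.  So its characteristic
  function \<open>\<phi>\<^sub>m\<close> satisfies \<open>\<phi>\<^sub>m\<^sub>+\<^sub>1(t) \<approx> exp(-|t|\<^sup>2/(2d)) \<phi>\<^sub>m((1 + a/m) t)\<close>.  After rescaling by
  \<open>\<surd>m\<close>, the Gaussian with variance \<open>v\<^sup>2 = 1 / (d (1 - 2a))\<close> is an approximate fixed point of this
  recursion, and \<open>a < 1/2\<close>, which is the diffusive regime, makes the recursion contract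
  (\<open>gap_le\<close>, \<open>gap_rate_tendsto_0\<close>).  The distance from the Gaussian at \<open>s\<close> is bounded by
  \<open>\<rho>\<^sub>m (|s|\<^sup>2 + |s|\<^sup>4)\<close> with \<open>\<rho>\<^sub>m \<longlonglongrightarrow> 0\<close>; a bound that is uniform up to a polynomial factor can be
  integrated over a random clock.

  For the clock, \<open>E(1/m) \<longlonglongrightarrow> 0\<close>, so \<open>m\<close> tends to infinity in probability, and the rising factorial
  moments of \<open>m\<close> are explicit products.  They give \<open>E((m/n\<^sup>\<alpha>)\<^sup>k) \<longlonglongrightarrow> k! / \<Gamma>(1 + k\<alpha>)\<close>, the moments of the
  Mittag-Leffler law, and hence convergence of the Laplace transforms
  (\<open>laplace_tendsto_mittag_leffler\<close>).

  Together: the characteristic function of \<open>S\<^sub>n / \<surd>m\<close> is close to \<open>exp(-v\<^sup>2|t|\<^sup>2/2)\<close>, and that of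
  \<open>S\<^sub>n / \<surd>(n\<^sup>\<alpha>)\<close> is close to \<open>E exp(-v\<^sup>2|t|\<^sup>2 m / (2n\<^sup>\<alpha>))\<close>, which tends to
  \<open>E exp(-v\<^sup>2|t|\<^sup>2 \<Sigma>'/2)\<close>, the characteristic function of \<open>\<surd>\<Sigma>' Z\<close>.  Pointwise convergence of
  characteristic functions on a Euclidean space implies weak convergence
  (\<open>char_tendsto_imp_weak_conv\<close>).
\<close>

section \<open>Isotropic Gaussian measures\<close>

lemma lborel_prod_integral:
  fixes f :: "'a::euclidean_space \<Rightarrow> real \<Rightarrow> 'b::{real_normed_field,banach,second_countable_topology}"
  assumes "\<And>b. b \<in> Basis \<Longrightarrow> integrable lborel (f b)"
  shows "integrable lborel (\<lambda>x::'a. \<Prod>b\<in>Basis. f b (x \<bullet> b))"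
    and "(\<integral>x. (\<Prod>b\<in>(Basis::'a set). f b (x \<bullet> b)) \<partial>lborel) = (\<Prod>b\<in>Basis. \<integral>x. f b x \<partial>lborel)"
proof -
  interpret product_sigma_finite "\<lambda>_::'a. lborel :: real measure"
    by standard
  have f[measurable]: "f b \<in> borel_measurable borel" if "b \<in> Basis" for b
    using assms[OF that] by (simp add: borel_measurable_integrable)
  have eq: "(\<Prod>b\<in>Basis. f b ((\<Sum>c\<in>Basis. g c *\<^sub>R c) \<bullet> b)) = (\<Prod>b\<in>Basis. f b (g b))" for g
    by (intro prod.cong refl) simp
  have m: "(\<lambda>x::'a. \<Prod>b\<in>Basis. f b (x \<bullet> b)) \<in> borel_measurable borel"
    by measurable
  have m2: "(\<lambda>g. \<Sum>c\<in>Basis. g c *\<^sub>R c) \<in> (\<Pi>\<^sub>M b\<in>Basis. lborel) \<rightarrow>\<^sub>M (borel :: 'a measure)"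
    by measurable
  show "integrable lborel (\<lambda>x::'a. \<Prod>b\<in>Basis. f b (x \<bullet> b))"
    unfolding lborel_eq[where 'a='a] using m m2
    by (subst integrable_distr_eq) (auto simp del: inner_sum_left simp: eq intro!: product_integrable_prod assms)
  show "(\<integral>x. (\<Prod>b\<in>(Basis::'a set). f b (x \<bullet> b)) \<partial>lborel) = (\<Prod>b\<in>Basis. \<integral>x. f b x \<partial>lborel)"
    unfolding lborel_eq[where 'a='a] using m m2
    by (subst integral_distr) (auto simp del: inner_sum_left simp: eq intro!: product_integral_prod assms)
qed

definition gauss_density :: "real \<Rightarrow> 'a::euclidean_space \<Rightarrow> real" where
  "gauss_density v x = (\<Prod>b\<in>Basis. normal_density 0 (sqrt v) (x \<bullet> b))"

lemma gauss_density_eq: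
  fixes x :: "'a::euclidean_space"
  assumes "v > 0"
  shows "gauss_density v x = exp (- (norm x)\<^sup>2 / (2 * v)) / sqrt (2 * pi * v) ^ DIM('a)"
proof -
  have "gauss_density v x = (\<Prod>b\<in>(Basis::'a set). (1 / sqrt (2 * pi * v)) * exp (- (x \<bullet> b)\<^sup>2 / (2 * v)))"
    using assms unfolding gauss_density_def normal_density_def by simp
  also have "\<dots> = (1 / sqrt (2 * pi * v)) ^ DIM('a) * exp (\<Sum>b\<in>(Basis::'a set). - (x \<bullet> b)\<^sup>2 / (2 * v))"
    by (simp only: prod.distrib prod_constant exp_sum[OF finite_Basis])
  also have "(\<Sum>b\<in>(Basis::'a set). - (x \<bullet> b)\<^sup>2 / (2 * v)) = - (norm x)\<^sup>2 / (2 * v)"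
    unfolding power2_norm_eq_inner euclidean_inner[of x x]
    by (simp add: sum_negf sum_divide_distrib power2_eq_square)
  finally show ?thesis by (simp add: power_divide)
qed

lemma gauss_density_nonneg [simp]: "gauss_density v x \<ge> 0"
  unfolding gauss_density_def by (intro prod_nonneg) auto

lemma gauss_density_measurable [measurable]: "gauss_density v \<in> borel_measurable borel"
  unfolding gauss_density_def by measurable

lemma gauss_density_integrable [simp]: "v > 0 \<Longrightarrow> integrable lborel (gauss_density v)"
  unfolding gauss_density_def[abs_def]
  by (rule lborel_prod_integral) auto

lemma gauss_density_integral [simp]:
  assumes "v > 0" shows "integral\<^sup>L lborel (gauss_density v :: 'a::euclidean_space \<Rightarrow> real) = 1"
  unfolding gauss_density_def[abs_def] using assms
  by (subst lborel_prod_integral) auto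

definition gauss :: "real \<Rightarrow> 'a::euclidean_space measure" where
  "gauss v = density lborel (\<lambda>x. ennreal (gauss_density v x))"

lemma sets_gauss [simp, measurable_cong]: "sets (gauss v) = sets borel"
  by (simp add: gauss_def)

lemma space_gauss [simp]: "space (gauss v) = UNIV"
  by (simp add: gauss_def)

lemma prob_space_gauss: "v > 0 \<Longrightarrow> prob_space (gauss v)"
  by standard (simp add: gauss_def emeasure_density nn_integral_eq_integral)

text \<open>The substitution \<open>x \<mapsto> \<surd>v x\<close> reduces the claim to the standard normal distribution.\<close>
lemma normal_density_char:
  assumes "v > 0"
  shows "(\<integral>x. normal_density 0 (sqrt v) x *\<^sub>R iexp (t * x) \<partial>lborel) = complex_of_real (exp (- v * t\<^sup>2 / 2))"
proof -
  have "(\<integral>x. normal_density 0 (sqrt v) x *\<^sub>R iexp (t * x) \<partial>lborel)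
      = sqrt v *\<^sub>R (\<integral>x. normal_density 0 (sqrt v) (sqrt v * x) *\<^sub>R iexp (t * (sqrt v * x)) \<partial>lborel)"
    using assms by (subst lborel_integral_real_affine[where c="sqrt v" and t=0]) auto
  also have "\<dots> = (\<integral>x. sqrt v *\<^sub>R (normal_density 0 (sqrt v) (sqrt v * x) *\<^sub>R iexp (t * (sqrt v * x))) \<partial>lborel)"
    by (simp del: scaleR_scaleR of_real_mult)
  also have "\<dots> = (\<integral>x. std_normal_density x *\<^sub>R iexp ((t * sqrt v) * x) \<partial>lborel)"
    using assms
    by (intro Bochner_Integration.integral_cong refl)
       (simp add: normal_density_def real_sqrt_mult power_mult_distrib mult_ac scaleR_conv_of_real)
  also have "\<dots> = char std_normal_distribution (t * sqrt v)"
    unfolding char_def by (subst integral_density) auto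
  also have "\<dots> = complex_of_real (exp (- v * t\<^sup>2 / 2))"
    using assms by (simp add: char_std_normal_distribution power_mult_distrib mult_ac)
  finally show ?thesis .
qed

text \<open>Integrand and density factor over the coordinates, so this is a product of one-dimensional
  characteristic functions.\<close>
lemma gauss_char:
  fixes t :: "'a::euclidean_space"
  assumes "v > 0"
  shows "(\<integral>x. iexp (t \<bullet> x) \<partial>gauss v) = complex_of_real (exp (- v * (norm t)\<^sup>2 / 2))"
proof -
  have int: "integrable lborel (\<lambda>x. normal_density 0 (sqrt v) x *\<^sub>R iexp (s * x))" for s
    using assms by (intro Bochner_Integration.integrable_bound[OF integrable_normal_density[of "sqrt v" 0]]) auto
  have "(\<integral>x. iexp (t \<bullet> x) \<partial>gauss v) = (\<integral>x. gauss_density v x *\<^sub>R iexp (t \<bullet> x) \<partial>lborel)"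
    unfolding gauss_def by (subst integral_density) auto
  also have "\<dots> = (\<integral>x. (\<Prod>b\<in>Basis. normal_density 0 (sqrt v) (x \<bullet> b) *\<^sub>R iexp ((t \<bullet> b) * (x \<bullet> b))) \<partial>lborel)"
  proof (intro Bochner_Integration.integral_cong refl)
    fix x :: 'a
    have "iexp (t \<bullet> x) = (\<Prod>b\<in>Basis. iexp ((t \<bullet> b) * (x \<bullet> b)))"
      by (simp add: euclidean_inner[of t x] sum_distrib_left exp_sum[symmetric])
    then show "gauss_density v x *\<^sub>R iexp (t \<bullet> x) =
        (\<Prod>b\<in>Basis. normal_density 0 (sqrt v) (x \<bullet> b) *\<^sub>R iexp ((t \<bullet> b) * (x \<bullet> b)))"
      by (simp add: gauss_density_def scaleR_conv_of_real prod.distrib)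
  qed
  also have "\<dots> = (\<Prod>b\<in>Basis. complex_of_real (exp (- v * (t \<bullet> b)\<^sup>2 / 2)))"
    by (subst lborel_prod_integral(2)) (use assms int in \<open>auto simp: normal_density_char simp del: of_real_mult\<close>)
  also have "\<dots> = complex_of_real (exp (\<Sum>b\<in>Basis. - v * (t \<bullet> b)\<^sup>2 / 2))"
    by (simp add: exp_sum)
  also have "(\<Sum>b\<in>Basis. - v * (t \<bullet> b)\<^sup>2 / 2) = - v * (norm t)\<^sup>2 / 2"
    unfolding power2_norm_eq_inner euclidean_inner[of t t]
    by (simp add: sum_negf sum_divide_distrib power2_eq_square sum_distrib_left)
  finally show ?thesis .
qed

section \<open>A continuity theorem for characteristic functions on Euclidean spaces\<close>

text \<open>The Gaussian density is, up to a constant, the characteristic function of the Gaussian measure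
  of inverse variance.  For Gaussians, this self-duality is the Fourier inversion formula.\<close>
lemma gauss_density_char:
  fixes x :: "'a::euclidean_space"
  assumes "v > 0"
  shows "complex_of_real (gauss_density v x)
    = complex_of_real (1 / sqrt (2 * pi * v) ^ DIM('a)) * (\<integral>u. iexp (x \<bullet> u) \<partial>gauss (1 / v))"
  using assms by (simp add: gauss_char gauss_density_eq del: of_real_exp of_real_divide of_real_mult
      flip: of_real_mult)

text \<open>Fubini's theorem turns the density of \<open>P\<close> convolved with a Gaussian into an integral of the
  characteristic function of \<open>P\<close>; convergence of characteristic functions passes through it by
  dominated convergence.\<close>
lemma gauss_smoothing_char:
  fixes P :: "'a::euclidean_space measure"
  assumes P: "prob_space P" "sets P = sets borel" and v: "v > 0"
  shows "complex_of_real (\<integral>y. gauss_density v (z - y) \<partial>P)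
    = complex_of_real (1 / sqrt (2 * pi * v) ^ DIM('a)) *
      (\<integral>u. iexp (z \<bullet> u) * (\<integral>y. iexp ((- u) \<bullet> y) \<partial>P) \<partial>gauss (1 / v))"
proof -
  interpret P: prob_space P by (rule P)
  interpret G: prob_space "gauss (1 / v) :: 'a measure" using v by (intro prob_space_gauss) auto
  interpret PG: pair_prob_space P "gauss (1 / v) :: 'a measure" ..
  have [measurable_cong]: "sets P = sets borel" by (rule P)
  have int: "integrable (P \<Otimes>\<^sub>M gauss (1 / v)) (\<lambda>(y, u). iexp ((z - y) \<bullet> u))"
    by (intro PG.P.integrable_const_bound[of _ 1]) (auto simp: split_beta)
  have "complex_of_real (\<integral>y. gauss_density v (z - y) \<partial>P) = (\<integral>y. complex_of_real (gauss_density v (z - y)) \<partial>P)"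
    by simp
  also have "\<dots> = complex_of_real (1 / sqrt (2 * pi * v) ^ DIM('a)) * (\<integral>y. (\<integral>u. iexp ((z - y) \<bullet> u) \<partial>gauss (1 / v)) \<partial>P)"
    unfolding gauss_density_char[OF v] by (subst integral_mult_right_zero) simp
  also have "(\<integral>y. (\<integral>u. iexp ((z - y) \<bullet> u) \<partial>gauss (1 / v)) \<partial>P)
     = (\<integral>u. (\<integral>y. iexp ((z - y) \<bullet> u) \<partial>P) \<partial>gauss (1 / v))"
    by (rule PG.Fubini_integral[OF int, symmetric])
  also have "\<dots> = (\<integral>u. iexp (z \<bullet> u) * (\<integral>y. iexp ((- u) \<bullet> y) \<partial>P) \<partial>gauss (1 / v))"
    by (intro Bochner_Integration.integral_cong refl)
       (simp add: inner_diff_left inner_diff_right algebra_simps exp_diff exp_minus inner_commute divide_inverse)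
  finally show ?thesis .
qed

lemma gauss_smoothing_tendsto:
  fixes \<mu> :: "nat \<Rightarrow> 'a::euclidean_space measure"
  assumes \<mu>: "\<And>n. prob_space (\<mu> n)" "\<And>n. sets (\<mu> n) = sets borel"
    and \<nu>: "prob_space \<nu>" "sets \<nu> = sets borel"
    and conv: "\<And>t. (\<lambda>n. \<integral>x. iexp (t \<bullet> x) \<partial>\<mu> n) \<longlonglongrightarrow> (\<integral>x. iexp (t \<bullet> x) \<partial>\<nu>)"
    and v: "v > 0"
  shows "(\<lambda>n. \<integral>y. gauss_density v (z - y) \<partial>\<mu> n) \<longlonglongrightarrow> (\<integral>y. gauss_density v (z - y) \<partial>\<nu>)"
proof -
  have m: "(\<lambda>u. \<integral>y. iexp ((- u) \<bullet> y) \<partial>P) \<in> borel_measurable borel"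
    and b: "norm (\<integral>y. iexp ((- u) \<bullet> y) \<partial>P) \<le> 1"
    if P: "prob_space P" "sets P = sets borel" for P :: "'a measure" and u
  proof -
    interpret P: prob_space P by fact
    have [measurable_cong]: "sets P = sets borel" by fact
    show "(\<lambda>u. \<integral>y. iexp ((- u) \<bullet> y) \<partial>P) \<in> borel_measurable borel"
      by measurable
    have "norm (\<integral>y. iexp ((- u) \<bullet> y) \<partial>P) \<le> (\<integral>y. norm (iexp ((- u) \<bullet> y)) \<partial>P)"
      by (rule integral_norm_bound)
    also have "\<dots> = 1" using P.prob_space by simp
    finally show "norm (\<integral>y. iexp ((- u) \<bullet> y) \<partial>P) \<le> 1" .
  qed
  interpret G: prob_space "gauss (1 / v) :: 'a measure" using v by (intro prob_space_gauss) auto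
  have "(\<lambda>n. complex_of_real (\<integral>y. gauss_density v (z - y) \<partial>\<mu> n)) \<longlonglongrightarrow> complex_of_real (\<integral>y. gauss_density v (z - y) \<partial>\<nu>)"
    unfolding gauss_smoothing_char[OF \<mu> v] gauss_smoothing_char[OF \<nu> v]
    using m[OF \<mu>] m[OF \<nu>] b[OF \<mu>] conv[of "- u" for u]
    by (intro tendsto_mult tendsto_const integral_dominated_convergence[where w="\<lambda>_. 1"])
       (auto simp: norm_mult intro!: tendsto_mult tendsto_const)
  then show ?thesis by (simp add: tendsto_of_real_iff)
qed

lemma gauss_second_moment:
  assumes "v > 0"
  shows "integrable lborel (\<lambda>x::'a::euclidean_space. gauss_density v x * (norm x)\<^sup>2)"
    and "(\<integral>x. gauss_density v x * (norm (x::'a))\<^sup>2 \<partial>lborel) = real DIM('a) * v"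
proof -
  \<comment> \<open>The factor \<open>x\<^sup>2\<close> is attached to the single coordinate \<open>c\<close>, which keeps the integrand a product.\<close>
  define h where "h c b x = normal_density 0 (sqrt v) x * (if b = c then x\<^sup>2 else 1)" for b c :: 'a and x
  have int: "integrable lborel (h c b)" for b c
    using assms integrable_normal_moment[of "sqrt v" 0 2] unfolding h_def by (cases "b = c") auto
  have val: "integral\<^sup>L lborel (h c b) = (if b = c then v else 1)" for b c
    using assms integral_normal_moment_even[of "sqrt v" 0 1] unfolding h_def by auto
  have eq: "gauss_density v x * (norm x)\<^sup>2 = (\<Sum>c\<in>Basis. \<Prod>b\<in>Basis. h c b (x \<bullet> b))" for x :: 'a
  proof -
    have "(\<Prod>b\<in>Basis. h c b (x \<bullet> b)) = gauss_density v x * (x \<bullet> c)\<^sup>2" if "c \<in> Basis" for c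
      using that unfolding h_def prod.distrib gauss_density_def by simp
    then show ?thesis
      unfolding power2_norm_eq_inner euclidean_inner[of x x]
      by (simp add: sum_distrib_left power2_eq_square)
  qed
  show "integrable lborel (\<lambda>x::'a. gauss_density v x * (norm x)\<^sup>2)"
    unfolding eq by (intro Bochner_Integration.integrable_sum lborel_prod_integral int)
  show "(\<integral>x. gauss_density v x * (norm (x::'a))\<^sup>2 \<partial>lborel) = real DIM('a) * v"
    unfolding eq
    by (subst Bochner_Integration.integral_sum)
       (auto intro!: lborel_prod_integral int simp: lborel_prod_integral(2)[OF int] val)
qed

definition gauss_smooth :: "real \<Rightarrow> ('a::euclidean_space \<Rightarrow> real) \<Rightarrow> 'a \<Rightarrow> real" where
  "gauss_smooth v f y = (\<integral>z. f z * gauss_density v (z - y) \<partial>lborel)"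

lemma gauss_smooth_shift:
  assumes [measurable]: "f \<in> borel_measurable borel"
  shows "gauss_smooth v f y = (\<integral>z. f (y + z) * gauss_density v z \<partial>lborel)"
proof -
  have "gauss_smooth v f y = (\<integral>z. f z * gauss_density v (z - y) \<partial>distr lborel borel ((+) y))"
    unfolding gauss_smooth_def lborel_distr_plus ..
  also have "\<dots> = (\<integral>z. f (y + z) * gauss_density v z \<partial>lborel)"
    by (subst integral_distr) auto
  finally show ?thesis .
qed

text \<open>Convolution moves mass by at least \<open>\<delta>\<close> with probability at most \<open>d v / \<delta>\<^sup>2\<close> (Chebyshev), and mass
  that moves less changes \<open>f\<close> by at most \<open>\<eta>\<close>.  The bound is uniform in \<open>y\<close>.\<close>
lemma gauss_smooth_approx:
  fixes f :: "'a::euclidean_space \<Rightarrow> real"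
  assumes f[measurable]: "f \<in> borel_measurable borel" and B: "\<And>x. \<bar>f x\<bar> \<le> B"
    and unif: "\<And>x z. norm z < \<delta> \<Longrightarrow> \<bar>f (x + z) - f x\<bar> \<le> \<eta>" and \<delta>: "\<delta> > 0" and v: "v > 0" and \<eta>: "\<eta> \<ge> 0"
  shows "\<bar>gauss_smooth v f y - f y\<bar> \<le> \<eta> + 2 * B * real DIM('a) * v / \<delta>\<^sup>2"
proof -
  have B0: "B \<ge> 0" using B[of 0] by linarith
  have i1: "integrable lborel (\<lambda>z. f (y + z) * gauss_density v z)"
    by (rule Bochner_Integration.integrable_bound[of _ "\<lambda>z. B * gauss_density v z"])
       (use v B0 in \<open>auto simp: abs_mult intro!: mult_right_mono B\<close>)
  have i2: "integrable lborel (\<lambda>z::'a. f y * gauss_density v z)"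
    using v by simp
  have "f y = (\<integral>z. f y * gauss_density v (z::'a) \<partial>lborel)"
    using v by simp
  then have "gauss_smooth v f y - f y = (\<integral>z. f (y + z) * gauss_density v z - f y * gauss_density v z \<partial>lborel)"
    unfolding gauss_smooth_shift[OF f] Bochner_Integration.integral_diff[OF i1 i2] by linarith
  then have "\<bar>gauss_smooth v f y - f y\<bar> = \<bar>\<integral>z. f (y + z) * gauss_density v z - f y * gauss_density v z \<partial>lborel\<bar>"
    by argo
  also have "\<dots> \<le> (\<integral>z. \<bar>f (y + z) * gauss_density v z - f y * gauss_density v z\<bar> \<partial>lborel)"
    by (rule integral_abs_bound)
  also have "\<dots> \<le> (\<integral>z. \<eta> * gauss_density v (z::'a) + 2 * B / \<delta>\<^sup>2 * (gauss_density v z * (norm z)\<^sup>2) \<partial>lborel)"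
  proof (rule integral_mono)
    fix z
    have "\<bar>f (y + z) - f y\<bar> \<le> \<eta> + 2 * B / \<delta>\<^sup>2 * (norm z)\<^sup>2"
    proof (cases "norm z < \<delta>")
      case True
      have "0 \<le> 2 * B / \<delta>\<^sup>2 * (norm z)\<^sup>2" using B0 by simp
      then show ?thesis using unif[OF True, of y] by linarith
    next
      case False
      then have "\<delta>\<^sup>2 \<le> (norm z)\<^sup>2" using \<delta> by (intro power_mono) auto
      then have "2 * B * 1 \<le> 2 * B * ((norm z)\<^sup>2 / \<delta>\<^sup>2)" using B0 \<delta> by (intro mult_left_mono) auto
      then show ?thesis using B[of "y + z"] B[of y] \<eta> by simp
    qed
    then have "\<bar>f (y + z) - f y\<bar> * gauss_density v z \<le> (\<eta> + 2 * B / \<delta>\<^sup>2 * (norm z)\<^sup>2) * gauss_density v z"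
      by (rule mult_right_mono) simp
    then show "\<bar>f (y + z) * gauss_density v z - f y * gauss_density v z\<bar>
       \<le> \<eta> * gauss_density v z + 2 * B / \<delta>\<^sup>2 * (gauss_density v z * (norm z)\<^sup>2)"
      unfolding left_diff_distrib[symmetric] abs_mult by (simp add: algebra_simps)
  qed (use v i1 i2 in \<open>auto intro!: Bochner_Integration.integrable_add gauss_second_moment integrable_mult_right\<close>)
  also have "\<dots> = \<eta> + 2 * B * real DIM('a) * v / \<delta>\<^sup>2"
    using v by (subst Bochner_Integration.integral_add)
       (auto intro!: gauss_second_moment integrable_mult_right simp: gauss_second_moment(2))
  finally show ?thesis .
qed

text \<open>Exchanging the integrals writes \<open>\<integral> gauss_smooth v f dP\<close> as an integral of \<open>f\<close> against the smoothed
  density of \<open>P\<close>, which converges pointwise and is bounded by a constant; integrability of \<open>f\<close>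
  supplies the dominating function.\<close>
lemma gauss_smooth_integral_tendsto:
  fixes \<mu> :: "nat \<Rightarrow> 'a::euclidean_space measure"
  assumes \<mu>: "\<And>n. prob_space (\<mu> n)" "\<And>n. sets (\<mu> n) = sets borel"
    and \<nu>: "prob_space \<nu>" "sets \<nu> = sets borel"
    and conv: "\<And>t. (\<lambda>n. \<integral>x. iexp (t \<bullet> x) \<partial>\<mu> n) \<longlonglongrightarrow> (\<integral>x. iexp (t \<bullet> x) \<partial>\<nu>)"
    and v: "v > 0" and f: "integrable lborel f"
  shows "(\<lambda>n. \<integral>y. gauss_smooth v f y \<partial>\<mu> n) \<longlonglongrightarrow> (\<integral>y. gauss_smooth v f y \<partial>\<nu>)"
proof -
  have f_m[measurable]: "f \<in> borel_measurable borel" using f by (simp add: borel_measurable_integrable)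
  define C where "C = 1 / sqrt (2 * pi * v) ^ DIM('a)"
  have C: "\<bar>gauss_density v x\<bar> \<le> C" for x :: 'a
    using v by (simp add: gauss_density_eq C_def divide_right_mono)
  have C0: "C \<ge> 0" using C[of 0] by linarith
  have gi: "integrable P (\<lambda>y. gauss_density v (z - y))" if "prob_space P" "sets P = sets borel" for P :: "'a measure" and z
  proof -
    interpret prob_space P by fact
    have [measurable_cong]: "sets P = sets borel" by fact
    show ?thesis using C by (intro integrable_const_bound[of _ C]) auto
  qed
  have gb: "\<bar>\<integral>y. gauss_density v (z - y) \<partial>P\<bar> \<le> C"
    if P: "prob_space P" "sets P = sets borel" for P :: "'a measure" and z
  proof -
    interpret prob_space P by fact
    have "\<bar>\<integral>y. gauss_density v (z - y) \<partial>P\<bar> \<le> (\<integral>y. \<bar>gauss_density v (z - y)\<bar> \<partial>P)"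
      by (rule integral_abs_bound)
    also have "\<dots> \<le> (\<integral>y. C \<partial>P)"
      using C gi[OF P] by (intro integral_mono) auto
    finally show ?thesis using prob_space by simp
  qed
  have swap: "(\<integral>y. gauss_smooth v f y \<partial>P) = (\<integral>z. f z * (\<integral>y. gauss_density v (z - y) \<partial>P) \<partial>lborel)"
    and meas: "(\<lambda>z. f z * (\<integral>y. gauss_density v (z - y) \<partial>P)) \<in> borel_measurable borel"
    if P: "prob_space P" "sets P = sets borel" for P :: "'a measure"
  proof -
    interpret P: prob_space P by fact
    interpret PL: pair_sigma_finite P "lborel :: 'a measure" ..
    have [measurable_cong]: "sets P = sets borel" by fact
    show "(\<lambda>z. f z * (\<integral>y. gauss_density v (z - y) \<partial>P)) \<in> borel_measurable borel"
      by measurable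
    have fi: "integrable lborel (\<lambda>z. f z * gauss_density v (z - y))" for y
      by (rule Bochner_Integration.integrable_bound[of _ "\<lambda>z. C * \<bar>f z\<bar>"])
         (use C C0 f in \<open>auto simp: abs_mult mult.commute[of C] intro!: mult_left_mono\<close>)
    have "integrable (P \<Otimes>\<^sub>M lborel) (\<lambda>(y, z). f z * gauss_density v (z - y))"
    proof (rule PL.Fubini_integrable)
      have "norm (\<integral>z. norm (f z * gauss_density v (z - y)) \<partial>lborel) \<le> C * (\<integral>z. \<bar>f z\<bar> \<partial>lborel)" for y
      proof -
        have "norm (\<integral>z. norm (f z * gauss_density v (z - y)) \<partial>lborel) = (\<integral>z. norm (f z * gauss_density v (z - y)) \<partial>lborel)"
          by simp
        also have "\<dots> \<le> (\<integral>z. C * \<bar>f z\<bar> \<partial>lborel)"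
          using integrable_norm[OF fi[of y]] f C C0
          by (intro integral_mono) (auto simp: abs_mult mult.commute[of C] intro!: mult_left_mono)
        finally show ?thesis by simp
      qed
      then show "integrable P (\<lambda>y. \<integral>z. norm (case (y, z) of (y, z) \<Rightarrow> f z * gauss_density v (z - y)) \<partial>lborel)"
        by (intro P.integrable_const_bound[of _ "C * (\<integral>z. \<bar>f z\<bar> \<partial>lborel)"]) auto
    qed (use fi in \<open>auto simp: split_beta\<close>)
    from PL.Fubini_integral[OF this]
    show "(\<integral>y. gauss_smooth v f y \<partial>P) = (\<integral>z. f z * (\<integral>y. gauss_density v (z - y) \<partial>P) \<partial>lborel)"
      unfolding gauss_smooth_def by simp
  qed
  show ?thesis
    unfolding swap[OF \<mu>] swap[OF \<nu>]
    using meas[OF \<mu>] meas[OF \<nu>] gb[OF \<mu>] f gauss_smoothing_tendsto[OF \<mu> \<nu> conv v]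
    by (intro integral_dominated_convergence[where w="\<lambda>z. \<bar>f z\<bar> * C"])
       (auto simp: abs_mult intro!: tendsto_mult mult_left_mono)
qed

lemma compact_support_uniformly_continuous:
  fixes f :: "'a::euclidean_space \<Rightarrow> real"
  assumes cont: "continuous_on UNIV f" and supp: "\<And>x. norm x > R \<Longrightarrow> f x = 0" and e: "e > 0"
  obtains \<delta> where "\<delta> > 0" "\<And>x z. norm z < \<delta> \<Longrightarrow> \<bar>f (x + z) - f x\<bar> \<le> e"
proof -
  have "uniformly_continuous_on (cball 0 (R + 1)) f"
    by (intro compact_uniformly_continuous continuous_on_subset[OF cont]) auto
  then obtain d where d: "d > 0"
    "\<And>x y. x \<in> cball 0 (R + 1) \<Longrightarrow> y \<in> cball 0 (R + 1) \<Longrightarrow> dist y x < d \<Longrightarrow> dist (f y) (f x) < e"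
    unfolding uniformly_continuous_on_def using e by meson
  show thesis
  proof (rule that[of "min d 1"])
    fix x z :: 'a assume z: "norm z < min d 1"
    have tri: "norm x \<le> norm (x + z) + norm z" "norm (x + z) \<le> norm x + norm z"
      using norm_triangle_ineq4[of "x + z" z] norm_triangle_ineq[of x z] by auto
    show "\<bar>f (x + z) - f x\<bar> \<le> e"
    proof (cases "norm x \<le> R + 1 \<and> norm (x + z) \<le> R + 1")
      case True
      then show ?thesis using d(2)[of x "x + z"] z by (auto simp: dist_norm simp flip: norm_minus_cancel[of "x + z"])
    next
      case False
      then have "norm x > R" "norm (x + z) > R" using tri z by auto
      then show ?thesis using supp e by simp
    qed
  qed (use d in auto)
qed

lemma tendsto_by_uniform_approx:
  fixes F :: "nat \<Rightarrow> real"
  assumes "\<And>e. e > 0 \<Longrightarrow> \<exists>G g. G \<longlonglongrightarrow> g \<and> (\<forall>n. \<bar>F n - G n\<bar> \<le> e) \<and> \<bar>l - g\<bar> \<le> e"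
  shows "F \<longlonglongrightarrow> l"
proof (rule LIMSEQ_I)
  fix e :: real assume "e > 0"
  then obtain G g where G: "G \<longlonglongrightarrow> g" "\<And>n. \<bar>F n - G n\<bar> \<le> e / 4" "\<bar>l - g\<bar> \<le> e / 4"
    using assms[of "e / 4"] by auto
  from LIMSEQ_D[OF G(1), of "e / 4"] \<open>e > 0\<close> obtain N where N: "\<And>n. n \<ge> N \<Longrightarrow> \<bar>G n - g\<bar> < e / 4"
    by auto
  have "norm (F n - l) < e" if "n \<ge> N" for n
    using N[OF that] G(2)[of n] G(3) \<open>e > 0\<close> unfolding real_norm_def by linarith
  then show "\<exists>N. \<forall>n\<ge>N. norm (F n - l) < e" by blast
qed

text \<open>Such \<open>f\<close> are uniformly continuous, hence uniform limits of their Gaussian smoothings.\<close>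
lemma compact_support_integral_tendsto:
  fixes \<mu> :: "nat \<Rightarrow> 'a::euclidean_space measure" and f :: "'a \<Rightarrow> real"
  assumes \<mu>: "\<And>n. prob_space (\<mu> n)" "\<And>n. sets (\<mu> n) = sets borel"
    and \<nu>: "prob_space \<nu>" "sets \<nu> = sets borel"
    and conv: "\<And>t. (\<lambda>n. \<integral>x. iexp (t \<bullet> x) \<partial>\<mu> n) \<longlonglongrightarrow> (\<integral>x. iexp (t \<bullet> x) \<partial>\<nu>)"
    and cont: "continuous_on UNIV f" and B: "\<And>x. \<bar>f x\<bar> \<le> B" and supp: "\<And>x. norm x > R \<Longrightarrow> f x = 0"
  shows "(\<lambda>n. \<integral>y. f y \<partial>\<mu> n) \<longlonglongrightarrow> (\<integral>y. f y \<partial>\<nu>)"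
proof (rule tendsto_by_uniform_approx)
  fix e :: real assume e: "e > 0"
  have [measurable]: "f \<in> borel_measurable borel" using cont by (rule borel_measurable_continuous_onI)
  obtain \<delta> where \<delta>: "\<delta> > 0" "\<And>x z. norm z < \<delta> \<Longrightarrow> \<bar>f (x + z) - f x\<bar> \<le> e / 2"
    using compact_support_uniformly_continuous[OF cont supp, of R "e / 2"] e by auto
  have B0: "B \<ge> 0" using B[of 0] by linarith
  \<comment> \<open>This variance makes the Chebyshev term of the smoothing error at most \<open>e / 2\<close>; the summand \<open>1\<close> keeps the denominator positive.\<close>
  define v where "v = e / 2 * \<delta>\<^sup>2 / (2 * B * real DIM('a) + 1)"
  have den: "2 * B * real DIM('a) + 1 > 0" using B0 by (simp add: add_nonneg_pos)
  have v: "v > 0" unfolding v_def using e \<delta> den by (intro divide_pos_pos mult_pos_pos) auto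
  have "v / \<delta>\<^sup>2 = e / 2 / (2 * B * real DIM('a) + 1)"
    unfolding v_def using \<delta>(1) by simp
  then have "2 * B * real DIM('a) * v / \<delta>\<^sup>2 = e / 2 * ((2 * B * real DIM('a)) / (2 * B * real DIM('a) + 1))"
    by (metis (no_types, opaque_lifting) times_divide_eq_right mult.commute)
  also have "\<dots> \<le> e / 2 * 1"
    using e den by (intro mult_left_mono) (auto simp: divide_le_eq_1)
  finally have small: "\<bar>gauss_smooth v f y - f y\<bar> \<le> e" for y
    using gauss_smooth_approx[of f B \<delta> "e / 2" v y] B \<delta> v e by auto
  have fi: "integrable lborel f"
  proof -
    have "integrable lborel (\<lambda>x. indicator (cball 0 R) x *\<^sub>R f x)"
      by (intro borel_integrable_compact continuous_on_subset[OF cont]) auto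
    also have "(\<lambda>x. indicator (cball 0 R) x *\<^sub>R f x) = f"
      using supp by (auto simp: indicator_def fun_eq_iff not_le)
    finally show ?thesis .
  qed
  have close: "\<bar>(\<integral>y. f y \<partial>P) - (\<integral>y. gauss_smooth v f y \<partial>P)\<bar> \<le> e"
    if P: "prob_space P" "sets P = sets borel" for P :: "'a measure"
  proof -
    interpret prob_space P by fact
    have [measurable_cong]: "sets P = sets borel" by fact
    have [measurable]: "gauss_smooth v f \<in> borel_measurable borel"
      unfolding gauss_smooth_def by measurable
    have i1: "integrable P f" using B by (intro integrable_const_bound[of _ B]) auto
    have "norm (gauss_smooth v f y) \<le> B + e" for y
      using small[of y] B[of y] unfolding real_norm_def by linarith
    then have i2: "integrable P (gauss_smooth v f)" by (intro integrable_const_bound[of _ "B + e"]) auto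
    have "\<bar>(\<integral>y. f y \<partial>P) - (\<integral>y. gauss_smooth v f y \<partial>P)\<bar> = \<bar>\<integral>y. f y - gauss_smooth v f y \<partial>P\<bar>"
      using i1 i2 by simp
    also have "\<dots> \<le> (\<integral>y. \<bar>f y - gauss_smooth v f y\<bar> \<partial>P)" by (rule integral_abs_bound)
    also have "\<dots> \<le> (\<integral>y. e \<partial>P)"
      using i1 i2 small by (intro integral_mono) (auto simp: abs_minus_commute)
    finally show ?thesis using prob_space by simp
  qed
  show "\<exists>G g. G \<longlonglongrightarrow> g \<and> (\<forall>n. \<bar>(\<integral>y. f y \<partial>\<mu> n) - G n\<bar> \<le> e) \<and> \<bar>(\<integral>y. f y \<partial>\<nu>) - g\<bar> \<le> e"
    using gauss_smooth_integral_tendsto[OF \<mu> \<nu> conv v fi] close[OF \<mu>] close[OF \<nu>] by blast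
qed

text \<open>A bounded continuous \<open>f\<close> is cut off to compact support by \<open>\<psi>\<^sub>k\<close>.  Tightness comes from the
  limit: the mass that \<open>\<mu>\<^sub>n\<close> has outside the support of \<open>\<psi>\<^sub>k\<close> is controlled by \<open>1 - \<integral>\<psi>\<^sub>k d\<mu>\<^sub>n\<close>,
  which converges to the corresponding quantity for the probability measure \<open>\<nu>\<close>.\<close>
theorem char_tendsto_imp_weak_conv:
  fixes \<mu> :: "nat \<Rightarrow> 'a::euclidean_space measure"
  assumes \<mu>: "\<And>n. prob_space (\<mu> n)" "\<And>n. sets (\<mu> n) = sets borel"
    and \<nu>: "prob_space \<nu>" "sets \<nu> = sets borel"
    and conv: "\<And>t. (\<lambda>n. \<integral>x. iexp (t \<bullet> x) \<partial>\<mu> n) \<longlonglongrightarrow> (\<integral>x. iexp (t \<bullet> x) \<partial>\<nu>)"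
  shows "weak_conv_meas \<mu> \<nu>"
  unfolding weak_conv_meas_def
proof safe
  fix f :: "'a \<Rightarrow> real" assume cont: "continuous_on UNIV f" and "bounded (range f)"
  then obtain B where B: "\<And>x. \<bar>f x\<bar> \<le> B" unfolding bounded_iff by auto
  have B0: "B \<ge> 0" using B[of 0] by linarith
  have [measurable]: "f \<in> borel_measurable borel" using cont by (rule borel_measurable_continuous_onI)
  define \<psi> :: "nat \<Rightarrow> 'a \<Rightarrow> real" where "\<psi> k x = max 0 (min 1 (real k + 1 - norm x))" for k x
  have \<psi>01: "0 \<le> \<psi> k x" "\<psi> k x \<le> 1" for k x by (auto simp: \<psi>_def)
  have \<psi>c: "continuous_on UNIV (\<psi> k)" for k unfolding \<psi>_def[abs_def] by (intro continuous_intros)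
  have [measurable]: "\<psi> k \<in> borel_measurable borel" for k using \<psi>c by (rule borel_measurable_continuous_onI)
  have \<psi>0: "\<psi> k x = 0" if "norm x > real k + 1" for k x using that by (auto simp: \<psi>_def)
  have \<psi>lim: "(\<lambda>n. \<integral>y. \<psi> k y \<partial>\<mu> n) \<longlonglongrightarrow> (\<integral>y. \<psi> k y \<partial>\<nu>)" for k
    by (rule compact_support_integral_tendsto[OF \<mu> \<nu> conv, where B=1 and R="real k + 1"])
       (use \<psi>c \<psi>01 \<psi>0 in auto)
  have f\<psi>lim: "(\<lambda>n. \<integral>y. f y * \<psi> k y \<partial>\<mu> n) \<longlonglongrightarrow> (\<integral>y. f y * \<psi> k y \<partial>\<nu>)" for k
    by (rule compact_support_integral_tendsto[OF \<mu> \<nu> conv, where B="B * 1" and R="real k + 1"])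
       (use \<psi>01 \<psi>0 B B0 in \<open>auto simp: abs_mult intro!: mult_mono continuous_intros \<psi>c cont simp del: mult_1_right\<close>)
  have cut: "\<bar>(\<integral>y. f y \<partial>P) - (\<integral>y. f y * \<psi> k y \<partial>P)\<bar> \<le> B * (1 - (\<integral>y. \<psi> k y \<partial>P))"
    if P: "prob_space P" "sets P = sets borel" for P :: "'a measure" and k
  proof -
    interpret prob_space P by fact
    have [measurable_cong]: "sets P = sets borel" by fact
    have i1: "integrable P f" using B by (intro integrable_const_bound[of _ B]) auto
    have i2: "integrable P (\<psi> k)" using \<psi>01 by (intro integrable_const_bound[of _ 1]) auto
    have i3: "integrable P (\<lambda>y. f y * \<psi> k y)"
      using \<psi>01 B B0 by (intro integrable_const_bound[of _ "B * 1"]) (auto simp: abs_mult intro!: mult_mono simp del: mult_1_right)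
    have "\<bar>(\<integral>y. f y \<partial>P) - (\<integral>y. f y * \<psi> k y \<partial>P)\<bar> = \<bar>\<integral>y. f y - f y * \<psi> k y \<partial>P\<bar>"
      using i1 i3 by simp
    also have "\<dots> \<le> (\<integral>y. \<bar>f y - f y * \<psi> k y\<bar> \<partial>P)" by (rule integral_abs_bound)
    also have "\<dots> \<le> (\<integral>y. B * (1 - \<psi> k y) \<partial>P)"
    proof (rule integral_mono)
      fix y
      have "\<bar>f y\<bar> * (1 - \<psi> k y) \<le> B * (1 - \<psi> k y)" using B \<psi>01 by (intro mult_right_mono) auto
      moreover have "\<bar>f y - f y * \<psi> k y\<bar> = \<bar>f y\<bar> * (1 - \<psi> k y)"
        using \<psi>01[of k y] abs_mult[of "f y" "1 - \<psi> k y"] by (simp add: algebra_simps)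
      ultimately show "\<bar>f y - f y * \<psi> k y\<bar> \<le> B * (1 - \<psi> k y)" by simp
    qed (use i1 i2 i3 in auto)
    also have "\<dots> = B * (1 - (\<integral>y. \<psi> k y \<partial>P))"
      using i2 prob_space by simp
    finally show ?thesis .
  qed
  have mass: "(\<lambda>k. \<integral>y. \<psi> k y \<partial>\<nu>) \<longlonglongrightarrow> 1"
  proof -
    interpret prob_space \<nu> by fact
    have [measurable_cong]: "sets \<nu> = sets borel" by fact
    have "(\<lambda>k. \<psi> k y) \<longlonglongrightarrow> 1" for y
    proof (rule tendsto_eventually)
      show "\<forall>\<^sub>F k in sequentially. \<psi> k y = 1"
        using eventually_ge_at_top[of "nat \<lceil>norm y\<rceil>"] by eventually_elim (auto simp: \<psi>_def)
    qed
    then have "(\<lambda>k. \<integral>y. \<psi> k y \<partial>\<nu>) \<longlonglongrightarrow> (\<integral>y. 1 \<partial>\<nu>)"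
      using \<psi>01 by (intro integral_dominated_convergence[where w="\<lambda>_. 1"]) auto
    then show ?thesis using prob_space by simp
  qed
  show "(\<lambda>n. \<integral>x. f x \<partial>\<mu> n) \<longlonglongrightarrow> (\<integral>x. f x \<partial>\<nu>)"
  proof (rule LIMSEQ_I)
    fix e :: real assume e: "e > 0"
    have "(\<lambda>k. B * (1 - (\<integral>y. \<psi> k y \<partial>\<nu>))) \<longlonglongrightarrow> B * (1 - 1)"
      by (intro tendsto_intros mass)
    then have "\<forall>\<^sub>F k in sequentially. B * (1 - (\<integral>y. \<psi> k y \<partial>\<nu>)) < e / 4"
      using e by (intro order_tendstoD(2)) auto
    then obtain k where k: "B * (1 - (\<integral>y. \<psi> k y \<partial>\<nu>)) < e / 4"
      by (auto simp: eventually_sequentially)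
    have "(\<lambda>n. B * (1 - (\<integral>y. \<psi> k y \<partial>\<mu> n))) \<longlonglongrightarrow> B * (1 - (\<integral>y. \<psi> k y \<partial>\<nu>))"
      by (intro tendsto_intros \<psi>lim)
    from order_tendstoD(2)[OF this k] obtain N1
      where N1: "\<And>n. n \<ge> N1 \<Longrightarrow> B * (1 - (\<integral>y. \<psi> k y \<partial>\<mu> n)) < e / 4"
      by (auto simp: eventually_sequentially)
    from LIMSEQ_D[OF f\<psi>lim[of k], of "e / 4"] e obtain N2
      where N2: "\<And>n. n \<ge> N2 \<Longrightarrow> norm ((\<integral>y. f y * \<psi> k y \<partial>\<mu> n) - (\<integral>y. f y * \<psi> k y \<partial>\<nu>)) < e / 4"
      by auto
    have "norm ((\<integral>x. f x \<partial>\<mu> n) - (\<integral>x. f x \<partial>\<nu>)) < e" if "n \<ge> max N1 N2" for n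
    proof -
      from that have "n \<ge> N1" "n \<ge> N2" by auto
      then show ?thesis
        using N1[of n] N2[of n] cut[OF \<mu>, of n k] cut[OF \<nu>, of k] k
        unfolding real_norm_def by linarith
    qed
    then show "\<exists>N. \<forall>n\<ge>N. norm ((\<integral>x. f x \<partial>\<mu> n) - (\<integral>x. f x \<partial>\<nu>)) < e" by blast
  qed
qed

section \<open>Stochastic approximation recursions\<close>

text \<open>The product of the factors \<open>1 - c/(n+1)\<close> is at most of order \<open>n\<^sup>-\<^sup>c\<close>, by comparison of
  \<open>ln (n+2) - ln (n+1)\<close> with \<open>1/(n+1)\<close>, so every starting value is forgotten.  A level \<open>\<epsilon>\<close> with
  \<open>e n < c \<epsilon>\<close> is a supersolution, which is why \<open>w n - \<epsilon>\<close> decays in this way.\<close>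
lemma robbins_monro_tendsto_0:
  fixes w e :: "nat \<Rightarrow> real"
  assumes w: "\<And>n. n \<ge> n0 \<Longrightarrow> w n \<ge> 0"
    and rec: "\<And>n. n \<ge> n0 \<Longrightarrow> w (Suc n) \<le> (1 - c / real (Suc n)) * w n + e n / real (Suc n)"
    and e: "e \<longlonglongrightarrow> 0" and c: "c > 0"
  shows "w \<longlonglongrightarrow> 0"
proof (rule LIMSEQ_I)
  fix \<epsilon>' :: real assume "\<epsilon>' > 0"
  define \<epsilon> where "\<epsilon> = \<epsilon>' / 2"
  have \<epsilon>: "\<epsilon> > 0" using \<open>\<epsilon>' > 0\<close> by (simp add: \<epsilon>_def)
  from order_tendstoD(2)[OF e, of "c * \<epsilon>"] c \<epsilon> obtain n1 where n1: "\<And>n. n \<ge> n1 \<Longrightarrow> e n < c * \<epsilon>"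
    by (auto simp: eventually_sequentially)
  \<comment> \<open>From \<open>c\<close> on, the factors \<open>1 - c / (n + 1)\<close> are nonnegative.\<close>
  define N where "N = max (max n0 n1) (nat \<lceil>c\<rceil>)"
  have N: "n \<ge> n0" "n \<ge> n1" "c / real (Suc n) \<le> 1" if "n \<ge> N" for n
    using that unfolding N_def by (auto simp: divide_le_eq nat_le_iff ceiling_le_iff)
  define B where "B = \<bar>w N - \<epsilon>\<bar> * exp (c * ln (real (N + 1)))"
  have bound: "w n - \<epsilon> \<le> B * exp (- c * ln (real (n + 1)))" if "n \<ge> N" for n
    using that
  proof (induction n rule: dec_induct)
    case base
    show ?case unfolding B_def by (simp add: exp_minus field_simps)
  next
    case (step n)
    have ln: "ln (real (n + 2)) - ln (real (n + 1)) \<le> 1 / real (n + 1)"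
    proof -
      have "ln (real (n + 2)) - ln (real (n + 1)) = ln (real (n + 2) / real (n + 1))"
        by (simp add: ln_div)
      also have "real (n + 2) / real (n + 1) = 1 + 1 / real (n + 1)" by (simp add: field_simps)
      also have "ln (1 + 1 / real (n + 1)) \<le> 1 / real (n + 1)" by (intro ln_add_one_self_le_self) simp
      finally show ?thesis .
    qed
    have "w (Suc n) - \<epsilon> \<le> (1 - c / real (Suc n)) * w n + c * \<epsilon> / real (Suc n) - \<epsilon>"
      using rec[OF N(1)[OF step(1)]] divide_right_mono[OF less_imp_le[OF n1[OF N(2)[OF step(1)]]], of "real (Suc n)"]
      by linarith
    also have "\<dots> = (1 - c / real (Suc n)) * (w n - \<epsilon>)"
      by (simp add: algebra_simps diff_divide_distrib del: of_nat_Suc)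
    also have "\<dots> \<le> (1 - c / real (Suc n)) * (B * exp (- c * ln (real (n + 1))))"
      using N(3)[OF step(1)] step(3) by (intro mult_left_mono) auto
    also have "\<dots> \<le> exp (- c / real (Suc n)) * (B * exp (- c * ln (real (n + 1))))"
      using exp_ge_add_one_self[of "- c / real (Suc n)"] by (intro mult_right_mono) (auto simp: B_def)
    also have "\<dots> = B * exp (- c * (1 / real (n + 1) + ln (real (n + 1))))"
      by (simp add: exp_add[symmetric] algebra_simps)
    also have "\<dots> \<le> B * exp (- c * ln (real (Suc n + 1)))"
      using ln c by (intro mult_left_mono) (auto simp: B_def)
    finally show ?case .
  qed
  have "filterlim (\<lambda>n. ln (real (n + 1))) at_top sequentially"
    by (rule filterlim_compose[OF ln_at_top filterlim_compose[OF filterlim_real_sequentially]])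
       (rule filterlim_add_const_nat_at_top)
  then have "filterlim (\<lambda>n. c * ln (real (n + 1))) at_top sequentially"
    using c by (intro filterlim_tendsto_pos_mult_at_top[OF tendsto_const]) auto
  then have "filterlim (\<lambda>n. - c * ln (real (n + 1))) at_bot sequentially"
    by (simp add: filterlim_uminus_at_bot)
  then have "(\<lambda>n. B * exp (- c * ln (real (n + 1)))) \<longlonglongrightarrow> B * 0"
    by (intro tendsto_mult tendsto_const filterlim_compose[OF exp_at_bot])
  from order_tendstoD(2)[OF this, of \<epsilon>] \<epsilon>
  obtain n2 where n2: "\<And>n. n \<ge> n2 \<Longrightarrow> B * exp (- c * ln (real (n + 1))) < \<epsilon>"
    by (auto simp: eventually_sequentially)
  have "norm (w n - 0) < \<epsilon>'" if "n \<ge> max N n2" for n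
    using bound[of n] n2[of n] w[of n] N(1)[of n] that by (auto simp: \<epsilon>_def)
  then show "\<exists>no. \<forall>n\<ge>no. norm (w n - 0) < \<epsilon>'" by blast
qed

section \<open>The urn of directions\<close>

definition dir :: "'n::finite \<times> bool \<Rightarrow> real ^ 'n" where
  "dir y = (if snd y then axis (fst y) 1 else - axis (fst y) 1)"

lemma norm_dir [simp]: "norm (dir y) = 1"
  by (simp add: dir_def)

lemma sum_dirs: "(\<Sum>y\<in>UNIV. f y) = (\<Sum>i\<in>(UNIV::'n::finite set). f (i, True) + f (i, False))"
proof -
  have "(\<Sum>y\<in>UNIV. f y) = (\<Sum>i\<in>(UNIV::'n set). \<Sum>b\<in>UNIV. f (i, b))"
    by (simp add: sum.cartesian_product)
  then show ?thesis by (simp add: UNIV_bool add.commute)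
qed

type_synonym 'n counts = "'n \<times> bool \<Rightarrow> nat"

definition moves :: "'n::finite counts \<Rightarrow> nat" where
  "moves c = (\<Sum>y\<in>UNIV. c y)"

definition incr :: "'n counts \<Rightarrow> 'n \<times> bool \<Rightarrow> 'n counts" where
  "incr c y = c(y := Suc (c y))"

lemma moves_incr [simp]: "moves (incr c y) = Suc (moves c)"
proof -
  have "moves (incr c y) = Suc (c y) + sum c (UNIV - {y})"
    unfolding moves_def incr_def by (subst sum.remove[of _ y]) auto
  also have "\<dots> = Suc (moves c)"
    unfolding moves_def by (subst sum.remove[of UNIV y c]) auto
  finally show ?thesis .
qed

lemma count_le_moves: "c y \<le> moves c"
  unfolding moves_def by (rule member_le_sum) auto

lemma sum_incr:
  fixes g :: "'n::finite \<times> bool \<Rightarrow> 'v::real_vector"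
  shows "(\<Sum>z\<in>UNIV. real (incr c y z) *\<^sub>R g z) = (\<Sum>z\<in>UNIV. real (c z) *\<^sub>R g z) + g y"
proof -
  have "(\<Sum>z\<in>UNIV. real (incr c y z) *\<^sub>R g z) = (\<Sum>z\<in>UNIV. real (c z) *\<^sub>R g z + (if z = y then g z else 0))"
    by (intro sum.cong) (auto simp: incr_def algebra_simps)
  then show ?thesis by (simp add: sum.distrib)
qed

definition position :: "'n::finite counts \<Rightarrow> real ^ 'n" where
  "position c = (\<Sum>y\<in>UNIV. real (c y) *\<^sub>R dir y)"

lemma position_zero [simp]: "position (\<lambda>_. 0) = 0"
  by (simp add: position_def)

lemma position_incr: "position (incr c y) = position c + dir y"
  unfolding position_def by (rule sum_incr)

definition axis_count :: "'n \<Rightarrow> 'n counts \<Rightarrow> real" where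
  "axis_count i c = real (c (i, True)) + real (c (i, False))"

lemma axis_count_incr: "axis_count i (incr c y) = axis_count i c + (if fst y = i then 1 else 0)"
  by (cases y; cases "snd y") (auto simp: axis_count_def incr_def)

text \<open>The conditional probability that the next nonzero step has a direction chosen \<open>k\<close> times so far
  among \<open>m\<close> nonzero steps.  For \<open>m = 0\<close> this is the uniform law of the first step.\<close>
definition urn_weight :: "'n::finite itself \<Rightarrow> real \<Rightarrow> nat \<Rightarrow> nat \<Rightarrow> real" where
  "urn_weight _ a m k = (if m = 0 then 1 / (2 * real CARD('n))
     else (1 - a) / (2 * real CARD('n)) + a * real k / real m)"

text \<open>The expectation of \<open>f\<close> applied to the direction counts of the walk without stops after \<open>m\<close> steps.
  The recursion conditions on the last step, whose transition probabilities are the weights; the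
  value depends on \<open>f\<close> only through counts of total \<open>m\<close>.\<close>
primrec urn_exp :: "real \<Rightarrow> nat \<Rightarrow> ('n::finite counts \<Rightarrow> 'v::real_vector) \<Rightarrow> 'v" where
  "urn_exp a 0 f = f (\<lambda>_. 0)"
| "urn_exp a (Suc m) f = urn_exp a m (\<lambda>c. \<Sum>y\<in>UNIV. urn_weight TYPE('n) a m (c y) *\<^sub>R f (incr c y))"

lemma urn_exp_cong:
  assumes "\<And>c. moves c = m \<Longrightarrow> f c = g c"
  shows "urn_exp a m f = urn_exp a m g"
  using assms
proof (induction m arbitrary: f g)
  case 0
  then show ?case by (simp add: moves_def)
next
  case (Suc m)
  show ?case unfolding urn_exp.simps by (rule Suc.IH) (simp add: Suc.prems)
qed

lemma urn_exp_add: "urn_exp a m (\<lambda>c. f c + g c) = urn_exp a m f + urn_exp a m g"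
  by (induction m arbitrary: f g) (simp_all add: scaleR_add_right sum.distrib)

lemma urn_exp_scaleR:
  fixes f :: "'n::finite counts \<Rightarrow> 'v::real_vector"
  shows "urn_exp a m (\<lambda>c. k *\<^sub>R f c) = k *\<^sub>R urn_exp a m f"
proof (induction m arbitrary: f)
  case (Suc m)
  have "(\<Sum>y\<in>UNIV. w y *\<^sub>R k *\<^sub>R g y) = k *\<^sub>R (\<Sum>y\<in>UNIV. w y *\<^sub>R g y)"
    for w and g :: "'n \<times> bool \<Rightarrow> 'v"
    by (simp add: scaleR_sum_right mult.commute)
  then show ?case by (simp add: Suc del: scaleR_scaleR)
qed simp

lemma urn_exp_mult:
  fixes k :: "'v::real_algebra"
  shows "urn_exp a m (\<lambda>c. k * f c) = k * urn_exp a m f"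
  by (induction m arbitrary: f) (simp_all flip: sum_distrib_left mult_scaleR_right)

lemma urn_exp_diff: "urn_exp a m (\<lambda>c. f c - g c) = urn_exp a m f - urn_exp a m g"
  using urn_exp_add[of a m f "\<lambda>c. (-1) *\<^sub>R g c"] by (simp only: urn_exp_scaleR) simp

lemma urn_exp_sum: "finite I \<Longrightarrow> urn_exp a m (\<lambda>c. \<Sum>i\<in>I. f i c) = (\<Sum>i\<in>I. urn_exp a m (f i))"
proof (induction I rule: finite_induct)
  case empty
  show ?case using urn_exp_scaleR[of a m 0 "\<lambda>_. 0"] by simp
qed (simp add: urn_exp_add)

text \<open>The lower bound on the memory parameter \<open>a\<close> makes the weights nonnegative; the upper bound is
  the diffusive regime.  The type parameter \<open>ty\<close> fixes the index type of the coordinates.\<close>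
locale elephant_urn =
  fixes ty :: "'n::finite itself" and a d :: real
  assumes d: "d = real CARD('n)"
    and a_lower: "- 1 \<le> a * (2 * d - 1)" and a_upper: "a < 1 / 2"
begin

abbreviation wt :: "nat \<Rightarrow> 'n counts \<Rightarrow> 'n \<times> bool \<Rightarrow> real" where
  "wt m c y \<equiv> urn_weight TYPE('n) a m (c y)"

lemma d_ge_1: "d \<ge> 1"
  by (simp add: d)

lemma a_ge_minus_1: "a \<ge> - 1"
proof (rule ccontr)
  assume "\<not> a \<ge> -1"
  then have "a * (2 * d - 1) \<le> a * 1" using d_ge_1 by (intro mult_left_mono_neg) auto
  then show False using a_lower \<open>\<not> a \<ge> -1\<close> by linarith
qed

lemma urn_weight_nonneg:
  assumes "k \<le> m"
  shows "urn_weight TYPE('n) a m k \<ge> 0"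
proof (cases "m = 0")
  case False
  then have km: "0 \<le> real k / real m" "real k / real m \<le> 1" using assms by auto
  show ?thesis
  proof (cases "a \<ge> 0")
    case True
    then have "(1 - a) / (2 * d) \<ge> 0" "a * real k / real m \<ge> 0" using a_upper km d_ge_1 by auto
    then show ?thesis using False unfolding urn_weight_def d by auto
  next
    case neg: False
    have "a * real k / real m \<ge> a" using neg km mult_left_mono_neg[of "real k / real m" 1 a] by auto
    moreover have "(1 - a) / (2 * d) + a = (1 + a * (2 * d - 1)) / (2 * d)"
      using d_ge_1 by (simp add: field_simps)
    moreover have "\<dots> \<ge> 0" using a_lower d_ge_1 by (intro divide_nonneg_nonneg) auto
    ultimately show ?thesis using False unfolding urn_weight_def d by auto
  qed
qed (simp add: urn_weight_def)

lemma urn_weight_sum: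
  assumes "moves (c :: 'n counts) = m"
  shows "(\<Sum>y\<in>UNIV. wt m c y) = 1"
proof (cases "m = 0")
  case True
  then show ?thesis by (simp add: urn_weight_def card_cartesian_product flip: UNIV_Times_UNIV)
next
  case False
  have s: "(\<Sum>y\<in>UNIV. real (c y)) = real m" using assms by (simp add: moves_def flip: of_nat_sum)
  have "(\<Sum>y\<in>UNIV. wt m c y) = real (card (UNIV :: ('n \<times> bool) set)) * ((1 - a) / (2 * d)) + a * (\<Sum>y\<in>UNIV. real (c y)) / real m"
    using False by (simp add: urn_weight_def d sum.distrib sum_distrib_left sum_divide_distrib)
  also have "real (card (UNIV :: ('n \<times> bool) set)) = 2 * d" by (simp add: d card_cartesian_product flip: UNIV_Times_UNIV)
  finally show ?thesis using False d_ge_1 by (simp add: s)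
qed

lemma urn_exp_const: "urn_exp a m (\<lambda>_::'n counts. k) = k"
proof (induction m)
  case (Suc m)
  have "urn_exp a (Suc m) (\<lambda>_::'n counts. k) = urn_exp a m (\<lambda>_::'n counts. k)"
    unfolding urn_exp.simps scaleR_sum_left[symmetric]
    by (rule urn_exp_cong) (simp add: urn_weight_sum)
  with Suc show ?case by simp
qed simp

lemma urn_exp_mono:
  fixes f g :: "'n counts \<Rightarrow> real"
  assumes "\<And>c. moves c = m \<Longrightarrow> f c \<le> g c"
  shows "urn_exp a m f \<le> urn_exp a m g"
  using assms
proof (induction m arbitrary: f g)
  case (Suc m)
  show ?case unfolding urn_exp.simps
    by (rule Suc.IH) (auto intro!: sum_mono mult_left_mono Suc.prems urn_weight_nonneg simp: count_le_moves)
qed (simp add: moves_def)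

lemma norm_urn_exp_le:
  fixes f :: "'n counts \<Rightarrow> 'v::real_normed_vector"
  shows "norm (urn_exp a m f) \<le> urn_exp a m (\<lambda>c. norm (f c))"
proof (induction m arbitrary: f)
  case (Suc m)
  have "norm (urn_exp a (Suc m) f) \<le> urn_exp a m (\<lambda>c. norm (\<Sum>y\<in>UNIV. wt m c y *\<^sub>R f (incr c y)))"
    unfolding urn_exp.simps by (rule Suc.IH)
  also have "\<dots> \<le> urn_exp a (Suc m) (\<lambda>c. norm (f c))"
    unfolding urn_exp.simps
  proof (rule urn_exp_mono)
    fix c :: "'n counts" assume c: "moves c = m"
    have "norm (\<Sum>y\<in>UNIV. wt m c y *\<^sub>R f (incr c y))
      \<le> (\<Sum>y\<in>UNIV. norm (wt m c y *\<^sub>R f (incr c y)))" by (rule norm_sum)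
    also have "\<dots> = (\<Sum>y\<in>UNIV. wt m c y *\<^sub>R norm (f (incr c y)))"
      using urn_weight_nonneg[of "c y" m for y] count_le_moves[of c] c by (intro sum.cong) auto
    finally show "norm (\<Sum>y\<in>UNIV. wt m c y *\<^sub>R f (incr c y))
      \<le> (\<Sum>y\<in>UNIV. wt m c y *\<^sub>R norm (f (incr c y)))" .
  qed
  finally show ?case .
qed simp

end

context elephant_urn
begin

lemma weight_eq:
  assumes "m \<ge> 1"
  shows "urn_weight TYPE('n) a m k = (1 - a) / (2 * d) + a * real k / real m"
  using assms by (simp add: urn_weight_def d)

lemma mean_step:
  fixes c :: "'n counts"
  assumes "m \<ge> 1"
  shows "(\<Sum>y\<in>UNIV. wt m c y * (t \<bullet> dir y)) = a * (t \<bullet> position c) / real m"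
proof -
  have "(\<Sum>y\<in>UNIV. t \<bullet> (dir y :: real ^ 'n)) = 0"
    by (simp add: sum_dirs dir_def inner_minus_right)
  moreover have "(\<Sum>y\<in>UNIV. real (c y) * (t \<bullet> dir y)) = t \<bullet> position c"
    by (simp add: position_def inner_sum_right)
  moreover have "(\<Sum>y\<in>UNIV. wt m c y * (t \<bullet> dir y))
     = (1 - a) / (2 * d) * (\<Sum>y\<in>UNIV. t \<bullet> (dir y :: real ^ 'n)) + a / real m * (\<Sum>y\<in>UNIV. real (c y) * (t \<bullet> dir y))"
    unfolding sum_distrib_left sum.distrib[symmetric]
    by (intro sum.cong refl) (simp add: weight_eq[OF assms] algebra_simps)
  ultimately show ?thesis by simp
qed

lemma axis_weight:
  fixes c :: "'n counts"
  assumes "m \<ge> 1"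
  shows "(\<Sum>y\<in>UNIV. wt m c y * (if fst y = i then 1 else 0))
    = 1 / d + a * (axis_count i c / real m - 1 / d)"
proof -
  have half: "(1 - a) / (2 * d) + (1 - a) / (2 * d) = (1 - a) / d" by simp
  have "(\<Sum>y\<in>UNIV. wt m c y * (if fst y = i then 1 else 0))
     = (\<Sum>j\<in>UNIV. if j = i then (1 - a) / d + a * axis_count j c / real m else 0)"
    unfolding sum_dirs
    by (intro sum.cong refl) (use half in \<open>auto simp: weight_eq[OF assms] axis_count_def distrib_left add_divide_distrib\<close>)
  also have "\<dots> = 1 / d + a * (axis_count i c / real m - 1 / d)"
    by (simp add: algebra_simps diff_divide_distrib)
  finally show ?thesis .
qed

text \<open>The covariance of a step is \<open>I / d\<close> when all axes have been used equally often.\<close>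
lemma second_moment_step:
  fixes c :: "'n counts" and t :: "real ^ 'n"
  assumes "m \<ge> 1"
  shows "(\<Sum>y\<in>UNIV. wt m c y * (t \<bullet> dir y)\<^sup>2)
    = (norm t)\<^sup>2 / d + a * (\<Sum>i\<in>UNIV. (t $ i)\<^sup>2 * (axis_count i c / real m - 1 / d))"
proof -
  have "(t \<bullet> dir y)\<^sup>2 = (\<Sum>i\<in>UNIV. (t $ i)\<^sup>2 * (if fst y = i then 1 else 0))" for y
    by (simp add: dir_def inner_axis inner_commute[of t] if_distrib cong: if_cong)
  then have "(\<Sum>y\<in>UNIV. wt m c y * (t \<bullet> dir y)\<^sup>2)
     = (\<Sum>y\<in>UNIV. \<Sum>i\<in>UNIV. (t $ i)\<^sup>2 * (wt m c y * (if fst y = i then 1 else 0)))"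
    by (simp only: sum_distrib_left mult.left_commute)
  also have "\<dots> = (\<Sum>i\<in>UNIV. \<Sum>y\<in>UNIV. (t $ i)\<^sup>2 * (wt m c y * (if fst y = i then 1 else 0)))"
    by (rule sum.swap)
  also have "\<dots> = (\<Sum>i\<in>UNIV. (t $ i)\<^sup>2 * (1 / d + a * (axis_count i c / real m - 1 / d)))"
    unfolding sum_distrib_left[symmetric] axis_weight[OF assms] ..
  also have "\<dots> = (\<Sum>i\<in>UNIV. (t $ i)\<^sup>2) / d + a * (\<Sum>i\<in>UNIV. (t $ i)\<^sup>2 * (axis_count i c / real m - 1 / d))"
    by (simp only: distrib_left sum.distrib sum_divide_distrib sum_distrib_left mult_1_right times_divide_eq_right mult.left_commute)
  also have "(\<Sum>i\<in>UNIV. (t $ i)\<^sup>2) = (norm t)\<^sup>2"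
    unfolding power2_norm_eq_inner inner_vec_def by (simp add: power2_eq_square)
  finally show ?thesis .
qed

text \<open>The sequence \<open>growth * m\<close> is a supersolution of
  \<open>u\<^sub>m\<^sub>+\<^sub>1 = (1 + 2a/m) u\<^sub>m + 1\<close>; this uses \<open>a < 1/2\<close>.\<close>
definition growth :: real where "growth = max 1 (1 / (1 - 2 * a))"

lemma growth: "growth \<ge> 1" "growth * (1 - 2 * a) \<ge> 1"
proof -
  show "growth \<ge> 1" by (simp add: growth_def)
  have "1 / (1 - 2 * a) * (1 - 2 * a) \<le> growth * (1 - 2 * a)"
    using a_upper by (intro mult_right_mono) (auto simp: growth_def)
  then show "growth * (1 - 2 * a) \<ge> 1" using a_upper by simp
qed

text \<open>Both \<open>|W\<^sub>m|\<^sup>2\<close> and the squared deviation of an axis count from \<open>m/d\<close> satisfy the recursion assumed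
  here.\<close>
lemma linear_growth:
  fixes f :: "'n counts \<Rightarrow> nat \<Rightarrow> real"
  assumes start: "\<And>y. f (incr (\<lambda>_. 0) y) 1 \<le> 1"
    and nonneg: "\<And>c m. f c m \<ge> 0"
    and step: "\<And>c m. m \<ge> 1 \<Longrightarrow> moves c = m \<Longrightarrow>
       (\<Sum>y\<in>UNIV. wt m c y * f (incr c y) (Suc m)) \<le> (1 + 2 * a / real m) * f c m + 1"
    and "m \<ge> 1"
  shows "urn_exp a m (\<lambda>c. f c m) \<le> growth * real m"
  using \<open>m \<ge> 1\<close>
proof (induction m rule: dec_induct)
  case base
  have "urn_exp a 1 (\<lambda>c. f c 1) \<le> urn_exp a 1 (\<lambda>_::'n counts. 1::real)"
  proof (rule urn_exp_mono)
    fix c :: "'n counts" assume c: "moves c = 1"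
    then obtain y where y: "c y \<noteq> 0" unfolding moves_def by (metis (mono_tags, lifting) sum.neutral zero_neq_one)
    have "c y + sum c (UNIV - {y}) = 1" using c unfolding moves_def by (subst (asm) sum.remove[of _ y]) auto
    then have "c y = 1" and rest: "sum c (UNIV - {y}) = 0" using y by linarith+
    from rest have "\<forall>z\<in>UNIV - {y}. c z = 0" by simp
    then have "c = incr (\<lambda>_. 0) y" using \<open>c y = 1\<close> unfolding incr_def fun_eq_iff by (metis DiffI One_nat_def UNIV_I fun_upd_apply singletonD)
    then show "f c 1 \<le> 1" using start by simp
  qed
  then show ?case using growth(1) by (simp only: urn_exp_const)
next
  case (step m)
  let ?L = "urn_exp a m (\<lambda>c. f c m)"
  have L0: "0 \<le> ?L" using urn_exp_mono[of m "\<lambda>_. 0" "\<lambda>c. f c m"] nonneg by (simp add: urn_exp_const)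
  have "urn_exp a (Suc m) (\<lambda>c. f c (Suc m)) \<le> urn_exp a m (\<lambda>c. (1 + 2 * a / real m) * f c m + 1)"
    unfolding urn_exp.simps using assms(3)[of m] step(1) by (intro urn_exp_mono) auto
  also have "\<dots> = (1 + 2 * a / real m) * ?L + 1"
    by (simp add: urn_exp_add urn_exp_mult urn_exp_const)
  also have "\<dots> \<le> growth * real (Suc m)"
  proof (cases "1 + 2 * a / real m \<ge> 0")
    case True
    then have "(1 + 2 * a / real m) * ?L \<le> (1 + 2 * a / real m) * (growth * real m)"
      using step.IH by (intro mult_left_mono)
    also have "\<dots> = growth * real m + growth * (2 * a)"
      using step(1) by (simp add: field_simps)
    finally show ?thesis using growth(2) by (simp add: algebra_simps)
  next
    case False
    \<comment> \<open>This case occurs only for \<open>m = 1\<close> and \<open>a < -1/2\<close>.\<close>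
    then have "(1 + 2 * a / real m) * ?L \<le> 0" using L0 by (intro mult_nonpos_nonneg) auto
    moreover have "growth * 1 \<le> growth * real (Suc m)" using growth(1) by (intro mult_left_mono) auto
    ultimately show ?thesis using growth(1) by linarith
  qed
  finally show ?case .
qed

lemma urn_exp_position_sq:
  assumes "m \<ge> 1"
  shows "urn_exp a m (\<lambda>c. (norm (position (c :: 'n counts)))\<^sup>2) \<le> growth * real m"
proof (rule linear_growth[OF _ _ _ assms, where f="\<lambda>c _. (norm (position c))\<^sup>2"])
  show "(norm (position (incr (\<lambda>_. 0) (y :: 'n \<times> bool))))\<^sup>2 \<le> 1" for y
    unfolding position_incr by (simp add: position_def)
next
  fix c :: "'n counts" and m assume m: "m \<ge> (1::nat)" and c: "moves c = m"
  have "(\<Sum>y\<in>UNIV. wt m c y * (norm (position (incr c y)))\<^sup>2)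
    = (\<Sum>y\<in>UNIV. wt m c y * ((norm (position c))\<^sup>2 + 1)
         + 2 * (wt m c y * (position c \<bullet> dir y)))"
  proof (intro sum.cong refl)
    fix y
    have "(norm (position c + dir y))\<^sup>2 = (norm (position c))\<^sup>2 + 1 + 2 * (position c \<bullet> dir y)"
      using dot_norm[of "position c" "dir y"] by simp
    then show "wt m c y * (norm (position (incr c y)))\<^sup>2 =
         wt m c y * ((norm (position c))\<^sup>2 + 1)
         + 2 * (wt m c y * (position c \<bullet> dir y))"
      by (simp add: position_incr algebra_simps)
  qed
  also have "\<dots> = ((norm (position c))\<^sup>2 + 1) + 2 * (a * (position c \<bullet> position c) / real m)"
    unfolding sum.distrib sum_distrib_left[symmetric] sum_distrib_right[symmetric] mean_step[OF m] urn_weight_sum[OF c] by simp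
  also have "\<dots> = (1 + 2 * a / real m) * (norm (position c))\<^sup>2 + 1"
    by (simp add: power2_norm_eq_inner algebra_simps)
  finally show "(\<Sum>y\<in>UNIV. wt m c y * (norm (position (incr c y)))\<^sup>2)
    \<le> (1 + 2 * a / real m) * (norm (position c))\<^sup>2 + 1" by simp
qed simp

lemma urn_exp_axis_sq:
  assumes "m \<ge> 1"
  shows "urn_exp a m (\<lambda>c. (axis_count i (c :: 'n counts) - real m / d)\<^sup>2) \<le> growth * real m"
proof (rule linear_growth[OF _ _ _ assms, where f="\<lambda>c m. (axis_count i c - real m / d)\<^sup>2"])
  have d01: "0 \<le> 1 / d" "1 / d \<le> 1" using d_ge_1 by auto
  have b: "((if P then 1 else 0) - 1 / d)\<^sup>2 \<le> 1" for P
    using d01 by (auto simp: abs_square_le_1)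
  show "(axis_count i (incr (\<lambda>_. 0) (y :: 'n \<times> bool)) - real 1 / d)\<^sup>2 \<le> 1" for y
    unfolding axis_count_incr using b[of "fst y = i"] by (simp add: axis_count_def)
  fix c :: "'n counts" and m assume m: "m \<ge> (1::nat)" and c: "moves c = m"
  let ?D = "axis_count i c - real m / d"
  let ?e = "\<lambda>y. (if fst y = i then 1 else 0) - 1 / d"
  have D: "a * (axis_count i c / real m - 1 / d) = a * ?D / real m"
    using m by (simp add: field_simps)
  have e: "(\<Sum>y\<in>UNIV. wt m c y * ?e y) = a * ?D / real m"
  proof -
    have "(\<Sum>y\<in>UNIV. wt m c y * ?e y)
      = (\<Sum>y\<in>UNIV. wt m c y * (if fst y = i then 1 else 0))
        - (\<Sum>y\<in>UNIV. wt m c y) * (1 / d)"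
      by (simp only: right_diff_distrib sum_subtractf sum_distrib_right)
    then show ?thesis unfolding axis_weight[OF m] urn_weight_sum[OF c] using D by linarith
  qed
  have "(\<Sum>y\<in>UNIV. wt m c y * (axis_count i (incr c y) - real (Suc m) / d)\<^sup>2)
    = (\<Sum>y\<in>UNIV. wt m c y * ?D\<^sup>2
         + (2 * ?D) * (wt m c y * ?e y) + wt m c y * (?e y)\<^sup>2)"
  proof (intro sum.cong refl)
    fix y
    have "axis_count i (incr c y) - real (Suc m) / d = ?D + ?e y"
      by (simp add: axis_count_incr add_divide_distrib)
    then show "wt m c y * (axis_count i (incr c y) - real (Suc m) / d)\<^sup>2 =
        wt m c y * ?D\<^sup>2
         + (2 * ?D) * (wt m c y * ?e y) + wt m c y * (?e y)\<^sup>2"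
      by (simp only: power2_sum) (simp only: algebra_simps)
  qed
  also have "\<dots> = ?D\<^sup>2 + (2 * ?D) * (a * ?D / real m) + (\<Sum>y\<in>UNIV. wt m c y * (?e y)\<^sup>2)"
    unfolding sum.distrib sum_distrib_left[symmetric] sum_distrib_right[symmetric] e urn_weight_sum[OF c] by simp
  also have "(\<Sum>y\<in>UNIV. wt m c y * (?e y)\<^sup>2) \<le> (\<Sum>y\<in>UNIV. wt m c y * 1)"
    using b c by (intro sum_mono mult_left_mono urn_weight_nonneg) (auto simp: count_le_moves)
  also have "\<dots> = 1" using urn_weight_sum[OF c] by simp
  also have "?D\<^sup>2 + (2 * ?D) * (a * ?D / real m) + 1 = (1 + 2 * a / real m) * ?D\<^sup>2 + 1"
  proof -
    have "x\<^sup>2 + (2 * x) * (a * x / real m) + 1 = (1 + 2 * a / real m) * x\<^sup>2 + 1" for x :: real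
      by (simp add: algebra_simps power2_eq_square)
    then show ?thesis .
  qed
  finally show "(\<Sum>y\<in>UNIV. wt m c y * (axis_count i (incr c y) - real (Suc m) / d)\<^sup>2)
    \<le> (1 + 2 * a / real m) * ?D\<^sup>2 + 1" by simp
qed simp

end

section \<open>Characteristic functions of the walk without stops\<close>

lemma iexp_quadratic_approx:
  "cmod (iexp x - (1 + \<i> * complex_of_real x - complex_of_real (x\<^sup>2 / 2))) \<le> \<bar>x\<bar> ^ 3 / 6"
  using iexp_approx1[of x 2] by (simp add: numeral_eq_Suc power_mult_distrib fact_Suc algebra_simps)

text \<open>For a negative argument the Lagrange remainder carries a factor \<open>exp t \<le> 1\<close>.\<close>
lemma exp_minus_taylor:
  fixes x :: real
  assumes "x \<ge> 0"
  shows "\<bar>exp (- x) - (\<Sum>k<K. (- x) ^ k / fact k)\<bar> \<le> x ^ K / fact K"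
proof (cases "x = 0 \<or> K = 0")
  case True
  then show ?thesis
  proof
    assume "x = 0"
    then show ?thesis by (cases K) (simp_all add: sum.lessThan_Suc_shift del: sum.lessThan_Suc)
  qed (use assms in simp)
next
  case False
  then have x: "- x < 0" "K > 0" using assms by auto
  have "\<exists>t. - x < t \<and> t < 0 \<and> exp (- x) = (\<Sum>m<K. exp 0 / fact m * (- x) ^ m) + exp t / fact K * (- x) ^ K"
    by (rule Maclaurin_minus[OF x, where diff="\<lambda>_. exp"]) (auto intro!: derivative_eq_intros)
  then obtain t where t: "t < 0" "exp (- x) = (\<Sum>m<K. (- x) ^ m / fact m) + exp t / fact K * (- x) ^ K" by auto
  have "\<bar>exp (- x) - (\<Sum>k<K. (- x) ^ k / fact k)\<bar> = exp t * (x ^ K / fact K)"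
    unfolding t(2) using assms by (simp add: abs_mult power_abs)
  also have "\<dots> \<le> 1 * (x ^ K / fact K)" using t(1) assms by (intro mult_right_mono) auto
  finally show ?thesis by simp
qed

lemma exp_minus_lipschitz:
  fixes x y :: real
  assumes "x \<ge> 0" "y \<ge> 0"
  shows "\<bar>exp (- x) - exp (- y)\<bar> \<le> \<bar>x - y\<bar>"
proof -
  have *: "exp (- x) - exp (- y) \<le> y - x" "0 \<le> exp (- x) - exp (- y)" if "x \<le> y" "x \<ge> 0" for x y :: real
  proof -
    have "exp (- y) = exp (- x) * exp (- (y - x))" by (simp add: exp_add[symmetric])
    then have "exp (- x) - exp (- y) = exp (- x) * (1 - exp (- (y - x)))" by (simp add: algebra_simps)
    also have "\<dots> \<le> 1 * (y - x)"
    proof (rule mult_mono)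
      show "1 - exp (- (y - x)) \<le> y - x" using exp_ge_add_one_self[of "- (y - x)"] by linarith
    qed (use that in auto)
    finally show "exp (- x) - exp (- y) \<le> y - x" by simp
    show "0 \<le> exp (- x) - exp (- y)" using that by simp
  qed
  show ?thesis
  proof (cases "x \<le> y")
    case True then show ?thesis using *[of x y] assms by auto
  next
    case False then show ?thesis using *[of y x] assms by auto
  qed
qed

definition urn_char :: "real \<Rightarrow> nat \<Rightarrow> real ^ 'n::finite \<Rightarrow> complex" where
  "urn_char a m t = urn_exp a m (\<lambda>c. iexp (t \<bullet> position c))"

context elephant_urn
begin

text \<open>Bounds the deviation of the conditional covariance of a step from \<open>I / d\<close>: the sum measures how
  unequally the axes have been used, and the square comes from the conditional mean of the step.\<close>
definition imbalance :: "nat \<Rightarrow> 'n counts \<Rightarrow> real" where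
  "imbalance m c = (\<Sum>i\<in>UNIV. \<bar>axis_count i c / real m - 1 / d\<bar>) + (norm (position c) / real m)\<^sup>2"

text \<open>Here \<open>\<xi>\<close> is the increment of \<open>t \<bullet> W\<close>, centred at the conditional mean from \<open>mean_step\<close>.\<close>
lemma variance_step:
  fixes c :: "'n counts" and t :: "real ^ 'n"
  assumes m: "m \<ge> 1" and c: "moves c = m"
  defines "\<xi> \<equiv> \<lambda>y. t \<bullet> dir y - a * (t \<bullet> position c) / real m"
  shows "(\<Sum>y\<in>UNIV. wt m c y * \<xi> y) = 0"
    and "\<bar>(\<Sum>y\<in>UNIV. wt m c y * (\<xi> y)\<^sup>2) - (norm t)\<^sup>2 / d\<bar> \<le> (norm t)\<^sup>2 * imbalance m c"
    and "\<bar>\<xi> y\<bar> \<le> 2 * norm t"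
proof -
  define \<mu> where "\<mu> = a * (t \<bullet> position c) / real m"
  have \<xi>: "\<xi> y = t \<bullet> dir y - \<mu>" for y by (simp add: \<xi>_def \<mu>_def)
  note mean = mean_step[OF m, where c=c and t=t, folded \<mu>_def]
  note tot = urn_weight_sum[OF c]
  have wpos: "wt m c y \<ge> 0" for y
    using c count_le_moves[of c y] by (intro urn_weight_nonneg) auto
  show "(\<Sum>y\<in>UNIV. wt m c y * \<xi> y) = 0"
    unfolding \<xi> right_diff_distrib sum_subtractf sum_distrib_right[symmetric] mean tot by simp
  have dirb: "\<bar>t \<bullet> dir y\<bar> \<le> norm t" for y :: "'n \<times> bool"
    using Cauchy_Schwarz_ineq2[of t "dir y"] by simp
  have "\<bar>\<mu>\<bar> \<le> (\<Sum>y\<in>UNIV. \<bar>wt m c y * (t \<bullet> dir y)\<bar>)"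
    unfolding mean[symmetric] by (rule sum_abs)
  also have "\<dots> \<le> (\<Sum>y\<in>UNIV. wt m c y * norm t)"
    using wpos dirb by (intro sum_mono) (auto simp: abs_mult intro!: mult_left_mono)
  also have "\<dots> = norm t" unfolding sum_distrib_right[symmetric] tot by simp
  finally have \<mu>: "\<bar>\<mu>\<bar> \<le> norm t" .
  show "\<bar>\<xi> y\<bar> \<le> 2 * norm t" using dirb[of y] \<mu> unfolding \<xi> by linarith
  have a1: "\<bar>a\<bar> \<le> 1" using a_upper a_ge_minus_1 by (simp add: abs_le_iff)
  have \<mu>2: "\<mu>\<^sup>2 \<le> (norm t)\<^sup>2 * (norm (position c) / real m)\<^sup>2"
  proof -
    have "\<bar>\<mu>\<bar> = \<bar>a\<bar> * (\<bar>t \<bullet> position c\<bar> / real m)" by (simp add: \<mu>_def abs_mult)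
    also have "\<dots> \<le> 1 * ((norm t * norm (position c)) / real m)"
      using a1 Cauchy_Schwarz_ineq2[of t "position c"] by (intro mult_mono divide_right_mono) auto
    finally have "\<bar>\<mu>\<bar> \<le> norm t * (norm (position c) / real m)" by simp
    from power_mono[OF this, of 2] show ?thesis by (simp only: power_mult_distrib power2_abs abs_ge_zero)
  qed
  let ?S = "\<Sum>i\<in>UNIV. (t $ i)\<^sup>2 * (axis_count i c / real m - 1 / d)"
  have "(\<Sum>y\<in>UNIV. wt m c y * (\<xi> y)\<^sup>2)
     = (\<Sum>y\<in>UNIV. wt m c y * (t \<bullet> dir y)\<^sup>2
         - 2 * \<mu> * (wt m c y * (t \<bullet> dir y)) + wt m c y * \<mu>\<^sup>2)"
    unfolding \<xi> power2_diff by (intro sum.cong refl) (simp only: algebra_simps)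
  also have "\<dots> = (norm t)\<^sup>2 / d + a * ?S - \<mu>\<^sup>2"
    unfolding sum.distrib sum_subtractf sum_distrib_left[symmetric] sum_distrib_right[symmetric] mean tot second_moment_step[OF m]
    by (simp add: power2_eq_square)
  finally have eq: "(\<Sum>y\<in>UNIV. wt m c y * (\<xi> y)\<^sup>2) - (norm t)\<^sup>2 / d = a * ?S - \<mu>\<^sup>2" by simp
  have "\<bar>a * ?S\<bar> \<le> 1 * (\<Sum>i\<in>UNIV. (norm t)\<^sup>2 * \<bar>axis_count i c / real m - 1 / d\<bar>)"
    unfolding abs_mult
  proof (intro mult_mono order_trans[OF sum_abs] sum_mono)
    fix i
    have "(t $ i)\<^sup>2 \<le> (norm t)\<^sup>2" using power_mono[OF component_le_norm_cart[of t i], of 2] by simp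
    then show "\<bar>(t $ i)\<^sup>2 * (axis_count i c / real m - 1 / d)\<bar> \<le> (norm t)\<^sup>2 * \<bar>axis_count i c / real m - 1 / d\<bar>"
      unfolding abs_mult by (intro mult_right_mono) auto
  qed (use a1 in auto)
  then have "\<bar>a * ?S\<bar> \<le> (norm t)\<^sup>2 * (\<Sum>i\<in>UNIV. \<bar>axis_count i c / real m - 1 / d\<bar>)"
    by (simp only: sum_distrib_left[symmetric] mult_1_left)
  then show "\<bar>(\<Sum>y\<in>UNIV. wt m c y * (\<xi> y)\<^sup>2) - (norm t)\<^sup>2 / d\<bar> \<le> (norm t)\<^sup>2 * imbalance m c"
    unfolding eq imbalance_def distrib_left using \<mu>2 zero_le_power2[of \<mu>] by linarith
qed

text \<open>Taylor expansion of \<open>exp(i \<xi>)\<close> to second order for the centred increment \<open>\<xi>\<close>: the first order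
  term vanishes and the second order term is compared with that of \<open>exp(-|t|\<^sup>2/(2d))\<close>.  The
  conditional mean of the step is what turns \<open>t\<close> into \<open>(1 + a/m) t\<close>.\<close>
lemma char_step:
  fixes c :: "'n counts" and t :: "real ^ 'n"
  assumes m: "m \<ge> 1" and c: "moves c = m"
  shows "cmod ((\<Sum>y\<in>UNIV. wt m c y *\<^sub>R iexp (t \<bullet> position (incr c y)))
      - complex_of_real (exp (- ((norm t)\<^sup>2 / (2 * d)))) * iexp (((1 + a / real m) *\<^sub>R t) \<bullet> position c))
    \<le> 2 * norm t ^ 3 + norm t ^ 4 + (norm t)\<^sup>2 * imbalance m c"
proof -
  define \<xi> where "\<xi> y = t \<bullet> dir y - a * (t \<bullet> position c) / real m" for y :: "'n \<times> bool"
  note \<xi> = variance_step[OF m c, where t=t, folded \<xi>_def]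
  define w where "w y = wt m c y" for y
  have wpos: "w y \<ge> 0" for y
    using c count_le_moves[of c y] unfolding w_def by (intro urn_weight_nonneg) auto
  have wsum: "(\<Sum>y\<in>UNIV. w y) = 1" unfolding w_def by (rule urn_weight_sum[OF c])
  define E where "E = iexp (((1 + a / real m) *\<^sub>R t) \<bullet> position c)"
  define V where "V = (\<Sum>y\<in>UNIV. w y * (\<xi> y)\<^sup>2)"
  define x where "x = (norm t)\<^sup>2 / (2 * d)"
  have split: "iexp (t \<bullet> position (incr c y)) = E * iexp (\<xi> y)" for y
    unfolding E_def \<xi>_def position_incr exp_add[symmetric]
    by (rule arg_cong[where f=exp]) (simp add: algebra_simps inner_add_right)
  define R where "R y = iexp (\<xi> y) - (1 + \<i> * complex_of_real (\<xi> y) - complex_of_real ((\<xi> y)\<^sup>2 / 2))" for y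
  have "(\<Sum>y\<in>UNIV. w y *\<^sub>R iexp (\<xi> y)) = (\<Sum>y\<in>UNIV. w y *\<^sub>R R y + (complex_of_real (w y) + \<i> * complex_of_real (w y * \<xi> y) - complex_of_real (w y * (\<xi> y)\<^sup>2 / 2)))"
    unfolding R_def by (intro sum.cong refl) (simp add: scaleR_conv_of_real algebra_simps)
  also have "\<dots> = (\<Sum>y\<in>UNIV. w y *\<^sub>R R y) + (complex_of_real (\<Sum>y\<in>UNIV. w y) + \<i> * complex_of_real (\<Sum>y\<in>UNIV. w y * \<xi> y) - complex_of_real (V / 2))"
    unfolding V_def by (simp add: sum.distrib sum_subtractf sum_distrib_left sum_divide_distrib)
  also have "\<dots> = (\<Sum>y\<in>UNIV. w y *\<^sub>R R y) + complex_of_real (1 - V / 2)"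
    using \<xi>(1) wsum by (simp add: w_def)
  finally have sum: "(\<Sum>y\<in>UNIV. w y *\<^sub>R iexp (\<xi> y)) = (\<Sum>y\<in>UNIV. w y *\<^sub>R R y) + complex_of_real (1 - V / 2)" .
  have R: "cmod (\<Sum>y\<in>UNIV. w y *\<^sub>R R y) \<le> 2 * norm t ^ 3"
  proof -
    have "cmod (R y) \<le> 2 * norm t ^ 3" for y
    proof -
      have "cmod (R y) \<le> \<bar>\<xi> y\<bar> ^ 3 / 6" unfolding R_def by (rule iexp_quadratic_approx)
      also have "\<dots> \<le> (2 * norm t) ^ 3 / 6" using \<xi>(3) by (intro divide_right_mono power_mono) auto
      also have "\<dots> \<le> 2 * norm t ^ 3" by (simp add: power_mult_distrib)
      finally show ?thesis .
    qed
    then have "cmod (\<Sum>y\<in>UNIV. w y *\<^sub>R R y) \<le> (\<Sum>y\<in>UNIV. w y * (2 * norm t ^ 3))"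
      using wpos by (intro order_trans[OF norm_sum] sum_mono) (auto intro!: mult_left_mono)
    then show ?thesis by (simp only: sum_distrib_right[symmetric] wsum)
  qed
  have x0: "x \<ge> 0" unfolding x_def using d_ge_1 by simp
  have xb: "x\<^sup>2 / 2 \<le> norm t ^ 4"
  proof -
    have "x \<le> (norm t)\<^sup>2 / 1" unfolding x_def using d_ge_1 by (intro divide_left_mono) auto
    then have "x\<^sup>2 \<le> ((norm t)\<^sup>2)\<^sup>2" using x0 by (intro power_mono) auto
    also have "((norm t)\<^sup>2)\<^sup>2 = norm t ^ 4" by simp
    finally show ?thesis using zero_le_power2[of x] by linarith
  qed
  have q: "\<bar>exp (- x) - (1 - x)\<bar> \<le> x\<^sup>2 / 2"
    using exp_minus_taylor[OF x0, of 2] by (simp add: numeral_2_eq_2)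
  have e: "\<bar>(1 - V / 2) - exp (- x)\<bar> \<le> norm t ^ 4 + (norm t)\<^sup>2 * imbalance m c"
  proof -
    have "\<bar>V - 2 * x\<bar> \<le> (norm t)\<^sup>2 * imbalance m c"
      using \<xi>(2) by (simp add: V_def w_def x_def)
    then show ?thesis using q xb by linarith
  qed
  have "(\<Sum>y\<in>UNIV. wt m c y *\<^sub>R iexp (t \<bullet> position (incr c y))) - complex_of_real (exp (- x)) * E
    = E * (\<Sum>y\<in>UNIV. w y *\<^sub>R iexp (\<xi> y)) - complex_of_real (exp (- x)) * E"
    unfolding split w_def sum_distrib_left by simp
  also have "\<dots> = E * ((\<Sum>y\<in>UNIV. w y *\<^sub>R R y) + complex_of_real ((1 - V / 2) - exp (- x)))"
    by (subst sum) (simp add: algebra_simps)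
  finally have "cmod ((\<Sum>y\<in>UNIV. wt m c y *\<^sub>R iexp (t \<bullet> position (incr c y)))
      - complex_of_real (exp (- x)) * E) = cmod (E * ((\<Sum>y\<in>UNIV. w y *\<^sub>R R y) + complex_of_real ((1 - V / 2) - exp (- x))))"
    by (rule arg_cong)
  also have "\<dots> = cmod ((\<Sum>y\<in>UNIV. w y *\<^sub>R R y) + complex_of_real ((1 - V / 2) - exp (- x)))"
    unfolding norm_mult E_def by (simp del: of_real_add of_real_mult inner_scaleR_left)
  also have "\<dots> \<le> 2 * norm t ^ 3 + (norm t ^ 4 + (norm t)\<^sup>2 * imbalance m c)"
    using R e by (intro order_trans[OF norm_triangle_ineq] add_mono) (simp_all only: norm_of_real)
  finally show ?thesis unfolding x_def E_def by (simp only: add.assoc)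
qed

text \<open>The first absolute moments are bounded by second moments through
  \<open>2|x| \<le> 1/\<surd>m + \<surd>m x\<^sup>2\<close>.\<close>
lemma urn_exp_imbalance:
  assumes m: "m \<ge> 1"
  shows "urn_exp a m (imbalance m) \<le> (2 * d * growth) / sqrt (real m)"
proof -
  have sq: "\<bar>x\<bar> \<le> (1 / sqrt (real m) + sqrt (real m) * x\<^sup>2) / 2" for x
  proof -
    have "0 \<le> (1 - sqrt (real m) * \<bar>x\<bar>)\<^sup>2 / sqrt (real m)" by simp
    also have "\<dots> = 1 / sqrt (real m) - 2 * \<bar>x\<bar> + sqrt (real m) * x\<^sup>2"
      using m by (simp add: power2_diff power_mult_distrib field_simps)
    finally show ?thesis by simp
  qed
  have ax: "urn_exp a m (\<lambda>c. \<bar>axis_count i (c :: 'n counts) / real m - 1 / d\<bar>) \<le> growth / sqrt (real m)" for i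
  proof -
    have "urn_exp a m (\<lambda>c. \<bar>axis_count i (c :: 'n counts) / real m - 1 / d\<bar>)
      \<le> urn_exp a m (\<lambda>c. (1 / sqrt (real m)) / 2 + (sqrt (real m) / (real m)\<^sup>2 / 2) * (axis_count i c - real m / d)\<^sup>2)"
    proof (rule urn_exp_mono)
      fix c :: "'n counts"
      have "axis_count i c / real m - 1 / d = (axis_count i c - real m / d) / real m"
        using m by (simp add: field_simps)
      then have "(axis_count i c / real m - 1 / d)\<^sup>2 = (axis_count i c - real m / d)\<^sup>2 / (real m)\<^sup>2"
        by (simp only: power_divide)
      then show "\<bar>axis_count i c / real m - 1 / d\<bar>
        \<le> (1 / sqrt (real m)) / 2 + (sqrt (real m) / (real m)\<^sup>2 / 2) * (axis_count i c - real m / d)\<^sup>2"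
        using sq[of "axis_count i c / real m - 1 / d"] by (simp only: add_divide_distrib) simp
    qed
    also have "\<dots> = (1 / sqrt (real m)) / 2 + (sqrt (real m) / (real m)\<^sup>2 / 2) * urn_exp a m (\<lambda>c. (axis_count i (c :: 'n counts) - real m / d)\<^sup>2)"
      by (simp only: urn_exp_add urn_exp_mult urn_exp_const)
    also have "\<dots> \<le> (1 / sqrt (real m)) / 2 + (sqrt (real m) / (real m)\<^sup>2 / 2) * (growth * real m)"
      by (intro add_left_mono mult_left_mono urn_exp_axis_sq m) simp
    also have "(sqrt (real m) / (real m)\<^sup>2 / 2) * (growth * real m) = growth / sqrt (real m) / 2"
    proof -
      have "real m = sqrt (real m) * sqrt (real m)" by simp
      then show ?thesis using m by (simp add: power2_eq_square field_simps)
    qed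
    also have "(1 / sqrt (real m)) / 2 + growth / sqrt (real m) / 2 \<le> growth / sqrt (real m)"
      using growth(1) divide_right_mono[of 1 growth "sqrt (real m)"] by simp
    finally show ?thesis .
  qed
  have pos: "urn_exp a m (\<lambda>c. (norm (position (c :: 'n counts)) / real m)\<^sup>2) \<le> growth / sqrt (real m)"
  proof -
    have "urn_exp a m (\<lambda>c. (norm (position (c :: 'n counts)) / real m)\<^sup>2)
      = (1 / (real m)\<^sup>2) * urn_exp a m (\<lambda>c. (norm (position (c :: 'n counts)))\<^sup>2)"
      unfolding urn_exp_mult[symmetric] by (simp add: power_divide)
    also have "\<dots> \<le> (1 / (real m)\<^sup>2) * (growth * real m)"
      by (intro mult_left_mono urn_exp_position_sq m) simp
    also have "\<dots> = growth / real m" using m by (simp add: power2_eq_square)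
    also have "\<dots> \<le> growth / sqrt (real m)"
    proof (rule divide_left_mono)
      show "sqrt (real m) \<le> real m"
        using m self_le_power[of "real m" 2] by (intro real_le_lsqrt) auto
    qed (use m growth(1) in auto)
    finally show ?thesis .
  qed
  have "urn_exp a m (imbalance m) = (\<Sum>i\<in>UNIV. urn_exp a m (\<lambda>c. \<bar>axis_count i (c :: 'n counts) / real m - 1 / d\<bar>)) + urn_exp a m (\<lambda>c. (norm (position (c :: 'n counts)) / real m)\<^sup>2)"
    unfolding imbalance_def[abs_def] by (simp only: urn_exp_add urn_exp_sum[OF finite])
  also have "\<dots> \<le> (\<Sum>i\<in>(UNIV :: 'n set). growth / sqrt (real m)) + growth / sqrt (real m)"
    by (intro add_mono sum_mono ax pos)
  also have "\<dots> = (d + 1) * growth / sqrt (real m)" by (simp add: d algebra_simps add_divide_distrib)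
  also have "\<dots> \<le> (2 * d * growth) / sqrt (real m)"
    using d_ge_1 growth(1) by (intro divide_right_mono mult_right_mono) auto
  finally show ?thesis .
qed

lemma urn_char_step:
  fixes t :: "real ^ 'n"
  assumes m: "m \<ge> 1"
  shows "cmod (urn_char a (Suc m) t - complex_of_real (exp (- ((norm t)\<^sup>2 / (2 * d)))) * urn_char a m ((1 + a / real m) *\<^sub>R t))
    \<le> 2 * norm t ^ 3 + norm t ^ 4 + (norm t)\<^sup>2 * ((2 * d * growth) / sqrt (real m))"
proof -
  let ?k = "complex_of_real (exp (- ((norm t)\<^sup>2 / (2 * d))))"
  have "urn_char a (Suc m) t - ?k * urn_char a m ((1 + a / real m) *\<^sub>R t)
    = urn_exp a m (\<lambda>c. (\<Sum>y\<in>UNIV. wt m c y *\<^sub>R iexp (t \<bullet> position (incr c y)))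
      - ?k * iexp (((1 + a / real m) *\<^sub>R t) \<bullet> position c))"
    unfolding urn_char_def urn_exp_mult[symmetric] urn_exp_diff[symmetric] urn_exp.simps ..
  also have "cmod \<dots> \<le> urn_exp a m (\<lambda>c::'n counts. 2 * norm t ^ 3 + norm t ^ 4 + (norm t)\<^sup>2 * imbalance m c)"
    by (intro order_trans[OF norm_urn_exp_le] urn_exp_mono char_step m)
  also have "\<dots> = 2 * norm t ^ 3 + norm t ^ 4 + (norm t)\<^sup>2 * urn_exp a m (imbalance m)"
    by (simp only: urn_exp_add urn_exp_const urn_exp_mult)
  also have "\<dots> \<le> 2 * norm t ^ 3 + norm t ^ 4 + (norm t)\<^sup>2 * ((2 * d * growth) / sqrt (real m))"
    by (intro add_left_mono mult_left_mono urn_exp_imbalance m) simp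
  finally show ?thesis .
qed

end

context elephant_urn
begin

definition limit_var :: real where "limit_var = 1 / (d * (1 - 2 * a))"

lemma limit_var_pos: "limit_var > 0"
  using d_ge_1 a_upper by (simp add: limit_var_def)

definition gap :: "nat \<Rightarrow> real ^ 'n \<Rightarrow> real" where
  "gap m s = cmod (urn_char a m (s /\<^sub>R sqrt (real m)) - complex_of_real (exp (- (limit_var * (norm s)\<^sup>2 / 2))))"

text \<open>One step of the walk maps the argument \<open>s\<close> of the rescaled characteristic function to
  \<open>shrink m * s\<close>.  Its square is about \<open>1 - (1 - 2a)/m\<close>, for large \<open>m\<close> a contraction exactly when \<open>a < 1/2\<close>.\<close>
definition shrink :: "nat \<Rightarrow> real" where
  "shrink m = (1 + a / real m) * sqrt (real m) / sqrt (real (Suc m))"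

lemma shrink_sq:
  assumes "m \<ge> 1"
  shows "(shrink m)\<^sup>2 = 1 - (1 - 2 * a) / real (Suc m) + a\<^sup>2 / (real m * real (Suc m))"
proof -
  have "(shrink m)\<^sup>2 = (1 + a / real m)\<^sup>2 * real m / real (Suc m)"
    by (simp add: shrink_def power_mult_distrib power_divide)
  also have "(1 + a / real m)\<^sup>2 * real m = real (Suc m) - (1 - 2 * a) + a\<^sup>2 / real m"
  proof -
    have "(1 + a / M)\<^sup>2 * M = M + 2 * a + a\<^sup>2 / M" if "M \<noteq> 0" for M
      using that by (simp add: field_simps power2_eq_square)
    from this[of "real m"] show ?thesis using assms by simp
  qed
  also have "\<dots> / real (Suc m) = 1 - (1 - 2 * a) / real (Suc m) + a\<^sup>2 / (real m * real (Suc m))"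
    unfolding add_divide_distrib diff_divide_distrib divide_divide_eq_left by simp
  finally show ?thesis .
qed

definition gap_const :: real where "gap_const = 5 + 2 * d * growth + limit_var"

text \<open>Three errors: the one-step expansion, the gap at the previous time, and the failure of the limit
  Gaussian to be an exact fixed point.  The choice of \<open>limit_var\<close> cancels the order \<open>1/m\<close> in the
  exponent of the third, and what remains is of order \<open>1/m\<^sup>2\<close>.\<close>
lemma gap_step:
  fixes s :: "real ^ 'n"
  assumes m: "m \<ge> 1"
  shows "gap (Suc m) s \<le> gap m (shrink m *\<^sub>R s)
     + gap_const * ((norm s)\<^sup>2 + norm s ^ 4) / (sqrt (real m) * real (Suc m))"
proof -
  define t where "t = s /\<^sub>R sqrt (real (Suc m))"
  define k where "k = exp (- ((norm t)\<^sup>2 / (2 * d)))"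
  define Q where "Q = (norm s)\<^sup>2 + norm s ^ 4"
  define D where "D = sqrt (real m) * real (Suc m)"
  have D: "D > 0" using m by (simp add: D_def)
  have norm_t: "norm t = norm s / sqrt (real (Suc m))" by (simp add: t_def divide_inverse mult.commute)
  have t2: "(norm t)\<^sup>2 = (norm s)\<^sup>2 / real (Suc m)" by (simp add: norm_t power_divide)
  have shift: "(1 + a / real m) *\<^sub>R t = (shrink m *\<^sub>R s) /\<^sub>R sqrt (real m)"
    using m by (simp add: t_def shrink_def divide_inverse mult_ac)
  let ?g = "\<lambda>s. exp (- (limit_var * (norm s)\<^sup>2 / 2))"
  have k1: "0 \<le> k" "k \<le> 1" using d_ge_1 by (auto simp: k_def)
  have m1: "sqrt (real m) \<ge> 1" using m by simp
  have sqrts: "sqrt (real m) \<le> sqrt (real (Suc m))" by simp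
  have Q0: "Q \<ge> 0" by (simp add: Q_def)
  have e1: "cmod (urn_char a (Suc m) t - complex_of_real k * urn_char a m ((1 + a / real m) *\<^sub>R t))
     \<le> (5 + 2 * d * growth) * Q / D"
  proof -
    have mD: "D \<le> sqrt (real (Suc m)) * real (Suc m)" unfolding D_def using sqrts by (intro mult_right_mono) auto
    have mD2: "sqrt (real (Suc m)) * real (Suc m) \<le> real (Suc m) * real (Suc m)"
      using self_le_power[of "real (Suc m)" 2] by (intro mult_right_mono real_le_lsqrt) auto
    have c: "norm s ^ 3 \<le> Q"
    proof (cases "norm s \<le> 1")
      case True
      then have "norm s ^ 3 \<le> (norm s)\<^sup>2" by (intro power_decreasing) auto
      then show ?thesis by (simp add: Q_def add_increasing2)
    next
      case False
      then have "norm s ^ 3 \<le> norm s ^ 4" by (intro power_increasing) auto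
      then show ?thesis by (simp add: Q_def add_increasing)
    qed
    have "norm t ^ 3 = norm s ^ 3 / (sqrt (real (Suc m)) * real (Suc m))"
      by (simp add: norm_t power_divide power3_eq_cube)
    also have "\<dots> \<le> Q / D" using c mD D Q0 by (intro frac_le) auto
    finally have b3: "norm t ^ 3 \<le> Q / D" .
    have "norm t ^ 4 = norm s ^ 4 / (real (Suc m) * real (Suc m))"
    proof -
      have "norm t ^ 4 = ((norm t)\<^sup>2)\<^sup>2" by simp
      also have "\<dots> = norm s ^ 4 / (real (Suc m) * real (Suc m))" unfolding t2 by (simp add: power_divide power2_eq_square power4_eq_xxxx mult.assoc)
      finally show ?thesis .
    qed
    also have "\<dots> \<le> Q / D" using order_trans[OF mD mD2] D Q0 by (intro frac_le) (auto simp: Q_def)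
    finally have b4: "norm t ^ 4 \<le> Q / D" .
    have "(norm t)\<^sup>2 * ((2 * d * growth) / sqrt (real m)) = (2 * d * growth) * ((norm s)\<^sup>2 / D)"
      unfolding t2 D_def by (simp add: mult_ac)
    also have "\<dots> \<le> (2 * d * growth) * (Q / D)"
      using d_ge_1 growth(1) D by (intro mult_left_mono divide_right_mono) (auto simp: Q_def)
    finally have b2: "(norm t)\<^sup>2 * ((2 * d * growth) / sqrt (real m)) \<le> (2 * d * growth) * (Q / D)" .
    have "2 * norm t ^ 3 + norm t ^ 4 + (norm t)\<^sup>2 * ((2 * d * growth) / sqrt (real m)) \<le> 3 * (Q / D) + (2 * d * growth) * (Q / D)"
      using b3 b4 b2 by linarith
    also have "\<dots> \<le> (5 + 2 * d * growth) * Q / D"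
    proof -
      have "0 \<le> Q / D" using Q0 D by simp
      moreover have "(5 + 2 * d * growth) * Q / D = 5 * (Q / D) + 2 * d * growth * (Q / D)"
        by (simp add: algebra_simps add_divide_distrib)
      ultimately show ?thesis by linarith
    qed
    finally show ?thesis using urn_char_step[OF m, of t] unfolding k_def by linarith
  qed
  have e2: "cmod (complex_of_real k * urn_char a m ((1 + a / real m) *\<^sub>R t) - complex_of_real (k * ?g (shrink m *\<^sub>R s))) \<le> gap m (shrink m *\<^sub>R s)"
  proof -
    have "cmod (complex_of_real k * urn_char a m ((1 + a / real m) *\<^sub>R t) - complex_of_real (k * ?g (shrink m *\<^sub>R s)))
      = k * gap m (shrink m *\<^sub>R s)"
      unfolding gap_def shift of_real_mult right_diff_distrib[symmetric] norm_mult using k1 by simp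
    also have "\<dots> \<le> 1 * gap m (shrink m *\<^sub>R s)" using k1 by (intro mult_right_mono) (auto simp: gap_def)
    finally show ?thesis by simp
  qed
  have e3: "\<bar>k * ?g (shrink m *\<^sub>R s) - ?g s\<bar> \<le> limit_var * Q / D"
  proof -
    let ?x = "(norm s)\<^sup>2 / real (Suc m) / (2 * d) + limit_var * ((shrink m)\<^sup>2 * (norm s)\<^sup>2) / 2"
    have "k * ?g (shrink m *\<^sub>R s) = exp (- ?x)"
      unfolding k_def t2 exp_add[symmetric] by (simp add: power_mult_distrib)
    moreover have "\<bar>exp (- ?x) - ?g s\<bar> \<le> \<bar>?x - limit_var * (norm s)\<^sup>2 / 2\<bar>"
      using limit_var_pos d_ge_1 by (intro exp_minus_lipschitz) auto
    moreover have "?x - limit_var * (norm s)\<^sup>2 / 2 = limit_var * (norm s)\<^sup>2 / 2 * (a\<^sup>2 / (real m * real (Suc m)))"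
    proof -
      have "1 / d = limit_var * (1 - 2 * a)" using a_upper by (simp add: limit_var_def)
      then have "(norm s)\<^sup>2 / real (Suc m) / (2 * d) = limit_var * (norm s)\<^sup>2 / 2 * ((1 - 2 * a) / real (Suc m))"
      proof -
        have "(norm s)\<^sup>2 / real (Suc m) / (2 * d) = (1 / d) * ((norm s)\<^sup>2 / 2 / real (Suc m))" by simp
        then show ?thesis unfolding \<open>1 / d = limit_var * (1 - 2 * a)\<close> by (simp add: mult_ac)
      qed
      moreover have "v * N / 2 * b + v * ((1 - b + e) * N) / 2 - v * N / 2 = v * N / 2 * e" for v N b e :: real
        by (simp add: field_simps)
      ultimately show ?thesis unfolding shrink_sq[OF m] by (simp only:)
    qed
    moreover have "limit_var * (norm s)\<^sup>2 / 2 * (a\<^sup>2 / (real m * real (Suc m))) \<le> limit_var * Q * (1 / D)"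
    proof (intro mult_mono)
      show "limit_var * (norm s)\<^sup>2 / 2 \<le> limit_var * Q"
        using limit_var_pos mult_left_mono[of "(norm s)\<^sup>2 / 2" Q limit_var] by (simp add: Q_def)
      have "sqrt (real m) \<le> real m" using m self_le_power[of "real m" 2] by (intro real_le_lsqrt) auto
      then have "D \<le> real m * real (Suc m)" unfolding D_def by (intro mult_right_mono) auto
      moreover have "a\<^sup>2 \<le> 1" using a_upper a_ge_minus_1 by (simp add: abs_square_le_1 abs_le_iff)
      ultimately show "a\<^sup>2 / (real m * real (Suc m)) \<le> 1 / D" using D by (intro frac_le) auto
    qed (use limit_var_pos Q0 D in auto)
    moreover have "limit_var * (norm s)\<^sup>2 / 2 * (a\<^sup>2 / (real m * real (Suc m))) \<ge> 0" using limit_var_pos by simp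
    ultimately show ?thesis by (simp only: abs_of_nonneg times_divide_eq_right mult_1_right)
  qed
  let ?A = "urn_char a (Suc m) t" and ?B = "complex_of_real k * urn_char a m ((1 + a / real m) *\<^sub>R t)"
    and ?C = "complex_of_real (k * ?g (shrink m *\<^sub>R s))" and ?E = "complex_of_real (?g s)"
  have "gap (Suc m) s = cmod ((?A - ?B) + (?B - ?C) + (?C - ?E))"
    by (simp add: gap_def t_def)
  also have "\<dots> \<le> cmod (?A - ?B) + cmod (?B - ?C) + cmod (?C - ?E)"
    by (meson add_right_mono norm_triangle_ineq order_trans)
  also have "cmod (?C - ?E) = \<bar>k * ?g (shrink m *\<^sub>R s) - ?g s\<bar>"
    by (simp only: of_real_diff[symmetric] norm_of_real)
  finally have "gap (Suc m) s \<le> (5 + 2 * d * growth) * Q / D + gap m (shrink m *\<^sub>R s) + limit_var * Q / D"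
    using e1 e2 e3 by linarith
  also have "\<dots> = gap m (shrink m *\<^sub>R s) + gap_const * Q / D"
    by (simp add: gap_const_def add_divide_distrib algebra_simps)
  finally show ?thesis by (simp add: Q_def D_def)
qed

text \<open>The factor \<open>max (shrink\<^sup>2) (shrink\<^sup>4)\<close> bounds the effect of the contraction on \<open>|s|\<^sup>2 + |s|\<^sup>4\<close>.\<close>
primrec gap_rate :: "nat \<Rightarrow> real" where
  "gap_rate 0 = 1 + limit_var"
| "gap_rate (Suc m) = (if m = 0 then 1 + limit_var else
     max ((shrink m)\<^sup>2) ((shrink m) ^ 4) * gap_rate m + gap_const / (sqrt (real m) * real (Suc m)))"

lemma gap_const_pos: "gap_const > 0"
  using d_ge_1 growth(1) limit_var_pos mult_nonneg_nonneg[of "2 * d" growth] unfolding gap_const_def by linarith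

lemma gap_rate_nonneg: "gap_rate m \<ge> 0"
proof (induction m)
  case (Suc m)
  have "0 \<le> max ((shrink m)\<^sup>2) ((shrink m) ^ 4)" by (rule max.coboundedI1) simp
  with Suc have "0 \<le> max ((shrink m)\<^sup>2) ((shrink m) ^ 4) * gap_rate m" by (rule mult_nonneg_nonneg[rotated])
  moreover have "0 \<le> gap_const / (sqrt (real m) * real (Suc m))" using gap_const_pos by simp
  ultimately show ?case using limit_var_pos by (simp only: gap_rate.simps split: if_split) linarith
qed (use limit_var_pos in auto)

text \<open>Dividing the gap by \<open>|s|\<^sup>2 + |s|\<^sup>4\<close> converts a contraction of the argument into a contraction of
  the error.  At time one the gap is of order \<open>|s|\<^sup>2\<close> because the first step has mean zero.\<close>
theorem gap_le:
  assumes "m \<ge> 1"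
  shows "gap m s \<le> gap_rate m * ((norm s)\<^sup>2 + norm s ^ 4)"
  using assms
proof (induction m arbitrary: s rule: dec_induct)
  case base
  let ?z = "\<lambda>c::'n counts. position c"
  have mean: "urn_exp a 1 (\<lambda>c. complex_of_real (s \<bullet> position (c::'n counts))) = 0"
  proof -
    have "urn_exp a 1 (\<lambda>c. complex_of_real (s \<bullet> position (c::'n counts)))
       = complex_of_real (\<Sum>y\<in>UNIV. 1 / (2 * d) * (s \<bullet> dir y))"
      by (simp add: position_incr position_zero urn_weight_def d scaleR_conv_of_real)
    also have "(\<Sum>y\<in>UNIV. 1 / (2 * d) * (s \<bullet> dir (y :: 'n \<times> bool))) = 0"
      by (simp add: sum_dirs dir_def inner_minus_right)
    finally show ?thesis by simp
  qed
  have "urn_char a 1 s - 1 = urn_exp a 1 (\<lambda>c::'n counts. iexp (s \<bullet> position c) - (1 + \<i> * complex_of_real (s \<bullet> position c)))"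
    unfolding urn_exp_diff urn_exp_add urn_exp_mult mean urn_char_def by (simp only: urn_exp_const) simp
  also have "cmod \<dots> \<le> urn_exp a 1 (\<lambda>c::'n counts. (norm s)\<^sup>2 / 2 * (norm (position c))\<^sup>2)"
  proof (intro order_trans[OF norm_urn_exp_le] urn_exp_mono)
    fix c :: "'n counts"
    have "cmod (iexp (s \<bullet> position c) - (1 + \<i> * complex_of_real (s \<bullet> position c))) \<le> \<bar>s \<bullet> position c\<bar>\<^sup>2 / 2"
      using iexp_approx1[of "s \<bullet> position c" 1] by (simp add: numeral_eq_Suc)
    also have "\<dots> \<le> (norm s * norm (position c))\<^sup>2 / 2"
      by (intro divide_right_mono power_mono Cauchy_Schwarz_ineq2) auto
    finally show "cmod (iexp (s \<bullet> position c) - (1 + \<i> * complex_of_real (s \<bullet> position c))) \<le> (norm s)\<^sup>2 / 2 * (norm (position c))\<^sup>2"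
      by (simp add: power_mult_distrib)
  qed
  also have "\<dots> = (norm s)\<^sup>2 / 2 * urn_exp a 1 (\<lambda>c::'n counts. (norm (position c))\<^sup>2)" by (rule urn_exp_mult)
  also have "urn_exp a 1 (\<lambda>c::'n counts. (norm (position c))\<^sup>2) = 1"
    by (simp add: position_incr position_zero urn_weight_def card_cartesian_product flip: UNIV_Times_UNIV)
  finally have 1: "cmod (urn_char a 1 s - 1) \<le> (norm s)\<^sup>2"
    using zero_le_power2[of "norm s"] by linarith
  have 2: "\<bar>1 - exp (- (limit_var * (norm s)\<^sup>2 / 2))\<bar> \<le> limit_var * (norm s)\<^sup>2"
  proof -
    have "0 \<le> limit_var * (norm s)\<^sup>2" using limit_var_pos by simp
    then show ?thesis using exp_minus_lipschitz[of 0 "limit_var * (norm s)\<^sup>2 / 2"] by simp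
  qed
  have "gap 1 s = cmod ((urn_char a 1 s - 1) + complex_of_real (1 - exp (- (limit_var * (norm s)\<^sup>2 / 2))))"
    by (simp add: gap_def)
  also have "\<dots> \<le> (norm s)\<^sup>2 + limit_var * (norm s)\<^sup>2"
    by (rule order_trans[OF norm_triangle_ineq add_mono[OF 1]]) (use 2 in \<open>simp only: norm_of_real\<close>)
  also have "\<dots> \<le> gap_rate 1 * ((norm s)\<^sup>2 + norm s ^ 4)"
    using limit_var_pos by (simp add: algebra_simps)
  finally show ?case .
next
  case (step m)
  let ?Q = "\<lambda>s :: real ^ 'n. (norm s)\<^sup>2 + norm s ^ 4" and ?\<kappa> = "max ((shrink m)\<^sup>2) ((shrink m) ^ 4)"
  have "?Q (shrink m *\<^sub>R s) = (shrink m)\<^sup>2 * (norm s)\<^sup>2 + (shrink m) ^ 4 * norm s ^ 4"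
    by (simp add: power_mult_distrib power_even_abs)
  also have "\<dots> \<le> ?\<kappa> * (norm s)\<^sup>2 + ?\<kappa> * norm s ^ 4"
    by (intro add_mono mult_right_mono) auto
  finally have Q: "?Q (shrink m *\<^sub>R s) \<le> ?\<kappa> * ?Q s" by (simp add: distrib_left)
  have "gap (Suc m) s \<le> gap m (shrink m *\<^sub>R s) + gap_const * ?Q s / (sqrt (real m) * real (Suc m))"
    by (rule gap_step[OF step(1)])
  also have "gap m (shrink m *\<^sub>R s) \<le> gap_rate m * ?Q (shrink m *\<^sub>R s)" by (rule step.IH)
  also have "\<dots> \<le> gap_rate m * (?\<kappa> * ?Q s)" by (intro mult_left_mono Q gap_rate_nonneg)
  also have "gap_rate m * (?\<kappa> * ?Q s) + gap_const * ?Q s / (sqrt (real m) * real (Suc m)) = gap_rate (Suc m) * ?Q s"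
    using step(1) by (simp add: algebra_simps)
  finally show ?case by simp
qed

lemma gap_rate_tendsto_0: "gap_rate \<longlonglongrightarrow> 0"
proof -
  define c where "c = (1 - 2 * a) / 2"
  have c: "c > 0" using a_upper by (simp add: c_def)
  \<comment> \<open>From here on \<open>a\<^sup>2 / m \<le> c\<close>, so the second order term of \<open>shrink_sq\<close> costs at most half of the contraction.\<close>
  define n0 where "n0 = max 1 (nat \<lceil>1 / c\<rceil>)"
  show ?thesis
  proof (rule robbins_monro_tendsto_0[where c=c and ?n0.0=n0 and e="\<lambda>m. gap_const / sqrt (real m)"])
    fix m assume m: "m \<ge> n0"
    then have m1: "m \<ge> 1" and "real m \<ge> 1 / c" by (auto simp: n0_def nat_le_iff ceiling_le_iff)
    then have "1 \<le> c * real m" using c by (simp add: field_simps)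
    moreover have "a\<^sup>2 \<le> 1" using a_upper a_ge_minus_1 by (simp add: abs_square_le_1 abs_le_iff)
    ultimately have "a\<^sup>2 / real m \<le> c" using m1 by (simp add: field_simps)
    then have "a\<^sup>2 / real m / real (Suc m) \<le> c / real (Suc m)" by (intro divide_right_mono) auto
    then have s: "(shrink m)\<^sup>2 \<le> 1 - c / real (Suc m)"
    proof -
      have "(1 - 2 * a) / real (Suc m) = c / real (Suc m) + c / real (Suc m)"
        unfolding add_divide_distrib[symmetric] by (simp only: c_def field_sum_of_halves)
      moreover have "a\<^sup>2 / (real m * real (Suc m)) = a\<^sup>2 / real m / real (Suc m)" by simp
      ultimately show ?thesis using \<open>a\<^sup>2 / real m / real (Suc m) \<le> c / real (Suc m)\<close>
        unfolding shrink_sq[OF m1] by linarith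
    qed
    then have s1: "(shrink m)\<^sup>2 \<le> 1" using c divide_nonneg_nonneg[of c "real (Suc m)"] by linarith
    have "shrink m ^ 4 = (shrink m)\<^sup>2 * (shrink m)\<^sup>2" by (simp add: power2_eq_square numeral_eq_Suc)
    also have "\<dots> \<le> (shrink m)\<^sup>2 * 1" using s1 by (intro mult_left_mono) auto
    finally have "max ((shrink m)\<^sup>2) ((shrink m) ^ 4) \<le> 1 - c / real (Suc m)" using s by simp
    then have "max ((shrink m)\<^sup>2) ((shrink m) ^ 4) * gap_rate m \<le> (1 - c / real (Suc m)) * gap_rate m"
      by (intro mult_right_mono gap_rate_nonneg)
    then show "gap_rate (Suc m) \<le> (1 - c / real (Suc m)) * gap_rate m + gap_const / sqrt (real m) / real (Suc m)"
      using m1 by simp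
  next
    show "(\<lambda>m. gap_const / sqrt (real m)) \<longlonglongrightarrow> 0"
      by (intro tendsto_divide_0[OF tendsto_const] filterlim_at_top_imp_at_infinity filterlim_compose[OF sqrt_at_top] filterlim_real_sequentially)
  qed (use gap_rate_nonneg c in auto)
qed

end

section \<open>The action of the step matrices on the directions\<close>

lemma dir_nonzero [simp]: "dir y \<noteq> 0"
  using norm_dir[of y] by (metis norm_zero zero_neq_one)

lemma inj_dir: "inj (dir :: 'n::finite \<times> bool \<Rightarrow> real ^ 'n)"
proof (rule injI)
  fix y z :: "'n \<times> bool" assume eq: "dir y = dir z"
  have "dir y $ fst y = (if snd y then 1 else - 1)" by (simp add: dir_def)
  moreover have "dir z $ fst y = (if fst y = fst z then if snd z then 1 else - 1 else 0)"
    by (simp add: dir_def axis_def)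
  ultimately have "(if snd y then 1 else - 1 :: real) = (if fst y = fst z then if snd z then 1 else - 1 else 0)"
    using eq by metis
  then show "y = z" by (intro prod_eqI) (auto split: if_splits)
qed

lemma dir_eq_iff [simp]: "dir y = dir z \<longleftrightarrow> y = z"
  using inj_dir by (auto dest: injD)

text \<open>The effect of the \<open>k\<close>-th power of the cyclic matrix on the number \<open>j\<close> of a basis vector.\<close>
definition shift :: "nat \<Rightarrow> nat \<Rightarrow> nat \<Rightarrow> nat" where
  "shift d k j = (if k < j then j - k else j + d - k)"

lemma shift_range: "k < d \<Longrightarrow> j \<in> {1..d} \<Longrightarrow> shift d k j \<in> {1..d}"
  by (auto simp: shift_def)

lemma shift_inj: "k < d \<Longrightarrow> k' < d \<Longrightarrow> j \<in> {1..d} \<Longrightarrow> shift d k j = shift d k' j \<Longrightarrow> k = k'"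
  by (auto simp: shift_def split: if_splits)

locale labelling =
  fixes lab :: "nat \<Rightarrow> 'n::finite"
  assumes lab: "bij_betw lab {1..CARD('n)} UNIV"
begin

lemma lab_eq_iff: "i \<in> {1..CARD('n)} \<Longrightarrow> j \<in> {1..CARD('n)} \<Longrightarrow> lab i = lab j \<longleftrightarrow> i = j"
  using lab unfolding bij_betw_def by (meson inj_on_eq_iff)

lemma obtain_lab:
  obtains j where "j \<in> {1..CARD('n)}" "i = lab j"
  using lab unfolding bij_betw_def by (metis UNIV_I imageE)

lemma cyc_mat_axis:
  assumes j: "j \<in> {1..CARD('n)}"
  shows "cyc_mat lab *v axis (lab j) 1 = axis (lab (if j = 1 then CARD('n) else j - 1)) 1"
proof (rule vec_eq_iff[THEN iffD2], rule allI)
  fix x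
  have "(cyc_mat lab *v axis (lab j) 1) $ x = cyc_mat lab $ x $ lab j"
    by (simp add: matrix_vector_mult_basis column_def)
  also have "\<dots> = (if x = lab (if j = 1 then CARD('n) else j - 1) then 1 else 0)"
  proof -
    have "((\<exists>i\<in>{1..<CARD('n)}. x = lab i \<and> lab j = lab (i + 1)) \<or> (x = lab CARD('n) \<and> lab j = lab 1))
      \<longleftrightarrow> x = lab (if j = 1 then CARD('n) else j - 1)"
    proof (cases "j = 1")
      case True
      then show ?thesis using j by (auto simp: lab_eq_iff)
    next
      case False
      have "(\<exists>i\<in>{1..<CARD('n)}. x = lab i \<and> lab j = lab (i + 1)) \<longleftrightarrow> x = lab (j - 1)"
      proof
        assume "\<exists>i\<in>{1..<CARD('n)}. x = lab i \<and> lab j = lab (i + 1)"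
        then obtain i where "i \<in> {1..<CARD('n)}" "x = lab i" "lab j = lab (i + 1)" by blast
        moreover from this have "j = i + 1" using j lab_eq_iff[of j "i + 1"] by auto
        ultimately show "x = lab (j - 1)" by simp
      next
        assume "x = lab (j - 1)"
        then show "\<exists>i\<in>{1..<CARD('n)}. x = lab i \<and> lab j = lab (i + 1)"
          using False j by (intro bexI[of _ "j - 1"]) auto
      qed
      moreover have "lab j \<noteq> lab 1" using False j lab_eq_iff[of j 1] by auto
      ultimately show ?thesis using False by simp
    qed
    then show ?thesis unfolding cyc_mat_def by simp
  qed
  finally show "(cyc_mat lab *v axis (lab j) 1) $ x = axis (lab (if j = 1 then CARD('n) else j - 1)) 1 $ x"
    by (simp add: axis_def)
qed

lemma mat_power_Suc: "mat_power B (Suc k) *v x = B *v (mat_power B k *v x)"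
  by (simp add: mat_power_def matrix_vector_mul_assoc)

lemma mat_power_axis:
  assumes j: "j \<in> {1..CARD('n)}" and "k < CARD('n)"
  shows "mat_power (cyc_mat lab) k *v axis (lab j) 1 = axis (lab (shift CARD('n) k j)) 1"
  using assms(2)
proof (induction k)
  case 0
  then show ?case using j by (simp add: mat_power_def shift_def)
next
  case (Suc k)
  have "(if shift CARD('n) k j = 1 then CARD('n) else shift CARD('n) k j - 1) = shift CARD('n) (Suc k) j"
    using j Suc.prems by (auto simp: shift_def)
  then show ?case
    using Suc cyc_mat_axis[OF shift_range[of k "CARD('n)" j]] j by (simp add: mat_power_Suc)
qed

text \<open>The nonzero values of the random matrices, indexed by an exponent below \<open>d\<close> and a sign.\<close>
definition step_mat :: "nat \<times> bool \<Rightarrow> real ^ 'n ^ 'n" where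
  "step_mat \<kappa> = (if snd \<kappa> then mat_power (cyc_mat lab) (fst \<kappa>) else - mat_power (cyc_mat lab) (fst \<kappa>))"

definition step_ids :: "(nat \<times> bool) set" where
  "step_ids = {..<CARD('n)} \<times> UNIV"

text \<open>The permutation of the directions induced by \<open>step_mat\<close>.\<close>
definition act :: "'n \<times> bool \<Rightarrow> nat \<times> bool \<Rightarrow> 'n \<times> bool" where
  "act y \<kappa> = (lab (shift CARD('n) (fst \<kappa>) (inv_into {1..CARD('n)} lab (fst y))), snd y = snd \<kappa>)"

lemma finite_step_ids [simp]: "finite step_ids"
  by (simp add: step_ids_def)

lemma act_lab: "j \<in> {1..CARD('n)} \<Longrightarrow> act (lab j, b) \<kappa> = (lab (shift CARD('n) (fst \<kappa>) j), b = snd \<kappa>)"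
  using bij_betw_inv_into_left[OF lab] by (simp add: act_def)

lemma matrix_neg_vector: "(- B) *v x = - (B *v (x :: real ^ 'k::finite))"
  by (simp add: matrix_vector_mult_def vec_eq_iff sum_negf)

lemma matrix_vector_neg: "B *v (- x) = - (B *v (x :: real ^ 'k::finite))"
  by (simp add: matrix_vector_mult_def vec_eq_iff sum_negf)

lemma step_mat_dir:
  assumes "\<kappa> \<in> step_ids"
  shows "step_mat \<kappa> *v dir y = dir (act y \<kappa>)"
proof -
  obtain j where j: "j \<in> {1..CARD('n)}" "fst y = lab j" by (rule obtain_lab)
  then have y: "y = (lab j, snd y)" by (cases y) simp
  have k: "fst \<kappa> < CARD('n)" using assms by (auto simp: step_ids_def)
  show ?thesis
    unfolding act_lab[OF j(1), of "snd y" \<kappa>, folded y] using mat_power_axis[OF j(1) k]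
    by (auto simp: step_mat_def dir_def j(2) matrix_neg_vector matrix_vector_neg)
qed

text \<open>The nonzero matrices act simply transitively on the directions.  Their distinctness and the
  Markov property of the counts both rest on this.\<close>
lemma act_bij: "bij_betw (act y) step_ids UNIV"
proof -
  obtain j where j: "j \<in> {1..CARD('n)}" "fst y = lab j" by (rule obtain_lab)
  then have y: "y = (lab j, snd y)" by (cases y) simp
  have inj: "inj_on (act y) step_ids"
  proof (rule inj_onI)
    fix \<kappa> \<kappa>' assume \<kappa>: "\<kappa> \<in> step_ids" "\<kappa>' \<in> step_ids" and eq: "act y \<kappa> = act y \<kappa>'"
    have k: "fst \<kappa> < CARD('n)" "fst \<kappa>' < CARD('n)" using \<kappa> by (auto simp: step_ids_def)
    from eq have "lab (shift CARD('n) (fst \<kappa>) j) = lab (shift CARD('n) (fst \<kappa>') j)" and s: "(snd y = snd \<kappa>) = (snd y = snd \<kappa>')"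
      unfolding act_lab[OF j(1), of "snd y", folded y] by auto
    then have "shift CARD('n) (fst \<kappa>) j = shift CARD('n) (fst \<kappa>') j"
      using lab_eq_iff shift_range[OF k(1) j(1)] shift_range[OF k(2) j(1)] by blast
    then have "fst \<kappa> = fst \<kappa>'" using shift_inj[OF k j(1)] by blast
    with s show "\<kappa> = \<kappa>'" by (intro prod_eqI) auto
  qed
  moreover have "act y ` step_ids = UNIV"
  proof (rule card_seteq)
    have "card (act y ` step_ids) = card (step_ids :: (nat \<times> bool) set)" by (rule card_image[OF inj])
    also have "\<dots> = card (UNIV :: ('n \<times> bool) set)"
      by (simp add: step_ids_def card_cartesian_product flip: UNIV_Times_UNIV)
    finally show "card (UNIV :: ('n \<times> bool) set) \<le> card (act y ` step_ids)" by simp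
  qed auto
  ultimately show ?thesis by (simp add: bij_betw_def)
qed

lemma act_id: "act y (0, True) = y"
proof -
  obtain j where j: "j \<in> {1..CARD('n)}" "fst y = lab j" by (rule obtain_lab)
  then have y: "y = (lab j, snd y)" by (cases y) simp
  then show ?thesis using j act_lab[OF j(1), of "snd y" "(0, True)", folded y] by (auto simp: shift_def prod_eq_iff)
qed

lemma id_in_step_ids: "(0, True) \<in> step_ids"
  by (simp add: step_ids_def)

lemma act_eq_self_iff: "\<kappa> \<in> step_ids \<Longrightarrow> act y \<kappa> = y \<longleftrightarrow> \<kappa> = (0, True)"
  using act_bij[of y] act_id[of y] id_in_step_ids unfolding bij_betw_def by (metis inj_on_eq_iff)

lemma inj_on_step_mat: "inj_on step_mat step_ids"
proof (rule inj_onI)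
  fix \<kappa> \<kappa>' assume \<kappa>: "\<kappa> \<in> step_ids" "\<kappa>' \<in> step_ids" and "step_mat \<kappa> = step_mat \<kappa>'"
  then have "dir (act (undefined, True) \<kappa>) = dir (act (undefined, True) \<kappa>')" by (simp flip: step_mat_dir)
  then show "\<kappa> = \<kappa>'" using act_bij[of "(undefined, True)"] \<kappa> unfolding bij_betw_def dir_eq_iff by (meson inj_onD)
qed

lemma step_mat_nonzero: "\<kappa> \<in> step_ids \<Longrightarrow> step_mat \<kappa> \<noteq> 0"
  using step_mat_dir[of \<kappa> "(undefined, True)"] dir_nonzero by (metis matrix_vector_mult_0)

text \<open>Averaging over the matrices is averaging over all new directions with weight \<open>q\<close>, corrected by
  \<open>p - q\<close> at the old direction, which only the identity matrix preserves.\<close>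
lemma sum_step_ids:
  fixes g :: "'n \<times> bool \<Rightarrow> 'v::real_vector"
  shows "(\<Sum>\<kappa>\<in>step_ids. (if \<kappa> = (0, True) then p else q) *\<^sub>R g (act y \<kappa>))
    = q *\<^sub>R (\<Sum>z\<in>UNIV. g z) + (p - q) *\<^sub>R g y"
proof -
  have "(\<Sum>\<kappa>\<in>step_ids. (if \<kappa> = (0, True) then p else q) *\<^sub>R g (act y \<kappa>))
     = (\<Sum>\<kappa>\<in>step_ids. (\<lambda>z. (if z = y then p else q) *\<^sub>R g z) (act y \<kappa>))"
    by (intro sum.cong refl) (simp add: act_eq_self_iff)
  also have "\<dots> = (\<Sum>z\<in>UNIV. (if z = y then p else q) *\<^sub>R g z)"
    by (rule sum.reindex_bij_betw[OF act_bij])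
  also have "\<dots> = (\<Sum>z\<in>UNIV. q *\<^sub>R g z + (if z = y then (p - q) *\<^sub>R g z else 0))"
    by (intro sum.cong refl) (simp add: algebra_simps)
  also have "\<dots> = q *\<^sub>R (\<Sum>z\<in>UNIV. g z) + (p - q) *\<^sub>R g y"
    by (simp add: sum.distrib scaleR_sum_right)
  finally show ?thesis .
qed

end

section \<open>The Markov chain of counts\<close>

definition add_step :: "'n::finite counts \<Rightarrow> real ^ 'n \<Rightarrow> 'n counts" where
  "add_step c x = (\<lambda>y. c y + (if x = dir y then 1 else 0))"

lemma add_step_dir [simp]: "add_step c (dir y) = incr c y"
  by (auto simp: add_step_def incr_def)

lemma add_step_0 [simp]: "add_step c 0 = c"
  using dir_nonzero by (auto simp: add_step_def fun_eq_iff)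

text \<open>The number of steps in each direction; steps outside the directions are not counted, so this
  is defined on the whole probability space.\<close>
primrec counts :: "(nat \<Rightarrow> 'a \<Rightarrow> real ^ 'n::finite) \<Rightarrow> nat \<Rightarrow> 'a \<Rightarrow> 'n counts" where
  "counts X 0 \<omega> = (\<lambda>_. 0)"
| "counts X (Suc n) \<omega> = add_step (counts X n \<omega>) (X (Suc n) \<omega>)"

lemma counts_le: "counts X n \<omega> y \<le> n"
  by (induction n arbitrary: y) (auto simp: add_step_def le_SucI)

lemma counts_eq_sum: "counts X n \<omega> y = (\<Sum>k\<in>{1..n}. if X k \<omega> = dir y then 1 else 0)"
  by (induction n) (simp_all add: add_step_def)

lemma counts_measurable:
  fixes X :: "nat \<Rightarrow> 'a \<Rightarrow> real ^ 'n::finite"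
  assumes "\<And>k. k \<in> {1..n} \<Longrightarrow> X k \<in> borel_measurable N"
  shows "counts X n \<in> measurable N (count_space UNIV)"
proof -
  have "(\<lambda>\<omega>. counts X n \<omega> y) \<in> measurable N (count_space UNIV)" for y
    unfolding counts_eq_sum
  proof (rule measurable_sum_nat)
    fix k assume "k \<in> {1..n}"
    then have [measurable]: "X k \<in> borel_measurable N" by (rule assms)
    show "(\<lambda>\<omega>. if X k \<omega> = dir y then 1 else 0 :: nat) \<in> measurable N (count_space UNIV)"
      by measurable
  qed
  then have *[measurable]: "(\<lambda>\<omega>. counts X n \<omega> y) \<in> measurable N (count_space UNIV)" for y .
  show ?thesis
    unfolding measurable_count_space_eq_countable[OF countableI_type]
  proof safe
    fix c :: "'n counts"
    have "counts X n -` {c} \<inter> space N = {\<omega>\<in>space N. \<forall>y. counts X n \<omega> y = c y}"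
      by (auto simp: fun_eq_iff)
    also have "\<dots> \<in> sets N" by measurable
    finally show "counts X n -` {c} \<inter> space N \<in> sets N" .
  qed auto
qed

text \<open>The direction of a step, if it has one.  The label takes finitely many values, so expectations of
  its functions are finite sums.\<close>
definition label :: "real ^ 'n::finite \<Rightarrow> ('n \<times> bool) option" where
  "label x = (if \<exists>y. x = dir y then Some (THE y. x = dir y) else None)"

lemma label_dir [simp]: "label (dir y) = Some y"
  by (auto simp: label_def)

lemma label_0 [simp]: "label 0 = None"
  using dir_nonzero by (auto simp: label_def)

lemma label_eq_Some: "label x = Some y \<longleftrightarrow> x = dir y"
proof
  assume *: "label x = Some y"
  then obtain z where "x = dir z" unfolding label_def by (metis option.distinct(1))
  with * show "x = dir y" by simp
qed simp

lemma label_measurable: "(label :: real ^ 'n::finite \<Rightarrow> _) \<in> measurable borel (count_space UNIV)"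
proof -
  have S: "label -` {Some y} = {dir y}" for y :: "'n \<times> bool" by (auto simp: label_eq_Some)
  have N: "label -` {None} = - (\<Union>y\<in>UNIV. {dir y :: real ^ 'n})"
    by (auto simp: label_def)
  have "label -` {o'} \<inter> space borel \<in> sets (borel :: (real ^ 'n) measure)" for o' :: "('n \<times> bool) option"
    by (cases o') (auto simp: S N intro!: borel_comp sets.finite_UN)
  then show ?thesis
    unfolding measurable_count_space_eq_countable[OF countableI_type] by auto
qed

lemma sum_labels:
  fixes f :: "('n::finite \<times> bool) option \<Rightarrow> 'v::real_vector"
  shows "(\<Sum>k\<in>{1..n}. f (label (X k \<omega>)))
    = (\<Sum>y\<in>UNIV. real (counts X n \<omega> y) *\<^sub>R f (Some y)) + (real n - real (moves (counts X n \<omega>))) *\<^sub>R f None"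
proof -
  have "f (label x) = (\<Sum>y\<in>UNIV. (if x = dir y then 1 else 0) *\<^sub>R f (Some y)) + (1 - (\<Sum>y\<in>UNIV. if x = dir y then 1 else 0)) *\<^sub>R f None"
    for x :: "real ^ 'n"
  proof (cases "label x")
    case None
    then have "x \<noteq> dir y" for y by auto
    then show ?thesis using None by simp
  next
    case (Some y)
    then have "x = dir y" by (simp add: label_eq_Some)
    then show ?thesis by (simp add: if_distrib[of "\<lambda>c. c *\<^sub>R _"] cong: if_cong)
  qed
  then have "(\<Sum>k\<in>{1..n}. f (label (X k \<omega>))) = (\<Sum>k\<in>{1..n}. (\<Sum>y\<in>UNIV. (if X k \<omega> = dir y then 1 else 0) *\<^sub>R f (Some y)) + (1 - (\<Sum>y\<in>UNIV. if X k \<omega> = dir y then 1 else 0)) *\<^sub>R f None)"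
    by (intro sum.cong refl)
  also have "\<dots> = (\<Sum>y\<in>UNIV. (\<Sum>k\<in>{1..n}. if X k \<omega> = dir y then 1 else 0) *\<^sub>R f (Some y))
      + (real n - (\<Sum>y\<in>UNIV. \<Sum>k\<in>{1..n}. if X k \<omega> = dir y then 1 else 0)) *\<^sub>R f None"
    unfolding sum.distrib
  proof (rule arg_cong2[where f="(+)"])
    show "(\<Sum>k\<in>{1..n}. \<Sum>y\<in>UNIV. (if X k \<omega> = dir y then 1 else 0) *\<^sub>R f (Some y))
      = (\<Sum>y\<in>UNIV. (\<Sum>k\<in>{1..n}. if X k \<omega> = dir y then 1 else 0) *\<^sub>R f (Some y))"
      unfolding scaleR_sum_left by (rule sum.swap)
    show "(\<Sum>k\<in>{1..n}. (1 - (\<Sum>y\<in>UNIV. if X k \<omega> = dir y then 1 else 0)) *\<^sub>R f None)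
      = (real n - (\<Sum>y\<in>UNIV. \<Sum>k\<in>{1..n}. if X k \<omega> = dir y then 1 else 0)) *\<^sub>R f None"
      unfolding scaleR_sum_left[symmetric] sum_subtractf sum.swap[of _ "{1..n}" UNIV] by simp
  qed
  also have "\<dots> = (\<Sum>y\<in>UNIV. real (counts X n \<omega> y) *\<^sub>R f (Some y)) + (real n - real (moves (counts X n \<omega>))) *\<^sub>R f None"
    unfolding moves_def counts_eq_sum of_nat_sum by (simp add: if_distrib[of real] cong: if_cong)
  finally show ?thesis .
qed

text \<open>For finitely many values, independence of an event and a random element passes from events to
  expectations by linearity.\<close>
lemma (in prob_space) integral_indicator_finite_range:
  fixes g :: "'c::countable \<Rightarrow> 'v::{banach,second_countable_topology}"
  assumes \<Psi>: "\<Psi> \<in> measurable M (count_space UNIV)" and S: "finite S" "\<And>\<omega>. \<omega> \<in> space M \<Longrightarrow> \<Psi> \<omega> \<in> S"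
    and E: "E \<in> events" and ind: "\<And>s. prob (E \<inter> {\<omega>\<in>space M. \<Psi> \<omega> = s}) = \<pi> * prob {\<omega>\<in>space M. \<Psi> \<omega> = s}"
  shows "integrable M (\<lambda>\<omega>. indicator E \<omega> *\<^sub>R g (\<Psi> \<omega>))"
    and "(\<integral>\<omega>. indicator E \<omega> *\<^sub>R g (\<Psi> \<omega>) \<partial>M) = \<pi> *\<^sub>R (\<integral>\<omega>. g (\<Psi> \<omega>) \<partial>M)"
proof -
  have ev: "{\<omega>\<in>space M. \<Psi> \<omega> = s} \<in> events" for s using \<Psi> by measurable
  have eq: "indicator F \<omega> *\<^sub>R g (\<Psi> \<omega>) = (\<Sum>s\<in>S. indicator (F \<inter> {\<omega>\<in>space M. \<Psi> \<omega> = s}) \<omega> *\<^sub>R g s)" if "\<omega> \<in> space M" for \<omega> and F :: "'a set"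
  proof -
    have "(\<Sum>s\<in>S. indicator (F \<inter> {\<omega>\<in>space M. \<Psi> \<omega> = s}) \<omega> *\<^sub>R g s) = (\<Sum>s\<in>S. if s = \<Psi> \<omega> then indicator F \<omega> *\<^sub>R g s else 0)"
      using that by (intro sum.cong refl) (auto simp: indicator_def)
    also have "\<dots> = indicator F \<omega> *\<^sub>R g (\<Psi> \<omega>)" using S(1) S(2)[OF that] by simp
    finally show ?thesis by simp
  qed
  have int: "integrable M (\<lambda>\<omega>. \<Sum>s\<in>S. indicator (F \<inter> {\<omega>\<in>space M. \<Psi> \<omega> = s}) \<omega> *\<^sub>R g s)" if "F \<in> events" for F
    using that ev by (intro Bochner_Integration.integrable_sum integrable_scaleR_left) (auto simp: emeasure_eq_measure)
  have val: "(\<integral>\<omega>. (\<Sum>s\<in>S. indicator (F \<inter> {\<omega>\<in>space M. \<Psi> \<omega> = s}) \<omega> *\<^sub>R g s) \<partial>M) = (\<Sum>s\<in>S. prob (F \<inter> {\<omega>\<in>space M. \<Psi> \<omega> = s}) *\<^sub>R g s)"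
    if "F \<in> events" for F
    using that ev by (subst Bochner_Integration.integral_sum) (auto simp: emeasure_eq_measure intro!: integrable_scaleR_left)
  show "integrable M (\<lambda>\<omega>. indicator E \<omega> *\<^sub>R g (\<Psi> \<omega>))"
    using int[OF E] by (rule Bochner_Integration.integrable_cong[OF refl, THEN iffD2, rotated]) (rule eq)
  have "(\<integral>\<omega>. indicator E \<omega> *\<^sub>R g (\<Psi> \<omega>) \<partial>M) = (\<Sum>s\<in>S. prob (E \<inter> {\<omega>\<in>space M. \<Psi> \<omega> = s}) *\<^sub>R g s)"
    unfolding val[OF E, symmetric] by (rule Bochner_Integration.integral_cong[OF refl]) (rule eq)
  also have "\<dots> = \<pi> *\<^sub>R (\<Sum>s\<in>S. prob (space M \<inter> {\<omega>\<in>space M. \<Psi> \<omega> = s}) *\<^sub>R g s)"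
  proof -
    have "space M \<inter> {\<omega>\<in>space M. \<Psi> \<omega> = s} = {\<omega>\<in>space M. \<Psi> \<omega> = s}" for s by auto
    then show ?thesis by (simp add: ind scaleR_sum_right)
  qed
  also have "(\<Sum>s\<in>S. prob (space M \<inter> {\<omega>\<in>space M. \<Psi> \<omega> = s}) *\<^sub>R g s) = (\<integral>\<omega>. indicator (space M) \<omega> *\<^sub>R g (\<Psi> \<omega>) \<partial>M)"
    unfolding val[OF sets.top, symmetric] by (rule Bochner_Integration.integral_cong[OF refl]) (rule eq[symmetric])
  also have "\<dots> = (\<integral>\<omega>. g (\<Psi> \<omega>) \<partial>M)" by (rule Bochner_Integration.integral_cong) auto
  finally show "(\<integral>\<omega>. indicator E \<omega> *\<^sub>R g (\<Psi> \<omega>) \<partial>M) = \<pi> *\<^sub>R (\<integral>\<omega>. g (\<Psi> \<omega>) \<partial>M)" .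
qed

lemma (in prob_space) AE_in_finite_support:
  assumes F: "finite F" and ev: "\<And>x. x \<in> F \<Longrightarrow> {\<omega>\<in>space M. f \<omega> = x} \<in> events"
    and one: "(\<Sum>x\<in>F. prob {\<omega>\<in>space M. f \<omega> = x}) = 1"
  shows "AE \<omega> in M. f \<omega> \<in> F"
proof -
  have "prob (\<Union>x\<in>F. {\<omega>\<in>space M. f \<omega> = x}) = (\<Sum>x\<in>F. prob {\<omega>\<in>space M. f \<omega> = x})"
    by (rule finite_measure_finite_Union) (use F ev in \<open>auto simp: disjoint_family_on_def\<close>)
  then have "AE \<omega> in M. \<omega> \<in> (\<Union>x\<in>F. {\<omega>\<in>space M. f \<omega> = x})"
    using one by (intro AE_prob_1) simp
  then show ?thesis by eventually_elim auto
qed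

context merws
begin

sublocale labelling lab
  by standard (rule lab)

definition \<alpha> :: real where "\<alpha> = 1 - r"

lemma \<alpha>: "0 < \<alpha>" "\<alpha> < 1"
  using r by (auto simp: \<alpha>_def)

lemma weights_sum: "(p - q) + 2 * real CARD('n) * q = \<alpha>"
  using pqr by (simp add: \<alpha>_def algebra_simps)

definition history :: "nat \<Rightarrow> 'a measure" where
  "history n = vimage_algebra (space M) (\<lambda>\<omega>. \<lambda>k\<in>{1..n}. X k \<omega>) (\<Pi>\<^sub>M k\<in>{1..n}. borel)"

lemma X_measurable: "k \<ge> 1 \<Longrightarrow> X k \<in> borel_measurable M"
  by (rule X_rv)

lemma X_history_measurable:
  assumes "k \<in> {1..n}"
  shows "X k \<in> borel_measurable (history n)"
proof -
  have "(\<lambda>\<omega>. \<lambda>k\<in>{1..n}. X k \<omega>) \<in> measurable (history n) (\<Pi>\<^sub>M k\<in>{1..n}. borel)"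
    unfolding history_def by (rule measurable_vimage_algebra1) (auto simp: space_PiM)
  from measurable_compose[OF this measurable_component_singleton[OF assms]] assms
  show ?thesis by simp
qed

lemma space_history [simp]: "space (history n) = space M"
  by (simp add: history_def)

lemma sets_history_subset: "sets (history n) \<subseteq> events"
proof -
  have m: "(\<lambda>\<omega>. \<lambda>k\<in>{1..n}. X k \<omega>) \<in> measurable M (\<Pi>\<^sub>M k\<in>{1..n}. borel)"
    by (intro measurable_restrict X_rv) simp
  have "(\<lambda>\<omega>. \<lambda>k\<in>{1..n}. X k \<omega>) \<in> space M \<rightarrow> space (\<Pi>\<^sub>M k\<in>{1..n}. borel)"
    by (auto simp: space_PiM)
  from sets_vimage_algebra2[OF this] show ?thesis
    unfolding history_def using measurable_sets[OF m] by auto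
qed

definition weight :: "nat \<times> bool \<Rightarrow> real" where
  "weight \<kappa> = (if \<kappa> = (0, True) then p else q)"

lemma prob_step_mat:
  assumes n: "n \<ge> 1" and \<kappa>: "\<kappa> \<in> step_ids"
  shows "prob {\<omega>\<in>space M. A (Suc n) \<omega> = step_mat \<kappa>} = weight \<kappa>"
proof -
  obtain k b where kb: "\<kappa> = (k, b)" by (cases \<kappa>)
  have k: "k < CARD('n)" using \<kappa> by (simp add: kb step_ids_def)
  show ?thesis
    using A_id[OF n] A_neg[OF n] A_cyc[OF n, of k] A_neg_cyc[OF n, of k] k
    by (cases "k = 0"; cases b) (simp_all add: kb step_mat_def weight_def mat_power_def[of _ 0])
qed

lemma A_measurable: "n \<ge> 1 \<Longrightarrow> A (Suc n) \<in> borel_measurable M"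
  using A_rv by simp

lemma U_measurable: "n \<ge> 1 \<Longrightarrow> U (Suc n) \<in> measurable M (count_space UNIV)"
  using U_rv by simp

lemma A_event: "n \<ge> 1 \<Longrightarrow> {\<omega>\<in>space M. A (Suc n) \<omega> = B} \<in> events"
  using A_measurable by measurable

lemma U_event: "n \<ge> 1 \<Longrightarrow> {\<omega>\<in>space M. U (Suc n) \<omega> = k} \<in> events"
  using U_measurable by measurable

lemma sum_weight: "(\<Sum>\<kappa>\<in>step_ids. weight \<kappa>) = \<alpha>"
  using sum_step_ids[of p q "\<lambda>_. 1::real" undefined] weights_sum
  by (simp add: weight_def card_cartesian_product algebra_simps flip: UNIV_Times_UNIV)

lemma AE_A:
  assumes n: "n \<ge> 1"
  shows "AE \<omega> in M. A (Suc n) \<omega> = 0 \<or> (\<exists>\<kappa>\<in>step_ids. A (Suc n) \<omega> = step_mat \<kappa>)"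
proof -
  have "AE \<omega> in M. A (Suc n) \<omega> \<in> insert 0 (step_mat ` step_ids)"
  proof (rule AE_in_finite_support)
    have "(\<Sum>B\<in>insert 0 (step_mat ` step_ids). prob {\<omega>\<in>space M. A (Suc n) \<omega> = B})
      = prob {\<omega>\<in>space M. A (Suc n) \<omega> = 0} + (\<Sum>\<kappa>\<in>step_ids. prob {\<omega>\<in>space M. A (Suc n) \<omega> = step_mat \<kappa>})"
      using step_mat_nonzero by (subst sum.insert) (auto simp: sum.reindex[OF inj_on_step_mat])
    also have "\<dots> = r + \<alpha>" using A_zero[OF n] by (simp add: prob_step_mat[OF n] sum_weight)
    finally show "(\<Sum>B\<in>insert 0 (step_mat ` step_ids). prob {\<omega>\<in>space M. A (Suc n) \<omega> = B}) = 1"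
      by (simp add: \<alpha>_def)
  qed (use A_event[OF n] in auto)
  then show ?thesis by eventually_elim auto
qed

lemma AE_U:
  assumes n: "n \<ge> 1"
  shows "AE \<omega> in M. U (Suc n) \<omega> \<in> {1..n}"
proof (rule AE_in_finite_support)
  show "(\<Sum>k\<in>{1..n}. prob {\<omega>\<in>space M. U (Suc n) \<omega> = k}) = 1"
    using U_unif[OF n] n by simp
qed (use U_event[OF n] in auto)

lemma X1_event: "k \<ge> 1 \<Longrightarrow> {\<omega>\<in>space M. X k \<omega> = x} \<in> events"
  using X_measurable by measurable

lemma prob_X1: "prob {\<omega>\<in>space M. X 1 \<omega> = dir y} = 1 / (2 * real CARD('n))"
  using X1_pos[of "fst y"] X1_neg[of "fst y"] by (simp add: dir_def)

lemma AE_X1: "AE \<omega> in M. \<exists>y. X 1 \<omega> = dir y"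
proof -
  have "AE \<omega> in M. X 1 \<omega> \<in> range dir"
  proof (rule AE_in_finite_support)
    have "(\<Sum>x\<in>range dir. prob {\<omega>\<in>space M. X 1 \<omega> = x}) = (\<Sum>y\<in>UNIV. prob {\<omega>\<in>space M. X 1 \<omega> = dir y})"
      by (simp add: sum.reindex[OF inj_dir])
    also have "\<dots> = 1"
      by (simp only: prob_X1) (simp add: card_cartesian_product flip: UNIV_Times_UNIV)
    finally show "(\<Sum>x\<in>range dir. prob {\<omega>\<in>space M. X 1 \<omega> = x}) = 1" .
  qed (use X1_event in auto)
  then show ?thesis by eventually_elim auto
qed

text \<open>The directions together with zero are preserved by all values of the random matrices.\<close>
lemma AE_X_range: "AE \<omega> in M. \<forall>k\<in>{1..n}. X k \<omega> = 0 \<or> (\<exists>y. X k \<omega> = dir y)"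
proof (induction n)
  case (Suc n)
  have "AE \<omega> in M. X (Suc n) \<omega> = 0 \<or> (\<exists>y. X (Suc n) \<omega> = dir y)"
  proof (cases "n = 0")
    case True
    from AE_X1 show ?thesis by eventually_elim (simp add: True)
  next
    case False
    then have n: "n \<ge> 1" by simp
    from Suc AE_A[OF n] AE_U[OF n] AE_space show ?thesis
    proof eventually_elim
      case (elim \<omega>)
      have step: "X (Suc n) \<omega> = A (Suc n) \<omega> *v X (U (Suc n) \<omega>) \<omega>" using X_step[OF n elim(4)] by simp
      have "X (U (Suc n) \<omega>) \<omega> = 0 \<or> (\<exists>y. X (U (Suc n) \<omega>) \<omega> = dir y)" using elim(1,3) by blast
      then show ?case
        using elim(2) unfolding step by (auto simp: step_mat_dir)
    qed
  qed
  with Suc show ?case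
  proof eventually_elim
    case (elim \<omega>)
    show ?case
    proof
      fix k assume "k \<in> {1..Suc n}"
      then have "k = Suc n \<or> k \<in> {1..n}" by auto
      then show "X k \<omega> = 0 \<or> (\<exists>y. X k \<omega> = dir y)" using elim by blast
    qed
  qed
qed simp

lemma counts_measurable_history: "counts X n \<in> measurable (history n) (count_space UNIV)"
  by (rule counts_measurable) (rule X_history_measurable)

lemma history_measurable_imp: "f \<in> measurable (history n) N \<Longrightarrow> f \<in> measurable M N"
  using sets_history_subset[of n] by (auto simp: measurable_def)

lemma counts_rv: "counts X n \<in> measurable M (count_space UNIV)"
  by (rule history_measurable_imp[OF counts_measurable_history])

lemma counts_finite_range: "finite {c :: 'n counts. \<forall>y. c y \<le> n}"
proof -
  have "{c :: 'n counts. \<forall>y. c y \<le> n} = (\<Pi>\<^sub>E y\<in>UNIV. {..n})" by (auto simp: PiE_def Pi_def)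
  then show ?thesis by (simp add: finite_PiE)
qed

lemma integrable_counts [simp]:
  fixes h :: "'n counts \<Rightarrow> 'v::{banach,second_countable_topology}"
  shows "integrable M (\<lambda>\<omega>. h (counts X n \<omega>))"
proof -
  have "integrable M (\<lambda>\<omega>. indicator (space M) \<omega> *\<^sub>R h (counts X n \<omega>))"
    by (rule integral_indicator_finite_range(1)[OF counts_rv counts_finite_range[of n], where \<pi>=1])
       (auto simp: counts_le intro!: arg_cong[where f=prob])
  then show ?thesis by (rule Bochner_Integration.integrable_cong[OF refl, THEN iffD1, rotated]) simp
qed

lemma independent_step:
  assumes n: "n \<ge> 1" and E: "E \<in> sets (history n)"
  shows "prob ({\<omega>\<in>space M. A (Suc n) \<omega> = B} \<inter> {\<omega>\<in>space M. U (Suc n) \<omega> = k} \<inter> E)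
    = prob {\<omega>\<in>space M. A (Suc n) \<omega> = B} * prob {\<omega>\<in>space M. U (Suc n) \<omega> = k} * prob E"
proof -
  define G where "G = (\<lambda>j::nat. [{\<omega>\<in>space M. A (Suc n) \<omega> = B}, {\<omega>\<in>space M. U (Suc n) \<omega> = k}, E] ! j)"
  have "{\<omega>\<in>space M. A (Suc n) \<omega> = B} = A (n + 1) -` {B} \<inter> space M" by auto
  also have "\<dots> \<in> sets (vimage_algebra (space M) (A (n + 1)) borel)" by (rule in_vimage_algebra) simp
  finally have 0: "{\<omega>\<in>space M. A (Suc n) \<omega> = B} \<in> sets (vimage_algebra (space M) (A (n + 1)) borel)" .
  have "{\<omega>\<in>space M. U (Suc n) \<omega> = k} = U (n + 1) -` {k} \<inter> space M" by auto
  also have "\<dots> \<in> sets (vimage_algebra (space M) (U (n + 1)) (count_space UNIV))" by (rule in_vimage_algebra) simp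
  finally have 1: "{\<omega>\<in>space M. U (Suc n) \<omega> = k} \<in> sets (vimage_algebra (space M) (U (n + 1)) (count_space UNIV))" .
  have "prob (\<Inter>j\<in>{0,1,2}. G j) = (\<Prod>j\<in>{0,1,2}. prob (G j))"
    by (rule indep_setsD[OF AU_indep[OF n]]) (use 0 1 E in \<open>auto simp: G_def history_def\<close>)
  moreover have "(\<Inter>j\<in>{0,1,2}. G j) = {\<omega>\<in>space M. A (Suc n) \<omega> = B} \<inter> {\<omega>\<in>space M. U (Suc n) \<omega> = k} \<inter> E"
    by (auto simp: G_def)
  moreover have "(\<Prod>j\<in>{0,1,2}. prob (G j)) = prob {\<omega>\<in>space M. A (Suc n) \<omega> = B} * prob {\<omega>\<in>space M. U (Suc n) \<omega> = k} * prob E"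
    by (simp add: G_def)
  ultimately show ?thesis by simp
qed

text \<open>The pair of the current counts and the label of the remembered step is a function of the history,
  hence independent of the choice of the matrix and of the remembered time.\<close>
lemma expectation_step:
  fixes g :: "'n counts \<times> ('n \<times> bool) option \<Rightarrow> 'v::{banach,second_countable_topology}"
  assumes n: "n \<ge> 1" and k: "k \<in> {1..n}"
  defines "E \<equiv> \<lambda>B. {\<omega>\<in>space M. A (Suc n) \<omega> = B} \<inter> {\<omega>\<in>space M. U (Suc n) \<omega> = k}"
  shows "integrable M (\<lambda>\<omega>. g (counts X n \<omega>, label (X k \<omega>)))"
    and "integrable M (\<lambda>\<omega>. indicator (E B) \<omega> *\<^sub>R g (counts X n \<omega>, label (X k \<omega>)))"
    and "(\<integral>\<omega>. indicator (E B) \<omega> *\<^sub>R g (counts X n \<omega>, label (X k \<omega>)) \<partial>M)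
      = (prob {\<omega>\<in>space M. A (Suc n) \<omega> = B} / real n) *\<^sub>R (\<integral>\<omega>. g (counts X n \<omega>, label (X k \<omega>)) \<partial>M)"
proof -
  let ?\<Psi> = "\<lambda>\<omega>. (counts X n \<omega>, label (X k \<omega>))"
  have lab_m: "(\<lambda>\<omega>. label (X k \<omega>)) \<in> measurable (history n) (count_space UNIV)"
    by (rule measurable_compose[OF X_history_measurable[OF k] label_measurable])
  have \<Psi>h: "?\<Psi> \<in> measurable (history n) (count_space UNIV)"
    using measurable_Pair[OF counts_measurable_history[of n] lab_m]
    by (simp add: pair_measure_countable)
  note \<Psi> = history_measurable_imp[OF \<Psi>h]
  have ev: "{\<omega>\<in>space M. ?\<Psi> \<omega> = s} \<in> sets (history n)" for s
  proof -
    have "?\<Psi> -` {s} \<inter> space (history n) \<in> sets (history n)" by (rule measurable_sets[OF \<Psi>h]) simp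
    moreover have "?\<Psi> -` {s} \<inter> space (history n) = {\<omega>\<in>space M. ?\<Psi> \<omega> = s}" by auto
    ultimately show ?thesis by simp
  qed
  have fin: "finite ({c :: 'n counts. \<forall>y. c y \<le> n} \<times> (UNIV :: ('n \<times> bool) option set))"
    using counts_finite_range by simp
  have rng: "?\<Psi> \<omega> \<in> {c. \<forall>y. c y \<le> n} \<times> UNIV" for \<omega> by (simp add: counts_le)
  have EB: "E B \<in> events" unfolding E_def using A_event[OF n] U_event[OF n] by blast
  have ind: "prob (E B \<inter> {\<omega>\<in>space M. ?\<Psi> \<omega> = s}) = (prob {\<omega>\<in>space M. A (Suc n) \<omega> = B} / real n) * prob {\<omega>\<in>space M. ?\<Psi> \<omega> = s}" for s
    unfolding E_def independent_step[OF n ev] using U_unif[OF n k] by simp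
  note res = integral_indicator_finite_range[OF \<Psi> fin rng]
  show "integrable M (\<lambda>\<omega>. indicator (E B) \<omega> *\<^sub>R g (?\<Psi> \<omega>))"
    and "(\<integral>\<omega>. indicator (E B) \<omega> *\<^sub>R g (?\<Psi> \<omega>) \<partial>M) = (prob {\<omega>\<in>space M. A (Suc n) \<omega> = B} / real n) *\<^sub>R (\<integral>\<omega>. g (?\<Psi> \<omega>) \<partial>M)"
    by (rule res[OF EB ind])+
  have "integrable M (\<lambda>\<omega>. indicator (space M) \<omega> *\<^sub>R g (?\<Psi> \<omega>))"
    by (rule res(1)[OF sets.top, where \<pi>=1]) (auto intro!: arg_cong[where f=prob])
  then show "integrable M (\<lambda>\<omega>. g (?\<Psi> \<omega>))"
    by (rule Bochner_Integration.integrable_cong[OF refl, THEN iffD1, rotated]) simp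
qed

end

lemma integral_nested_sum:
  fixes f :: "'i \<Rightarrow> 'a \<Rightarrow> 'v::{banach,second_countable_topology}"
  assumes f: "\<And>k. k \<in> I \<Longrightarrow> integrable M (f k)" and g: "\<And>k \<kappa>. k \<in> I \<Longrightarrow> \<kappa> \<in> J \<Longrightarrow> integrable M (g k \<kappa>)"
  shows "(\<integral>\<omega>. (\<Sum>k\<in>I. f k \<omega> + (\<Sum>\<kappa>\<in>J. g k \<kappa> \<omega>)) \<partial>M)
    = (\<Sum>k\<in>I. (\<integral>\<omega>. f k \<omega> \<partial>M) + (\<Sum>\<kappa>\<in>J. (\<integral>\<omega>. g k \<kappa> \<omega> \<partial>M)))"
  using assms by simp

context merws
begin

text \<open>The transition operator of the counts at time \<open>n\<close>, acting on functions.\<close>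
definition transition :: "nat \<Rightarrow> ('n counts \<Rightarrow> 'v::real_vector) \<Rightarrow> 'n counts \<Rightarrow> 'v" where
  "transition n h c = (1 - \<alpha> * real (moves c) / real n) *\<^sub>R h c
     + (\<Sum>z\<in>UNIV. ((q * real (moves c) + (p - q) * real (c z)) / real n) *\<^sub>R h (incr c z))"

definition outcome :: "('n counts \<Rightarrow> 'v) \<Rightarrow> nat \<times> bool \<Rightarrow> 'n counts \<times> ('n \<times> bool) option \<Rightarrow> 'v" where
  "outcome h \<kappa> = (\<lambda>(c, o'). case o' of None \<Rightarrow> h c | Some y \<Rightarrow> h (incr c (act y \<kappa>)))"

text \<open>Summing over the remembered times \<open>k\<close> amounts to summing over the directions with multiplicity
  \<open>c y\<close>; the \<open>n - m\<close> zero steps reproduce themselves whatever the matrix is.\<close>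
lemma outcome_sum:
  fixes h :: "'n counts \<Rightarrow> 'v::real_vector"
  assumes n: "n \<ge> 1"
  shows "(\<Sum>k\<in>{1..n}. (r / real n) *\<^sub>R h (counts X n \<omega>) + (\<Sum>\<kappa>\<in>step_ids. (weight \<kappa> / real n) *\<^sub>R outcome h \<kappa> (counts X n \<omega>, label (X k \<omega>))))
    = transition n h (counts X n \<omega>)"
proof -
  define c where "c = counts X n \<omega>"
  define f where "f o' = (r / real n) *\<^sub>R h c + (\<Sum>\<kappa>\<in>step_ids. (weight \<kappa> / real n) *\<^sub>R outcome h \<kappa> (c, o'))" for o'
  have None: "f None = (1 / real n) *\<^sub>R h c"
  proof -
    have "f None = (r / real n + (\<Sum>\<kappa>\<in>step_ids. weight \<kappa>) / real n) *\<^sub>R h c"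
      by (simp add: f_def outcome_def scaleR_sum_left[symmetric] sum_divide_distrib scaleR_add_left)
    also have "r / real n + (\<Sum>\<kappa>\<in>step_ids. weight \<kappa>) / real n = 1 / real n"
      unfolding sum_weight by (simp add: \<alpha>_def add_divide_distrib[symmetric])
    finally show ?thesis .
  qed
  let ?H = "\<Sum>z\<in>UNIV. h (incr c z)"
  have Some: "f (Some y) = (r / real n) *\<^sub>R h c + (q / real n) *\<^sub>R ?H + ((p - q) / real n) *\<^sub>R h (incr c y)" for y
  proof -
    have "(\<Sum>\<kappa>\<in>step_ids. (weight \<kappa> / real n) *\<^sub>R outcome h \<kappa> (c, Some y))
      = (1 / real n) *\<^sub>R (\<Sum>\<kappa>\<in>step_ids. weight \<kappa> *\<^sub>R h (incr c (act y \<kappa>)))"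
      by (simp add: scaleR_sum_right outcome_def)
    also have "\<dots> = (1 / real n) *\<^sub>R (q *\<^sub>R ?H + (p - q) *\<^sub>R h (incr c y))"
      unfolding weight_def using sum_step_ids[of p q "\<lambda>z. h (incr c z)" y] by (rule arg_cong)
    finally show ?thesis by (simp add: f_def scaleR_add_right)
  qed
  have tot: "(\<Sum>y\<in>UNIV. real (c y)) = real (moves c)" by (simp add: moves_def)
  have "(\<Sum>k\<in>{1..n}. f (label (X k \<omega>)))
    = (\<Sum>y\<in>UNIV. real (c y) *\<^sub>R f (Some y)) + (real n - real (moves c)) *\<^sub>R f None"
    unfolding c_def by (rule sum_labels)
  also have "(\<Sum>y\<in>UNIV. real (c y) *\<^sub>R f (Some y))
    = real (moves c) *\<^sub>R ((r / real n) *\<^sub>R h c + (q / real n) *\<^sub>R ?H) + (\<Sum>y\<in>UNIV. ((p - q) * real (c y) / real n) *\<^sub>R h (incr c y))"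
    unfolding Some scaleR_add_right sum.distrib scaleR_sum_left[symmetric] tot by (simp add: mult.commute scaleR_sum_left[symmetric] tot[symmetric] sum_distrib_left sum_distrib_right sum_divide_distrib)
  also have "\<dots> + (real n - real (moves c)) *\<^sub>R f None =
     (real (moves c) * r / real n + (real n - real (moves c)) / real n) *\<^sub>R h c
     + ((\<Sum>z\<in>UNIV. (q * real (moves c) / real n) *\<^sub>R h (incr c z)) + (\<Sum>z\<in>UNIV. ((p - q) * real (c z) / real n) *\<^sub>R h (incr c z)))"
    unfolding None by (simp add: scaleR_add_left scaleR_add_right scaleR_sum_right mult.commute)
  also have "real (moves c) * r / real n + (real n - real (moves c)) / real n = 1 - \<alpha> * real (moves c) / real n"
    using n by (simp add: \<alpha>_def field_simps)
  also have "((\<Sum>z\<in>UNIV. (q * real (moves c) / real n) *\<^sub>R h (incr c z)) + (\<Sum>z\<in>UNIV. ((p - q) * real (c z) / real n) *\<^sub>R h (incr c z)))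
    = (\<Sum>z\<in>UNIV. ((q * real (moves c) + (p - q) * real (c z)) / real n) *\<^sub>R h (incr c z))"
    by (simp add: sum.distrib[symmetric] scaleR_add_left[symmetric] add_divide_distrib)
  finally show ?thesis unfolding transition_def f_def c_def .
qed

text \<open>The probability space is decomposed by the value of the matrix and of the remembered time; on each piece
  the new counts are a function of the old ones and of the label of the remembered step.\<close>
theorem markov_counts:
  fixes h :: "'n counts \<Rightarrow> 'v::{banach,second_countable_topology}"
  assumes n: "n \<ge> 1"
  shows "(\<integral>\<omega>. h (counts X (Suc n) \<omega>) \<partial>M) = (\<integral>\<omega>. transition n h (counts X n \<omega>) \<partial>M)"
proof -
  let ?E = "\<lambda>B k. {\<omega>\<in>space M. A (Suc n) \<omega> = B} \<inter> {\<omega>\<in>space M. U (Suc n) \<omega> = k}"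
  let ?\<Psi> = "\<lambda>k \<omega>. (counts X n \<omega>, label (X k \<omega>))"
  let ?h0 = "\<lambda>(c :: 'n counts, _ :: ('n \<times> bool) option). h c"
  have "AE \<omega> in M. h (counts X (Suc n) \<omega>) = (\<Sum>k\<in>{1..n}. indicator (?E 0 k) \<omega> *\<^sub>R ?h0 (?\<Psi> k \<omega>)
      + (\<Sum>\<kappa>\<in>step_ids. indicator (?E (step_mat \<kappa>) k) \<omega> *\<^sub>R outcome h \<kappa> (?\<Psi> k \<omega>)))"
    using AE_A[OF n] AE_U[OF n] AE_X_range[of n] AE_space
  proof eventually_elim
    case (elim \<omega>)
    define k where "k = U (Suc n) \<omega>"
    have k: "k \<in> {1..n}" using elim(2) by (simp add: k_def)
    have step: "counts X (Suc n) \<omega> = add_step (counts X n \<omega>) (A (Suc n) \<omega> *v X k \<omega>)"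
      using X_step[OF n elim(4)] by (simp add: k_def)
    have "(\<Sum>k'\<in>{1..n}. indicator (?E 0 k') \<omega> *\<^sub>R ?h0 (?\<Psi> k' \<omega>)
      + (\<Sum>\<kappa>\<in>step_ids. indicator (?E (step_mat \<kappa>) k') \<omega> *\<^sub>R outcome h \<kappa> (?\<Psi> k' \<omega>)))
      = (\<Sum>k'\<in>{1..n}. if k' = k then (if A (Suc n) \<omega> = 0 then h (counts X n \<omega>) else 0)
         + (\<Sum>\<kappa>\<in>step_ids. if A (Suc n) \<omega> = step_mat \<kappa> then outcome h \<kappa> (?\<Psi> k' \<omega>) else 0) else 0)"
      using elim(4) by (intro sum.cong refl) (auto simp: indicator_def k_def intro!: sum.cong)
    also have "\<dots> = (if A (Suc n) \<omega> = 0 then h (counts X n \<omega>) else 0)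
         + (\<Sum>\<kappa>\<in>step_ids. if A (Suc n) \<omega> = step_mat \<kappa> then outcome h \<kappa> (?\<Psi> k \<omega>) else 0)"
      using k by simp
    also have "\<dots> = h (counts X (Suc n) \<omega>)"
    proof (cases "A (Suc n) \<omega> = 0")
      case True
      have "(\<Sum>\<kappa>\<in>step_ids. if A (Suc n) \<omega> = step_mat \<kappa> then outcome h \<kappa> (?\<Psi> k \<omega>) else 0) = 0"
      proof (intro sum.neutral ballI)
        fix \<kappa> assume "\<kappa> \<in> step_ids"
        then show "(if A (Suc n) \<omega> = step_mat \<kappa> then outcome h \<kappa> (?\<Psi> k \<omega>) else 0) = 0"
          using True step_mat_nonzero[of \<kappa>] by auto
      qed
      then show ?thesis using True unfolding step by simp
    next
      case False
      then obtain \<kappa> where \<kappa>: "\<kappa> \<in> step_ids" "A (Suc n) \<omega> = step_mat \<kappa>" using elim(1) by blast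
      have "(\<Sum>\<kappa>'\<in>step_ids. if A (Suc n) \<omega> = step_mat \<kappa>' then outcome h \<kappa>' (?\<Psi> k \<omega>) else 0)
        = (\<Sum>\<kappa>'\<in>step_ids. if \<kappa>' = \<kappa> then outcome h \<kappa>' (?\<Psi> k \<omega>) else 0)"
        using \<kappa> inj_on_step_mat by (intro sum.cong refl) (auto dest: inj_onD)
      also have "\<dots> = outcome h \<kappa> (?\<Psi> k \<omega>)" using \<kappa> by simp
      also have "\<dots> = h (counts X (Suc n) \<omega>)"
      proof -
        from elim(3) k consider "X k \<omega> = 0" | y where "X k \<omega> = dir y" by blast
        then show ?thesis
          unfolding step by cases (simp_all add: outcome_def step_mat_dir \<kappa>)
      qed
      finally show ?thesis using False by simp
    qed
    finally show ?case by simp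
  qed
  then have "(\<integral>\<omega>. h (counts X (Suc n) \<omega>) \<partial>M) = (\<integral>\<omega>. (\<Sum>k\<in>{1..n}. indicator (?E 0 k) \<omega> *\<^sub>R ?h0 (?\<Psi> k \<omega>)
      + (\<Sum>\<kappa>\<in>step_ids. indicator (?E (step_mat \<kappa>) k) \<omega> *\<^sub>R outcome h \<kappa> (?\<Psi> k \<omega>))) \<partial>M)"
    by (intro Bochner_Integration.integral_cong_AE borel_measurable_integrable integrable_counts
        Bochner_Integration.integrable_sum Bochner_Integration.integrable_add expectation_step(2)[OF n])
  also have "\<dots> = (\<Sum>k\<in>{1..n}. (\<integral>\<omega>. indicator (?E 0 k) \<omega> *\<^sub>R ?h0 (?\<Psi> k \<omega>) \<partial>M)
      + (\<Sum>\<kappa>\<in>step_ids. (\<integral>\<omega>. indicator (?E (step_mat \<kappa>) k) \<omega> *\<^sub>R outcome h \<kappa> (?\<Psi> k \<omega>) \<partial>M)))"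
    by (rule integral_nested_sum) (rule expectation_step(2)[OF n], assumption)+
  also have "\<dots> = (\<Sum>k\<in>{1..n}. (\<integral>\<omega>. (r / real n) *\<^sub>R h (counts X n \<omega>) \<partial>M)
      + (\<Sum>\<kappa>\<in>step_ids. (\<integral>\<omega>. (weight \<kappa> / real n) *\<^sub>R outcome h \<kappa> (?\<Psi> k \<omega>) \<partial>M)))"
  proof (intro sum.cong refl arg_cong2[where f="(+)"])
    fix k assume k: "k \<in> {1..n}"
    show "(\<integral>\<omega>. indicator (?E 0 k) \<omega> *\<^sub>R ?h0 (?\<Psi> k \<omega>) \<partial>M) = (\<integral>\<omega>. (r / real n) *\<^sub>R h (counts X n \<omega>) \<partial>M)"
      using expectation_step(3)[OF n k, of 0 ?h0] A_zero[OF n] by simp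
    fix \<kappa> assume \<kappa>: "\<kappa> \<in> step_ids"
    show "(\<integral>\<omega>. indicator (?E (step_mat \<kappa>) k) \<omega> *\<^sub>R outcome h \<kappa> (?\<Psi> k \<omega>) \<partial>M) = (\<integral>\<omega>. (weight \<kappa> / real n) *\<^sub>R outcome h \<kappa> (?\<Psi> k \<omega>) \<partial>M)"
      using expectation_step(3)[OF n k, of "step_mat \<kappa>" "outcome h \<kappa>"] prob_step_mat[OF n \<kappa>] by simp
  qed
  also have "\<dots> = (\<integral>\<omega>. (\<Sum>k\<in>{1..n}. (r / real n) *\<^sub>R h (counts X n \<omega>) + (\<Sum>\<kappa>\<in>step_ids. (weight \<kappa> / real n) *\<^sub>R outcome h \<kappa> (?\<Psi> k \<omega>))) \<partial>M)"
    by (rule integral_nested_sum[symmetric])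
       (auto intro!: integrable_scaleR_right expectation_step(1)[OF n])
  also have "\<dots> = (\<integral>\<omega>. transition n h (counts X n \<omega>) \<partial>M)"
    unfolding outcome_sum[OF n] ..
  finally show ?thesis .
qed

lemma expectation_counts_1:
  fixes h :: "'n counts \<Rightarrow> 'v::{banach,second_countable_topology}"
  shows "(\<integral>\<omega>. h (counts X 1 \<omega>) \<partial>M) = (\<Sum>y\<in>UNIV. (1 / (2 * real CARD('n))) *\<^sub>R h (incr (\<lambda>_. 0) y))"
proof -
  let ?E = "\<lambda>y. {\<omega>\<in>space M. X 1 \<omega> = dir y}"
  have "AE \<omega> in M. h (counts X 1 \<omega>) = (\<Sum>y\<in>UNIV. indicator (?E y) \<omega> *\<^sub>R h (incr (\<lambda>_. 0) y))"
    using AE_X1 AE_space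
  proof eventually_elim
    case (elim \<omega>)
    then obtain y where y: "X 1 \<omega> = dir y" by blast
    have "(\<Sum>z\<in>UNIV. indicator (?E z) \<omega> *\<^sub>R h (incr (\<lambda>_. 0) z)) = (\<Sum>z\<in>UNIV. if z = y then h (incr (\<lambda>_. 0) z) else 0)"
      using y elim(2) by (intro sum.cong refl) (auto simp: indicator_def)
    then show ?case using y by simp
  qed
  moreover have int: "integrable M (\<lambda>\<omega>. indicator (?E y) \<omega> *\<^sub>R h (incr (\<lambda>_. 0) y))" for y
    using X1_event[of 1] by (intro integrable_scaleR_left) (auto simp: emeasure_eq_measure)
  ultimately have "(\<integral>\<omega>. h (counts X 1 \<omega>) \<partial>M) = (\<integral>\<omega>. (\<Sum>y\<in>UNIV. indicator (?E y) \<omega> *\<^sub>R h (incr (\<lambda>_. 0) y)) \<partial>M)"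
    by (intro Bochner_Integration.integral_cong_AE borel_measurable_integrable integrable_counts Bochner_Integration.integrable_sum)
  also have "\<dots> = (\<Sum>y\<in>UNIV. (1 / (2 * real CARD('n))) *\<^sub>R h (incr (\<lambda>_. 0) y))"
  proof -
    have "(\<integral>\<omega>. indicator (?E y) \<omega> *\<^sub>R h (incr (\<lambda>_. 0) y) \<partial>M) = prob (?E y) *\<^sub>R h (incr (\<lambda>_. 0) y)" for y
      using X1_event[of 1 "dir y"] by (subst integral_scaleR_left) (auto simp: emeasure_eq_measure)
    then show ?thesis by (simp only: Bochner_Integration.integral_sum[OF int] prob_X1)
  qed
  finally show ?thesis .
qed

text \<open>The difference \<open>p' - q'\<close> of the parameters \<open>p' = p/\<alpha>\<close>, \<open>q' = q/\<alpha>\<close> conditioned on a nonzero step.\<close>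
definition memory :: real where "memory = (p - q) / \<alpha>"

lemma memory_q: "q / \<alpha> = (1 - memory) / (2 * real CARD('n))"
  using weights_sum \<alpha> by (simp add: memory_def field_simps)

lemma transition_eq:
  assumes "n \<ge> 1"
  shows "transition n h c = (1 - \<alpha> * real (moves c) / real n) *\<^sub>R h c
     + (\<alpha> * real (moves c) / real n) *\<^sub>R (\<Sum>z\<in>UNIV. urn_weight TYPE('n) memory (moves c) (c z) *\<^sub>R h (incr c z))"
proof -
  have "(q * real (moves c) + (p - q) * real (c z)) / real n = \<alpha> * real (moves c) / real n * urn_weight TYPE('n) memory (moves c) (c z)" for z
  proof (cases "moves c = 0")
    case True
    then have "c z = 0" using count_le_moves[of c z] by simp
    then show ?thesis using True by simp
  next
    case False
    then have "urn_weight TYPE('n) memory (moves c) (c z) = q / \<alpha> + (p - q) / \<alpha> * real (c z) / real (moves c)"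
      by (simp add: urn_weight_def memory_q memory_def)
    then show ?thesis using False \<alpha>(1) by (simp add: field_simps)
  qed
  then show ?thesis unfolding transition_def scaleR_sum_right by (simp only: scaleR_scaleR)
qed

lemma elephant_urn_memory:
  assumes "memory < 1 / 2"
  shows "elephant_urn TYPE('n) memory (real CARD('n))"
proof
  have "\<alpha> * (memory * (2 * real CARD('n) - 1) + 1) = 2 * real CARD('n) * p"
    using weights_sum \<alpha> by (simp add: memory_def field_simps)
  also have "\<dots> \<ge> 0" using p by simp
  finally show "- 1 \<le> memory * (2 * real CARD('n) - 1)"
    using \<alpha>(1) by (simp add: zero_le_mult_iff)
qed (use assms in auto)

text \<open>Given the number \<open>m\<close> of nonzero steps, the counts are distributed as in the walk without stops
  after \<open>m\<close> steps.  In the induction both sides evolve by the same operator: \<open>urn_exp\<close> sees only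
  counts of total \<open>m\<close>, on which the transition at time \<open>n\<close> is a mixture, with weights depending on
  \<open>m\<close> and \<open>n\<close> only, of staying and of one step of the urn.\<close>
theorem expectation_urn:
  fixes h :: "'n counts \<Rightarrow> 'v::{banach,second_countable_topology}"
  assumes mem: "memory < 1 / 2" and "n \<ge> 1"
  shows "(\<integral>\<omega>. h (counts X n \<omega>) \<partial>M) = (\<integral>\<omega>. urn_exp memory (moves (counts X n \<omega>)) h \<partial>M)"
  using assms(2)
proof (induction n arbitrary: h rule: dec_induct)
  case base
  have inc: "moves (incr (\<lambda>_. 0) (y :: 'n \<times> bool)) = 1" for y by (simp add: moves_def[of "\<lambda>_. 0"])
  have u: "urn_exp memory 1 h = (\<Sum>y\<in>UNIV. (1 / (2 * real CARD('n))) *\<^sub>R h (incr (\<lambda>_. 0) y))"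
    by (simp add: urn_weight_def)
  show ?case
    unfolding expectation_counts_1[of h] expectation_counts_1[of "\<lambda>c. urn_exp memory (moves c) h"] inc u
    by (simp add: card_cartesian_product scaleR_sum_left[symmetric] flip: UNIV_Times_UNIV)
next
  case (step n)
  interpret elephant_urn "TYPE('n)" memory "real CARD('n)" by (rule elephant_urn_memory[OF mem])
  let ?H = "\<lambda>c. urn_exp memory (moves c) h"
  have "(\<integral>\<omega>. h (counts X (Suc n) \<omega>) \<partial>M) = (\<integral>\<omega>. transition n h (counts X n \<omega>) \<partial>M)"
    by (rule markov_counts[OF step(1)])
  also have "\<dots> = (\<integral>\<omega>. urn_exp memory (moves (counts X n \<omega>)) (transition n h) \<partial>M)" by (rule step.IH)
  also have "\<dots> = (\<integral>\<omega>. transition n ?H (counts X n \<omega>) \<partial>M)"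
  proof (rule arg_cong[where f="\<lambda>f. integral\<^sup>L M f"], rule ext)
    fix \<omega>
    let ?c = "counts X n \<omega>"
    have "urn_exp memory (moves ?c) (transition n h)
      = urn_exp memory (moves ?c) (\<lambda>c. (1 - \<alpha> * real (moves ?c) / real n) *\<^sub>R h c
     + (\<alpha> * real (moves ?c) / real n) *\<^sub>R (\<Sum>z\<in>UNIV. urn_weight TYPE('n) memory (moves ?c) (c z) *\<^sub>R h (incr c z)))"
      by (rule urn_exp_cong) (simp add: transition_eq[OF step(1)])
    also have "\<dots> = (1 - \<alpha> * real (moves ?c) / real n) *\<^sub>R ?H ?c + (\<alpha> * real (moves ?c) / real n) *\<^sub>R urn_exp memory (Suc (moves ?c)) h"
      by (simp add: urn_exp_add urn_exp_scaleR)
    also have "\<dots> = transition n ?H ?c"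
      by (simp add: transition_eq[OF step(1)] scaleR_sum_left[symmetric] urn_weight_sum del: urn_exp.simps)
    finally show "urn_exp memory (moves ?c) (transition n h) = transition n ?H ?c" .
  qed
  also have "\<dots> = (\<integral>\<omega>. ?H (counts X (Suc n) \<omega>) \<partial>M)"
    by (rule markov_counts[OF step(1), symmetric])
  finally show ?case .
qed

end

section \<open>The number of nonzero steps\<close>

lemma pochhammer_minus_power:
  fixes x :: real
  assumes x: "x \<ge> 0"
  shows "0 \<le> pochhammer x (Suc k) - x ^ Suc k \<and> pochhammer x (Suc k) - x ^ Suc k \<le> (real (Suc k))\<^sup>2 * pochhammer x k"
proof (induction k)
  case (Suc k)
  have p0: "pochhammer x j \<ge> 0" for j
    unfolding pochhammer_prod using x by (intro prod_nonneg) auto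
  let ?D = "pochhammer x (Suc k) - x ^ Suc k"
  have eq: "pochhammer x (Suc (Suc k)) - x ^ Suc (Suc k) = x * ?D + real (Suc k) * pochhammer x (Suc k)"
    unfolding pochhammer_rec'[of x "Suc k"] by (simp add: algebra_simps)
  have "x * ?D \<le> x * ((real (Suc k))\<^sup>2 * pochhammer x k)" using Suc x by (intro mult_left_mono) auto
  also have "\<dots> = (real (Suc k))\<^sup>2 * (x * pochhammer x k)" by simp
  also have "\<dots> \<le> (real (Suc k))\<^sup>2 * pochhammer x (Suc k)"
    unfolding pochhammer_rec'[of x k] using x p0 by (intro mult_left_mono mult_right_mono) auto
  finally have "x * ?D + real (Suc k) * pochhammer x (Suc k) \<le> ((real (Suc k))\<^sup>2 + real (Suc k)) * pochhammer x (Suc k)"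
    by (simp add: distrib_right)
  also have "\<dots> \<le> (real (Suc (Suc k)))\<^sup>2 * pochhammer x (Suc k)"
    using p0 by (intro mult_right_mono) (auto simp: power2_eq_square algebra_simps)
  finally show ?case unfolding eq using Suc x p0 by (auto intro!: add_nonneg_nonneg mult_nonneg_nonneg)
qed simp

lemma pochhammer_shift_diff:
  "x * (pochhammer (x + 1) k - pochhammer x k) = real k * pochhammer (x :: real) k"
proof -
  have "x * pochhammer (x + 1) k = pochhammer x k * (x + real k)"
    using pochhammer_rec[of x k] pochhammer_Suc[of x k] by simp
  then show ?thesis by (simp add: algebra_simps)
qed

text \<open>Euler's limit formula for \<open>1/\<Gamma>(1 + z)\<close>, with the index shifted by one.\<close>
lemma pochhammer_over_fact_asymp:
  fixes z :: real
  assumes z: "z \<ge> 0"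
  shows "(\<lambda>n. pochhammer (1 + z) (n - 1) / fact (n - 1) / real n powr z) \<longlonglongrightarrow> rGamma (1 + z)"
proof -
  have quot: "(\<lambda>n. real n / (real n + c)) \<longlonglongrightarrow> 1" for c
  proof -
    have "(\<lambda>n. 1 / (1 + c / real n)) \<longlonglongrightarrow> 1 / (1 + 0)"
      by (intro tendsto_intros lim_const_over_n) simp
    moreover have "\<forall>\<^sub>F n in sequentially. 1 / (1 + c / real n) = real n / (real n + c)"
      using eventually_gt_at_top[of 0] by eventually_elim (simp add: field_simps)
    ultimately show ?thesis by (simp add: filterlim_cong)
  qed
  have "(\<lambda>n. rGamma_series (1 + z) n * (real n / (real n + z)) * (real n / (real n + (1 + z)))) \<longlonglongrightarrow> rGamma (1 + z) * 1 * 1"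
    by (intro tendsto_mult rGamma_series_LIMSEQ quot)
  moreover have "\<forall>\<^sub>F n in sequentially. rGamma_series (1 + z) n * (real n / (real n + z)) * (real n / (real n + (1 + z)))
     = pochhammer (1 + z) (n - 1) / fact (n - 1) / real n powr z"
    using eventually_gt_at_top[of 0]
  proof eventually_elim
    case (elim n)
    obtain j where n: "n = Suc j" using elim by (cases n) auto
    have e: "exp ((1 + z) * ln (real n)) = real n powr z * real n"
      using elim by (simp add: powr_def exp_add distrib_right)
    have f: "fact n = real n * fact (n - 1)" by (simp add: n)
    have p: "pochhammer (1 + z) (n + 1) = pochhammer (1 + z) (n - 1) * (real n + z) * (real n + (1 + z))"
      by (simp add: n pochhammer_Suc add_ac)
    have pos: "real n > 0" "real n + z > 0" "real n + (1 + z) > 0" "real n powr z > 0" "(fact (n - 1) :: real) > 0" using elim z by auto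
    have "P * a * b / (N * F * (W * N)) * (N / a) * (N / b) = P / F / W"
      if "a > 0" "b > 0" "N > 0" "F > 0" "W > 0" for P a b N F W :: real
      using that by (simp add: field_simps)
    from this[OF pos(2,3,1,5,4)] show ?case unfolding rGamma_series_def of_real_eq_id id_apply e f p by simp
  qed
  ultimately show ?thesis by (simp add: filterlim_cong)
qed

text \<open>Monotonicity reduces \<open>\<Gamma>\<close> to factorials, and \<open>R\<^sup>j / j! \<le> exp R\<close>.\<close>
lemma Gamma_superexponential:
  fixes x R :: real
  assumes x: "x \<ge> 1" and R: "R \<ge> 1"
  shows "R powr (x - 1) * exp (- R) \<le> Gamma (1 + x)"
proof -
  define j where "j = nat \<lfloor>x\<rfloor>"
  have j: "real j \<le> x" "x < real j + 1" "j \<ge> 1" using x by (auto simp: j_def nat_floor_neg le_nat_floor)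
  have "R ^ j / fact j = (\<Sum>i\<in>{j}. R ^ i / fact i)" by simp
  also have "\<dots> \<le> (\<Sum>i. R ^ i / fact i)"
    using R summable_exp[of R] by (intro sum_le_suminf) (auto simp: divide_inverse mult.commute)
  also have "\<dots> = exp R" by (simp add: exp_def divide_inverse mult.commute scaleR_conv_of_real)
  finally have "R ^ j * exp (- R) \<le> fact j" by (simp add: field_simps exp_minus)
  moreover have "R powr (x - 1) \<le> R ^ j"
  proof -
    have "R powr (x - 1) \<le> R powr real j" using R j by (intro powr_mono) auto
    then show ?thesis using R by (simp add: powr_realpow)
  qed
  then have "R powr (x - 1) * exp (- R) \<le> R ^ j * exp (- R)" by (intro mult_right_mono) auto
  moreover have "fact j = Gamma (1 + real j)" by (rule Gamma_fact[symmetric])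
  moreover have "Gamma (1 + real j) \<le> Gamma (1 + x)"
    using j Gamma_real_strict_mono[of "1 + real j" "1 + x"] by (cases "real j = x") auto
  ultimately show ?thesis by linarith
qed

lemma mittag_leffler_summable:
  fixes \<alpha> t :: real
  assumes \<alpha>: "\<alpha> > 0"
  shows "summable (\<lambda>k. t ^ k / Gamma (1 + real k * \<alpha>))"
proof -
  define T where "T = max 1 \<bar>t\<bar>"
  \<comment> \<open>With this \<open>R\<close> the bound \<open>R powr (k \<alpha>)\<close> on the Gamma function beats \<open>|t| ^ k\<close> by the factor \<open>2 ^ k\<close>.\<close>
  define R where "R = (2 * T) powr (1 / \<alpha>)"
  have T: "T \<ge> 1" "\<bar>t\<bar> \<le> T" by (auto simp: T_def)
  have R: "R \<ge> 1" using T \<alpha> unfolding R_def by (intro ge_one_powr_ge_zero) auto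
  show ?thesis
  proof (rule summable_comparison_test_ev)
    show "summable (\<lambda>k. R * exp R * (1 / 2) ^ k)" by (intro summable_mult summable_geometric) simp
    show "\<forall>\<^sub>F k in sequentially. norm (t ^ k / Gamma (1 + real k * \<alpha>)) \<le> R * exp R * (1 / 2) ^ k"
      using eventually_ge_at_top[of "nat \<lceil>1 / \<alpha>\<rceil>"]
    proof eventually_elim
      case (elim k)
      then have "1 / \<alpha> \<le> real k" by linarith
      then have k1: "real k * \<alpha> \<ge> 1" using \<alpha> by (simp add: field_simps)
      have "R powr (real k * \<alpha>) = (2 * T) ^ k"
        using \<alpha> T by (simp add: R_def powr_powr powr_realpow)
      then have "R powr (real k * \<alpha> - 1) = (2 * T) ^ k / R" using R by (simp add: powr_diff)
      then have lower: "(2 * T) ^ k / R * exp (- R) \<le> Gamma (1 + real k * \<alpha>)"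
        using Gamma_superexponential[OF k1 R] by simp
      have pos: "(2 * T) ^ k / R * exp (- R) > 0" using T R by simp
      have "norm (t ^ k / Gamma (1 + real k * \<alpha>)) = \<bar>t\<bar> ^ k / Gamma (1 + real k * \<alpha>)"
        using lower pos by (simp add: power_abs)
      also have "\<dots> \<le> T ^ k / ((2 * T) ^ k / R * exp (- R))"
        using T lower pos by (intro frac_le power_mono) auto
      also have "\<dots> = R * exp R * (1 / 2) ^ k"
        using T R by (simp add: power_mult_distrib exp_minus field_simps)
      finally show ?case .
    qed
  qed
qed

text \<open>\<open>S K\<close> approximates \<open>F\<close> with error \<open>T K\<close>; first \<open>n\<close> and then \<open>K\<close> tends to infinity.\<close>
lemma tendsto_by_truncation:
  fixes F :: "nat \<Rightarrow> real" and S T :: "nat \<Rightarrow> nat \<Rightarrow> real"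
  assumes bound: "\<And>K n. n \<ge> 1 \<Longrightarrow> \<bar>F n - S K n\<bar> \<le> T K n"
    and S: "\<And>K. S K \<longlonglongrightarrow> s K" and T: "\<And>K. T K \<longlonglongrightarrow> t K"
    and s: "s \<longlonglongrightarrow> l" and t: "t \<longlonglongrightarrow> 0"
  shows "F \<longlonglongrightarrow> l"
proof (rule LIMSEQ_I)
  fix e :: real assume e: "e > 0"
  then have e4: "e / 4 > 0" by simp
  have "\<forall>\<^sub>F K in sequentially. \<bar>s K - l\<bar> < e / 4 \<and> t K < e / 4"
    using tendstoD[OF s, of "e / 4"] order_tendstoD(2)[OF t, of "e / 4"] e
    by (auto simp: dist_real_def elim: eventually_elim2)
  then obtain K where K: "\<bar>s K - l\<bar> < e / 4" "t K < e / 4" by (auto simp: eventually_sequentially)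
  have "\<forall>\<^sub>F n in sequentially. norm (F n - l) < e"
    using tendstoD[OF S[of K], OF e4] order_tendstoD(2)[OF T[of K] K(2)] eventually_ge_at_top[of 1]
  proof eventually_elim
    case (elim n)
    then show ?case using bound[of n K] K unfolding dist_real_def real_norm_def by linarith
  qed
  then show "\<exists>no. \<forall>n\<ge>no. norm (F n - l) < e" by (simp add: eventually_sequentially)
qed

context merws
begin

definition num_moves :: "nat \<Rightarrow> 'a \<Rightarrow> nat" where
  "num_moves n \<omega> = moves (counts X n \<omega>)"

lemma integrable_num_moves [simp]:
  fixes f :: "nat \<Rightarrow> 'v::{banach,second_countable_topology}"
  shows "integrable M (\<lambda>\<omega>. f (num_moves n \<omega>))"
  unfolding num_moves_def by (rule integrable_counts[of "\<lambda>c. f (moves c)"])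

lemma markov_num_moves:
  fixes f :: "nat \<Rightarrow> real"
  assumes n: "n \<ge> 1"
  shows "(\<integral>\<omega>. f (num_moves (Suc n) \<omega>) \<partial>M)
    = (\<integral>\<omega>. f (num_moves n \<omega>) + \<alpha> * real (num_moves n \<omega>) / real n * (f (Suc (num_moves n \<omega>)) - f (num_moves n \<omega>)) \<partial>M)"
proof -
  have tr: "transition n (\<lambda>c. f (moves c)) c = f (moves c) + \<alpha> * real (moves c) / real n * (f (Suc (moves c)) - f (moves c))" for c
  proof -
    have "(\<Sum>z\<in>UNIV. (q * real (moves c) + (p - q) * real (c z)) / real n)
        = (q * real (moves c) * (2 * real CARD('n)) + (p - q) * (\<Sum>z\<in>UNIV. real (c z))) / real n"
      by (simp add: sum_divide_distrib[symmetric] sum.distrib sum_distrib_left card_cartesian_product flip: UNIV_Times_UNIV)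
    also have "(\<Sum>z\<in>UNIV. real (c z)) = real (moves c)" by (simp add: moves_def)
    also have "q * real (moves c) * (2 * real CARD('n)) + (p - q) * real (moves c) = \<alpha> * real (moves c)"
      unfolding weights_sum[symmetric] by (simp add: algebra_simps)
    finally have "(\<Sum>z\<in>UNIV. (q * real (moves c) + (p - q) * real (c z)) / real n) = \<alpha> * real (moves c) / real n" .
    then show ?thesis
      unfolding transition_def moves_incr real_scaleR_def sum_distrib_right[symmetric] by (simp only:) (simp add: algebra_simps diff_divide_distrib)
  qed
  show ?thesis unfolding num_moves_def using markov_counts[OF n, of "\<lambda>c. f (moves c)"] by (simp only: tr)
qed

lemma expectation_num_moves_1: "(\<integral>\<omega>. f (num_moves 1 \<omega>) \<partial>M) = (f 1 :: real)"
proof -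
  have "moves (incr (\<lambda>_. 0) (y :: 'n \<times> bool)) = 1" for y by (simp add: moves_def[of "\<lambda>_. 0"])
  then show ?thesis unfolding num_moves_def using expectation_counts_1[of "\<lambda>c. f (moves c)"]
    by (simp add: card_cartesian_product flip: UNIV_Times_UNIV)
qed

lemma AE_num_moves_pos:
  assumes "n \<ge> 1"
  shows "AE \<omega> in M. num_moves n \<omega> \<ge> 1"
  using AE_X1
proof eventually_elim
  case (elim \<omega>)
  then obtain y where y: "X 1 \<omega> = dir y" by blast
  have "1 \<le> counts X n \<omega> y"
    unfolding counts_eq_sum using assms y by (subst sum.remove[of _ 1]) auto
  also have "\<dots> \<le> num_moves n \<omega>" unfolding num_moves_def by (rule count_le_moves)
  finally show ?case .
qed

text \<open>Since \<open>m (1/(m+1) - 1/m) = -1/(m+1) \<le> -1/(2m)\<close>, the expectation shrinks by a factor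
  \<open>1 - \<alpha>/(2n)\<close> at least, and the harmonic series diverges.\<close>
lemma expectation_inverse_num_moves: "(\<lambda>n. \<integral>\<omega>. 1 / real (num_moves n \<omega>) \<partial>M) \<longlonglongrightarrow> 0"
proof (rule robbins_monro_tendsto_0[where c="\<alpha> / 2" and e="\<lambda>_. 0" and ?n0.0=1])
  fix n assume n: "(1::nat) \<le> n"
  let ?u = "\<integral>\<omega>. 1 / real (num_moves n \<omega>) \<partial>M"
  show u0: "0 \<le> ?u" by (rule Bochner_Integration.integral_nonneg) simp
  have "(\<integral>\<omega>. 1 / real (num_moves (Suc n) \<omega>) \<partial>M)
    = (\<integral>\<omega>. 1 / real (num_moves n \<omega>) + \<alpha> * real (num_moves n \<omega>) / real n * (1 / real (Suc (num_moves n \<omega>)) - 1 / real (num_moves n \<omega>)) \<partial>M)"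
    by (rule markov_num_moves[OF n, of "\<lambda>m. 1 / real m"])
  also have "\<dots> \<le> (\<integral>\<omega>. (1 - \<alpha> / (2 * real n)) * (1 / real (num_moves n \<omega>)) \<partial>M)"
  proof (rule integral_mono)
    fix \<omega>
    let ?m = "num_moves n \<omega>"
    show "1 / real ?m + \<alpha> * real ?m / real n * (1 / real (Suc ?m) - 1 / real ?m) \<le> (1 - \<alpha> / (2 * real n)) * (1 / real ?m)"
    proof (cases "?m = 0")
      case False
      then have m: "real ?m \<ge> 1" by simp
      have "\<alpha> * real ?m / real n * (1 / real (Suc ?m) - 1 / real ?m) = - (\<alpha> / real n * (1 / real (Suc ?m)))"
      proof -
        have "1 / real (Suc ?m) - 1 / real ?m = - (1 / (real ?m * real (Suc ?m)))"
          using m by (simp add: field_simps)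
        then show ?thesis using m by simp
      qed
      moreover have "\<alpha> / real n * (1 / (2 * real ?m)) \<le> \<alpha> / real n * (1 / real (Suc ?m))"
        using m n \<alpha> by (intro mult_left_mono divide_left_mono) auto
      ultimately show ?thesis by (simp add: algebra_simps)
    qed simp
  qed (use integrable_num_moves[of "\<lambda>m. 1 / real m + \<alpha> * real m / real n * (1 / real (Suc m) - 1 / real m)"]
       integrable_num_moves[of "\<lambda>m. (1 - \<alpha> / (2 * real n)) * (1 / real m)"] in simp_all)
  also have "\<dots> = (1 - \<alpha> / (2 * real n)) * ?u" by (rule integral_mult_right_zero)
  also have "\<dots> \<le> (1 - \<alpha> / 2 / real (Suc n)) * ?u + 0 / real (Suc n)"
  proof -
    have "\<alpha> / 2 / real (Suc n) \<le> \<alpha> / (2 * real n)" using n \<alpha> by (simp add: frac_le)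
    then show ?thesis using u0 by (simp add: mult_right_mono)
  qed
  finally show "(\<integral>\<omega>. 1 / real (num_moves (Suc n) \<omega>) \<partial>M) \<le> (1 - \<alpha> / 2 / real (Suc n)) * ?u + 0 / real (Suc n)" .
qed (use \<alpha> in auto)

text \<open>\<open>\<delta> m \<le> e/2 + B N / m\<close> for all \<open>m \<ge> 1\<close>, if \<open>\<delta>\<close> is bounded by \<open>B\<close> and is below \<open>e/2\<close> from \<open>N\<close> on.\<close>
lemma expectation_null_sequence:
  fixes \<delta> :: "nat \<Rightarrow> real"
  assumes \<delta>: "\<delta> \<longlonglongrightarrow> 0" and pos: "\<And>m. \<delta> m \<ge> 0"
  shows "(\<lambda>n. \<integral>\<omega>. \<delta> (num_moves n \<omega>) \<partial>M) \<longlonglongrightarrow> 0"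
proof (rule LIMSEQ_I)
  fix e :: real assume e: "e > 0"
  obtain B where B: "\<And>m. \<delta> m \<le> B" "B > 0"
    using convergent_imp_Bseq[OF convergentI[OF \<delta>]] unfolding Bseq_def by (auto simp: abs_le_iff)
  from order_tendstoD(2)[OF \<delta>, of "e / 2"] e obtain N where N: "\<And>m. m \<ge> N \<Longrightarrow> \<delta> m < e / 2"
    by (auto simp: eventually_sequentially)
  have "(\<lambda>n. e / 2 + B * real N * (\<integral>\<omega>. 1 / real (num_moves n \<omega>) \<partial>M)) \<longlonglongrightarrow> e / 2 + B * real N * 0"
    by (intro tendsto_intros expectation_inverse_num_moves)
  from order_tendstoD(2)[OF this, of e] e
  have "\<forall>\<^sub>F n in sequentially. e / 2 + B * real N * (\<integral>\<omega>. 1 / real (num_moves n \<omega>) \<partial>M) < e"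
    by simp
  then have "\<forall>\<^sub>F n in sequentially. norm ((\<integral>\<omega>. \<delta> (num_moves n \<omega>) \<partial>M) - 0) < e"
    using eventually_ge_at_top[of 1]
  proof eventually_elim
    case (elim n)
    have "(\<integral>\<omega>. \<delta> (num_moves n \<omega>) \<partial>M) \<le> (\<integral>\<omega>. e / 2 + B * real N * (1 / real (num_moves n \<omega>)) \<partial>M)"
    proof (rule integral_mono_AE)
      show "AE \<omega> in M. \<delta> (num_moves n \<omega>) \<le> e / 2 + B * real N * (1 / real (num_moves n \<omega>))"
        using AE_num_moves_pos[OF elim(2)]
      proof eventually_elim
        case m: (elim \<omega>)
        let ?m = "num_moves n \<omega>"
        show ?case
        proof (cases "?m \<ge> N")
          case True
          have "0 \<le> B * real N * (1 / real ?m)" using B by simp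
          then show ?thesis using N[OF True] by linarith
        next
          case False
          then have "1 \<le> real N / real ?m" using m by simp
          then have "B * 1 \<le> B * (real N / real ?m)" using B by (intro mult_left_mono) auto
          then show ?thesis using B(1)[of ?m] e by simp
        qed
      qed
    qed (use integrable_num_moves[of "\<lambda>m. e / 2 + B * real N * (1 / real m)"] in simp_all)
    also have "\<dots> = e / 2 + B * real N * (\<integral>\<omega>. 1 / real (num_moves n \<omega>) \<partial>M)"
    proof -
      have "(\<integral>\<omega>. e / 2 + B * real N * (1 / real (num_moves n \<omega>)) \<partial>M) = (\<integral>\<omega>. e / 2 \<partial>M) + (\<integral>\<omega>. B * real N * (1 / real (num_moves n \<omega>)) \<partial>M)"
        using integrable_num_moves[of "\<lambda>m. B * real N * (1 / real m)"]
        by (intro Bochner_Integration.integral_add) simp_all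
      then show ?thesis unfolding integral_mult_right_zero using prob_space by simp
    qed
    finally have "(\<integral>\<omega>. \<delta> (num_moves n \<omega>) \<partial>M) < e" using elim(1) by linarith
    moreover have "0 \<le> (\<integral>\<omega>. \<delta> (num_moves n \<omega>) \<partial>M)" using pos by (intro Bochner_Integration.integral_nonneg) simp
    ultimately show ?case by simp
  qed
  then show "\<exists>no. \<forall>n\<ge>no. norm ((\<integral>\<omega>. \<delta> (num_moves n \<omega>) \<partial>M) - 0) < e" by (simp add: eventually_sequentially)
qed

text \<open>By \<open>pochhammer_shift_diff\<close>, rising factorials are eigenfunctions of the transition operator of the
  clock, with eigenvalue \<open>1 + \<alpha> k / n\<close>.\<close>
lemma rising_moment:
  assumes "n \<ge> 1"
  shows "(\<integral>\<omega>. pochhammer (real (num_moves n \<omega>)) k \<partial>M)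
    = fact k * (pochhammer (1 + \<alpha> * real k) (n - 1) / fact (n - 1))"
  using assms
proof (induction n rule: dec_induct)
  case base
  show ?case using expectation_num_moves_1[of "\<lambda>m. pochhammer (real m) k"] by (simp add: pochhammer_fact)
next
  case (step n)
  have "(\<integral>\<omega>. pochhammer (real (num_moves (Suc n) \<omega>)) k \<partial>M)
    = (\<integral>\<omega>. (1 + \<alpha> * real k / real n) * pochhammer (real (num_moves n \<omega>)) k \<partial>M)"
    unfolding markov_num_moves[OF step(1), of "\<lambda>m. pochhammer (real m) k"]
  proof (intro Bochner_Integration.integral_cong refl)
    fix \<omega>
    let ?x = "real (num_moves n \<omega>)"
    have "\<alpha> * ?x / real n * (pochhammer (?x + 1) k - pochhammer ?x k) = \<alpha> / real n * (real k * pochhammer ?x k)"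
      unfolding pochhammer_shift_diff[symmetric] by simp
    then show "pochhammer ?x k + \<alpha> * ?x / real n * (pochhammer (real (Suc (num_moves n \<omega>))) k - pochhammer ?x k)
      = (1 + \<alpha> * real k / real n) * pochhammer ?x k"
      by (simp add: algebra_simps)
  qed
  also have "\<dots> = (1 + \<alpha> * real k / real n) * (fact k * (pochhammer (1 + \<alpha> * real k) (n - 1) / fact (n - 1)))"
    using step.IH by simp
  also have "\<dots> = fact k * (pochhammer (1 + \<alpha> * real k) n / fact n)"
  proof -
    obtain j where n: "n = Suc j" using step(1) by (cases n) auto
    have "(1 + z / (1 + real j)) * (F * (P / G)) = F * (P * (1 + z + real j) / ((1 + real j) * G))" if "G > 0" for z F P G :: real
      using that by (simp add: field_simps)
    from this[of "fact j" "\<alpha> * real k" "fact k" "pochhammer (1 + \<alpha> * real k) j"]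
    show ?thesis by (simp add: n pochhammer_Suc)
  qed
  finally show ?case by simp
qed

definition scaled_moves :: "nat \<Rightarrow> 'a \<Rightarrow> real" where
  "scaled_moves n \<omega> = real (num_moves n \<omega>) / real n powr \<alpha>"

lemma scaled_moves_nonneg: "scaled_moves n \<omega> \<ge> 0"
  by (simp add: scaled_moves_def)

lemma integrable_scaled_moves [simp]:
  fixes f :: "real \<Rightarrow> 'v::{banach,second_countable_topology}"
  shows "integrable M (\<lambda>\<omega>. f (scaled_moves n \<omega>))"
  unfolding scaled_moves_def by (rule integrable_num_moves[of "\<lambda>m. f (real m / real n powr \<alpha>)"])

lemma scaled_rising_moment:
  "(\<lambda>n. (\<integral>\<omega>. pochhammer (real (num_moves n \<omega>)) k \<partial>M) / (real n powr \<alpha>) ^ k) \<longlonglongrightarrow> fact k / Gamma (1 + real k * \<alpha>)"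
proof -
  have "(\<lambda>n. fact k * (pochhammer (1 + \<alpha> * real k) (n - 1) / fact (n - 1) / real n powr (\<alpha> * real k))) \<longlonglongrightarrow> fact k * rGamma (1 + \<alpha> * real k)"
    using \<alpha> by (intro tendsto_mult tendsto_const pochhammer_over_fact_asymp) simp
  moreover have "\<forall>\<^sub>F n in sequentially. fact k * (pochhammer (1 + \<alpha> * real k) (n - 1) / fact (n - 1) / real n powr (\<alpha> * real k))
     = (\<integral>\<omega>. pochhammer (real (num_moves n \<omega>)) k \<partial>M) / (real n powr \<alpha>) ^ k"
    using eventually_ge_at_top[of 1]
  proof eventually_elim
    case (elim n)
    then have "(real n powr \<alpha>) ^ k = real n powr (\<alpha> * real k)" by (simp add: powr_powr[symmetric] powr_realpow)
    then show ?case by (simp add: rising_moment[OF elim])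
  qed
  ultimately have "(\<lambda>n. (\<integral>\<omega>. pochhammer (real (num_moves n \<omega>)) k \<partial>M) / (real n powr \<alpha>) ^ k) \<longlonglongrightarrow> fact k * rGamma (1 + \<alpha> * real k)"
    by (rule Lim_transform_eventually)
  then show ?thesis by (simp only: rGamma_inverse_Gamma divide_inverse mult.commute[of \<alpha>])
qed

text \<open>A power differs from the rising factorial by a polynomial of lower degree, which is of smaller
  order by \<open>scaled_rising_moment\<close>.\<close>
lemma scaled_moment:
  "(\<lambda>n. \<integral>\<omega>. scaled_moves n \<omega> ^ k \<partial>M) \<longlonglongrightarrow> fact k / Gamma (1 + real k * \<alpha>)"
proof (cases k)
  case 0
  then show ?thesis using prob_space by simp
next
  case (Suc j)
  define D where "D n = (\<integral>\<omega>. pochhammer (real (num_moves n \<omega>)) k - real (num_moves n \<omega>) ^ k \<partial>M) / (real n powr \<alpha>) ^ k" for n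
  define B where "B n = (real k)\<^sup>2 * ((\<integral>\<omega>. pochhammer (real (num_moves n \<omega>)) j \<partial>M) / (real n powr \<alpha>) ^ j) * (1 / real n powr \<alpha>)" for n
  have "(\<lambda>n. 1 / real n powr \<alpha>) \<longlonglongrightarrow> 0"
    using tendsto_neg_powr[OF _ filterlim_real_sequentially, of "- \<alpha>"] \<alpha> by (simp add: powr_minus_divide)
  then have "B \<longlonglongrightarrow> (real k)\<^sup>2 * (fact j / Gamma (1 + real j * \<alpha>)) * 0"
    unfolding B_def by (intro tendsto_mult tendsto_const scaled_rising_moment)
  then have B0: "B \<longlonglongrightarrow> 0" by simp
  have bounds: "0 \<le> D n \<and> D n \<le> B n" for n
  proof -
    have "(\<integral>\<omega>. pochhammer (real (num_moves n \<omega>)) k - real (num_moves n \<omega>) ^ k \<partial>M) \<le> (\<integral>\<omega>. (real k)\<^sup>2 * pochhammer (real (num_moves n \<omega>)) j \<partial>M)"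
      using pochhammer_minus_power[of "real m" j for m]
      by (intro integral_mono integrable_num_moves[of "\<lambda>m. pochhammer (real m) k - real m ^ k"] integrable_num_moves[of "\<lambda>m. (real k)\<^sup>2 * pochhammer (real m) j"]) (auto simp: Suc)
    then have "D n \<le> (real k)\<^sup>2 * (\<integral>\<omega>. pochhammer (real (num_moves n \<omega>)) j \<partial>M) / (real n powr \<alpha>) ^ k"
      unfolding D_def by (intro divide_right_mono) auto
    moreover have "0 \<le> D n"
      unfolding D_def using pochhammer_minus_power[of "real m" j for m] by (intro divide_nonneg_nonneg Bochner_Integration.integral_nonneg) (auto simp: Suc)
    ultimately show ?thesis by (simp add: B_def Suc mult_ac)
  qed
  have D0: "D \<longlonglongrightarrow> 0"
    by (rule tendsto_sandwich[OF _ _ tendsto_const B0]) (use bounds in auto)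
  have "(\<lambda>n. (\<integral>\<omega>. pochhammer (real (num_moves n \<omega>)) k \<partial>M) / (real n powr \<alpha>) ^ k - D n) \<longlonglongrightarrow> fact k / Gamma (1 + real k * \<alpha>) - 0"
    by (intro tendsto_diff scaled_rising_moment D0)
  moreover have "(\<integral>\<omega>. pochhammer (real (num_moves n \<omega>)) k \<partial>M) / (real n powr \<alpha>) ^ k - D n = (\<integral>\<omega>. scaled_moves n \<omega> ^ k \<partial>M)" for n
    unfolding D_def scaled_moves_def power_divide
    using integrable_num_moves[of "\<lambda>m. pochhammer (real m) k" n] integrable_num_moves[of "\<lambda>m. real m ^ k" n]
    by (simp add: diff_divide_distrib[symmetric])
  ultimately show ?thesis by simp
qed

text \<open>For nonnegative arguments the Taylor remainder of \<open>exp (- x)\<close> is bounded by its next term, so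
  convergence of moments suffices; the limits of these terms are summable.\<close>
theorem laplace_tendsto_mittag_leffler:
  assumes \<theta>: "\<theta> \<ge> 0"
  shows "(\<lambda>n. \<integral>\<omega>. exp (- (\<theta> * scaled_moves n \<omega>)) \<partial>M) \<longlonglongrightarrow> (\<Sum>k. (- \<theta>) ^ k / Gamma (1 + real k * \<alpha>))"
proof (rule tendsto_by_truncation)
  let ?Z = "scaled_moves"
  show "\<bar>(\<integral>\<omega>. exp (- (\<theta> * ?Z n \<omega>)) \<partial>M) - (\<Sum>k<K. (- \<theta>) ^ k / fact k * (\<integral>\<omega>. ?Z n \<omega> ^ k \<partial>M))\<bar>
     \<le> \<theta> ^ K / fact K * (\<integral>\<omega>. ?Z n \<omega> ^ K \<partial>M)" for K n
  proof -
    let ?f = "\<lambda>z. exp (- (\<theta> * z)) - (\<Sum>k<K. (- \<theta>) ^ k / fact k * z ^ k)"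
    have "(\<integral>\<omega>. exp (- (\<theta> * ?Z n \<omega>)) \<partial>M) - (\<Sum>k<K. (- \<theta>) ^ k / fact k * (\<integral>\<omega>. ?Z n \<omega> ^ k \<partial>M))
      = (\<integral>\<omega>. exp (- (\<theta> * ?Z n \<omega>)) \<partial>M) - (\<integral>\<omega>. (\<Sum>k<K. (- \<theta>) ^ k / fact k * ?Z n \<omega> ^ k) \<partial>M)"
      using integrable_scaled_moves[of "\<lambda>z. z ^ k" n for k] by (subst Bochner_Integration.integral_sum) auto
    also have "\<dots> = (\<integral>\<omega>. ?f (?Z n \<omega>) \<partial>M)"
      by (intro Bochner_Integration.integral_diff[symmetric] integrable_scaled_moves[of "\<lambda>z. exp (- (\<theta> * z))" n]
          integrable_scaled_moves[of "\<lambda>z. \<Sum>k<K. (- \<theta>) ^ k / fact k * z ^ k" n])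
    also have "\<bar>\<dots>\<bar> \<le> (\<integral>\<omega>. \<bar>?f (?Z n \<omega>)\<bar> \<partial>M)" by (rule integral_abs_bound)
    also have "\<dots> \<le> (\<integral>\<omega>. \<theta> ^ K / fact K * ?Z n \<omega> ^ K \<partial>M)"
    proof (intro integral_mono)
      fix \<omega>
      show "\<bar>?f (?Z n \<omega>)\<bar> \<le> \<theta> ^ K / fact K * ?Z n \<omega> ^ K"
        using exp_minus_taylor[of "\<theta> * ?Z n \<omega>" K] \<theta> scaled_moves_nonneg[of n \<omega>]
        by (simp add: power_mult_distrib power_minus[of \<open>\<theta> * _\<close>] power_minus[of \<theta>] mult.assoc)
    qed (rule integrable_scaled_moves[of "\<lambda>z. \<bar>?f z\<bar>" n] integrable_scaled_moves[of "\<lambda>z. \<theta> ^ K / fact K * z ^ K" n])+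
    finally show ?thesis by simp
  qed
  show "(\<lambda>n. \<Sum>k<K. (- \<theta>) ^ k / fact k * (\<integral>\<omega>. ?Z n \<omega> ^ k \<partial>M)) \<longlonglongrightarrow> (\<Sum>k<K. (- \<theta>) ^ k / fact k * (fact k / Gamma (1 + real k * \<alpha>)))" for K
    by (intro tendsto_sum tendsto_mult tendsto_const scaled_moment)
  show "(\<lambda>n. \<theta> ^ K / fact K * (\<integral>\<omega>. ?Z n \<omega> ^ K \<partial>M)) \<longlonglongrightarrow> \<theta> ^ K / fact K * (fact K / Gamma (1 + real K * \<alpha>))" for K
    by (intro tendsto_mult tendsto_const scaled_moment)
  show "(\<lambda>K. \<Sum>k<K. (- \<theta>) ^ k / fact k * (fact k / Gamma (1 + real k * \<alpha>))) \<longlonglongrightarrow> (\<Sum>k. (- \<theta>) ^ k / Gamma (1 + real k * \<alpha>))"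
    using summable_LIMSEQ[OF mittag_leffler_summable[OF \<alpha>(1), of "- \<theta>"]] by simp
  show "(\<lambda>K. \<theta> ^ K / fact K * (fact K / Gamma (1 + real K * \<alpha>))) \<longlonglongrightarrow> 0"
    using summable_LIMSEQ_zero[OF mittag_leffler_summable[OF \<alpha>(1), of \<theta>]] by simp
qed

end

section \<open>The limit theorems\<close>

lemma mat_vector: "mat v *v x = v *\<^sub>R (x :: real ^ 'n::finite)"
proof -
  have "(\<Sum>j\<in>UNIV. (if i = j then v else 0) * x $ j) = v * x $ i" for i
    by (subst sum.remove[of _ i]) (auto intro!: sum.neutral)
  then show ?thesis by (simp add: vec_eq_iff matrix_vector_mult_def mat_def)
qed

text \<open>The choice in \<open>matrix_inv\<close> is determined on vectors by the defining equation.\<close>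
lemma matrix_inv_mat_vector:
  assumes "v \<noteq> 0"
  shows "matrix_inv (mat v) *v x = (x :: real ^ 'n::finite) /\<^sub>R v"
proof -
  have "mat v ** mat (1 / v) = (mat 1 :: real ^ 'n ^ 'n)" "mat (1 / v) ** mat v = (mat 1 :: real ^ 'n ^ 'n)"
    using assms by (auto simp: matrix_eq matrix_vector_mul_assoc[symmetric] mat_vector)
  then have "mat v ** matrix_inv (mat v) = (mat 1 :: real ^ 'n ^ 'n) \<and> matrix_inv (mat v) ** mat v = (mat 1 :: real ^ 'n ^ 'n)"
    unfolding matrix_inv_def by (intro someI_ex[where P="\<lambda>A'. mat v ** A' = mat 1 \<and> A' ** mat v = mat 1"]) blast
  then have "mat v *v (matrix_inv (mat v) *v x) = x"
    by (simp only: matrix_vector_mul_assoc matrix_vector_mul_lid)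
  then have "inverse v *\<^sub>R (v *\<^sub>R (matrix_inv (mat v) *v x)) = x /\<^sub>R v"
    by (simp only: mat_vector)
  then show ?thesis using assms by simp
qed

lemma gaussian_eq_gauss:
  assumes "v > 0"
  shows "gaussian 0 (mat v) = (gauss v :: (real ^ 'n::finite) measure)"
proof -
  have det: "det (mat v :: real ^ 'n ^ 'n) = v ^ CARD('n)"
    by (subst det_diagonal) (auto simp: mat_def)
  have "sqrt ((2 * pi) ^ CARD('n) * v ^ CARD('n)) = sqrt (2 * pi * v) ^ CARD('n)"
    by (simp only: power_mult_distrib[symmetric] real_sqrt_power)
  moreover have "- (1 / 2) * ((x - 0) \<bullet> (matrix_inv (mat v) *v (x - 0))) = - (norm x)\<^sup>2 / (2 * v)" for x :: "real ^ 'n"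
  proof -
    have "(x - 0) \<bullet> (matrix_inv (mat v) *v (x - 0)) = inverse v * (norm x)\<^sup>2"
      using assms by (simp only: matrix_inv_mat_vector diff_zero inner_scaleR_right power2_norm_eq_inner)
    then show ?thesis using assms by (simp only:) (simp add: field_simps)
  qed
  ultimately have "exp (- (1 / 2) * ((x - 0) \<bullet> (matrix_inv (mat v) *v (x - 0)))) / sqrt ((2 * pi) ^ CARD('n) * det (mat v :: real ^ 'n ^ 'n)) = gauss_density v x" for x :: "real ^ 'n"
    unfolding det gauss_density_eq[OF assms] by (simp only: DIM_cart DIM_real mult_1_right)
  then show ?thesis unfolding gaussian_def gauss_def by (simp only:)
qed

context merws
begin

lemma walk_measurable: "walk X n \<in> borel_measurable M"
proof (induction n)
  case (Suc n)
  then show ?case using X_measurable[of "Suc n"] by simp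
qed simp

lemma sigma_sq_measurable: "sigma_sq X n \<in> borel_measurable M"
proof -
  have "(\<lambda>\<omega>. \<Sum>k=1..n. (norm (X k \<omega>))\<^sup>2) \<in> borel_measurable M"
    using X_measurable by (intro borel_measurable_sum borel_measurable_power borel_measurable_norm) auto
  then show ?thesis by (simp add: sigma_sq_def[abs_def])
qed

lemma AE_walk_counts:
  "AE \<omega> in M. walk X n \<omega> = position (counts X n \<omega>) \<and> sigma_sq X n \<omega> = real (num_moves n \<omega>)"
  using AE_X_range[of n]
proof eventually_elim
  case (elim \<omega>)
  have "walk X m \<omega> = position (counts X m \<omega>) \<and> sigma_sq X m \<omega> = real (moves (counts X m \<omega>))" if "m \<le> n" for m
    using that
  proof (induction m)
    case 0
    then show ?case by (simp add: sigma_sq_def moves_def)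
  next
    case (Suc m)
    have s: "sigma_sq X (Suc m) \<omega> = sigma_sq X m \<omega> + (norm (X (Suc m) \<omega>))\<^sup>2" by (simp add: sigma_sq_def)
    from elim Suc.prems consider "X (Suc m) \<omega> = 0" | y where "X (Suc m) \<omega> = dir y" by force
    then show ?case
      using Suc by cases (auto simp: s position_incr)
  qed
  then show ?case by (simp add: num_moves_def)
qed

lemma weak_conv_by_char:
  fixes Y :: "nat \<Rightarrow> 'a \<Rightarrow> 'c::euclidean_space"
  assumes Y: "\<And>n. Y n \<in> borel_measurable M" and \<nu>: "prob_space \<nu>" "sets \<nu> = sets borel"
    and conv: "\<And>t. (\<lambda>n. \<integral>\<omega>. iexp (t \<bullet> Y n \<omega>) \<partial>M) \<longlonglongrightarrow> (\<integral>x. iexp (t \<bullet> x) \<partial>\<nu>)"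
  shows "converges_in_distribution M Y \<nu>"
  unfolding converges_in_distribution_def
proof safe
  show "weak_conv_meas (\<lambda>n. distr M borel (Y n)) \<nu>"
  proof (rule char_tendsto_imp_weak_conv[OF _ _ \<nu>])
    show "prob_space (distr M borel (Y n))" for n by (rule prob_space_distr[OF Y])
    have "(\<integral>x. iexp (t \<bullet> x) \<partial>distr M borel (Y n)) = (\<integral>\<omega>. iexp (t \<bullet> Y n \<omega>) \<partial>M)" for t n
      by (subst integral_distr[OF Y]) auto
    then show "(\<lambda>n. \<integral>x. iexp (t \<bullet> x) \<partial>distr M borel (Y n)) \<longlonglongrightarrow> (\<integral>x. iexp (t \<bullet> x) \<partial>\<nu>)" for t
      using conv by simp
  qed simp
qed (rule Y)

text \<open>The factor \<open>b\<close> covers both normalisations, the random one and the deterministic one.\<close>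
lemma char_walk_decomposition:
  assumes mem: "memory < 1 / 2" and n: "n \<ge> 1" and b: "b \<in> borel_measurable borel"
  shows "(\<integral>\<omega>. iexp (t \<bullet> (b (sigma_sq X n \<omega>) *\<^sub>R walk X n \<omega>)) \<partial>M)
    = (\<integral>\<omega>. urn_char memory (num_moves n \<omega>) (b (real (num_moves n \<omega>)) *\<^sub>R t) \<partial>M)"
proof -
  define H where "H c = iexp (t \<bullet> (b (real (moves c)) *\<^sub>R position c))" for c :: "'n counts"
  have "AE \<omega> in M. iexp (t \<bullet> (b (sigma_sq X n \<omega>) *\<^sub>R walk X n \<omega>)) = H (counts X n \<omega>)"
    using AE_walk_counts[of n] by eventually_elim (simp add: H_def num_moves_def)
  moreover have "(\<lambda>\<omega>. iexp (t \<bullet> (b (sigma_sq X n \<omega>) *\<^sub>R walk X n \<omega>))) \<in> borel_measurable M"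
    using b sigma_sq_measurable[of n] walk_measurable[of n] by measurable
  ultimately have "(\<integral>\<omega>. iexp (t \<bullet> (b (sigma_sq X n \<omega>) *\<^sub>R walk X n \<omega>)) \<partial>M) = (\<integral>\<omega>. H (counts X n \<omega>) \<partial>M)"
    by (intro Bochner_Integration.integral_cong_AE borel_measurable_integrable[OF integrable_counts])
  also have "\<dots> = (\<integral>\<omega>. urn_exp memory (moves (counts X n \<omega>)) H \<partial>M)"
    by (rule expectation_urn[OF mem n])
  also have "\<dots> = (\<integral>\<omega>. urn_char memory (num_moves n \<omega>) (b (real (num_moves n \<omega>)) *\<^sub>R t) \<partial>M)"
  proof (intro Bochner_Integration.integral_cong refl)
    fix \<omega>
    show "urn_exp memory (moves (counts X n \<omega>)) H = urn_char memory (num_moves n \<omega>) (b (real (num_moves n \<omega>)) *\<^sub>R t)"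
      unfolding urn_char_def num_moves_def by (rule urn_exp_cong) (simp add: H_def)
  qed
  finally show ?thesis .
qed

lemma walk_clt:
  assumes mem: "memory < 1 / 2"
  defines "v \<equiv> 1 / (real CARD('n) * (1 - 2 * memory))"
  shows "converges_in_distribution M (\<lambda>n \<omega>. walk X n \<omega> /\<^sub>R sqrt (sigma_sq X n \<omega>)) (gauss v)"
proof -
  interpret urn: elephant_urn "TYPE('n)" memory "real CARD('n)" by (rule elephant_urn_memory[OF mem])
  have v: "v > 0" and lv: "urn.limit_var = v" using urn.limit_var_pos by (auto simp: v_def urn.limit_var_def)
  show ?thesis
  proof (rule weak_conv_by_char)
    show "(\<lambda>\<omega>. walk X n \<omega> /\<^sub>R sqrt (sigma_sq X n \<omega>)) \<in> borel_measurable M" for n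
      using sigma_sq_measurable[of n] walk_measurable[of n] by measurable
    show "prob_space (gauss v :: (real ^ 'n) measure)" by (rule prob_space_gauss[OF v])
    fix t :: "real ^ 'n"
    let ?g = "complex_of_real (exp (- (v * (norm t)\<^sup>2 / 2)))"
    let ?Q = "(norm t)\<^sup>2 + norm t ^ 4"
    let ?\<phi> = "\<lambda>m. urn_char memory m (t /\<^sub>R sqrt (real m))"
    have "(\<lambda>n. (\<integral>\<omega>. iexp (t \<bullet> (walk X n \<omega> /\<^sub>R sqrt (sigma_sq X n \<omega>))) \<partial>M) - ?g) \<longlonglongrightarrow> 0"
    proof (rule Lim_null_comparison)
      show "(\<lambda>n. \<integral>\<omega>. urn.gap_rate (num_moves n \<omega>) * ?Q \<partial>M) \<longlonglongrightarrow> 0"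
        using tendsto_mult_left_zero[OF urn.gap_rate_tendsto_0, of ?Q] urn.gap_rate_nonneg
        by (intro expectation_null_sequence[of "\<lambda>m. urn.gap_rate m * ?Q"]) auto
      show "\<forall>\<^sub>F n in sequentially. norm ((\<integral>\<omega>. iexp (t \<bullet> (walk X n \<omega> /\<^sub>R sqrt (sigma_sq X n \<omega>))) \<partial>M) - ?g)
         \<le> (\<integral>\<omega>. urn.gap_rate (num_moves n \<omega>) * ?Q \<partial>M)"
        using eventually_ge_at_top[of 1]
      proof eventually_elim
        case (elim n)
        have "(\<integral>\<omega>. iexp (t \<bullet> (walk X n \<omega> /\<^sub>R sqrt (sigma_sq X n \<omega>))) \<partial>M) - ?g = (\<integral>\<omega>. ?\<phi> (num_moves n \<omega>) - ?g \<partial>M)"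
          using char_walk_decomposition[OF mem elim _, of "\<lambda>x. inverse (sqrt x)" t] integrable_num_moves[of ?\<phi> n] prob_space
          by simp
        also have "norm \<dots> \<le> (\<integral>\<omega>. norm (?\<phi> (num_moves n \<omega>) - ?g) \<partial>M)" by (rule integral_norm_bound)
        also have "\<dots> \<le> (\<integral>\<omega>. urn.gap_rate (num_moves n \<omega>) * ?Q \<partial>M)"
        proof (rule integral_mono_AE)
          show "AE \<omega> in M. norm (?\<phi> (num_moves n \<omega>) - ?g) \<le> urn.gap_rate (num_moves n \<omega>) * ?Q"
            using AE_num_moves_pos[OF elim] by eventually_elim (use urn.gap_le[unfolded urn.gap_def lv] in blast)
        qed (rule integrable_num_moves[of "\<lambda>m. norm (?\<phi> m - ?g)"] integrable_num_moves[of "\<lambda>m. urn.gap_rate m * ?Q"])+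
        finally show ?case .
      qed
    qed
    moreover have "?g = (\<integral>x. iexp (t \<bullet> x) \<partial>gauss v)" by (simp add: gauss_char[OF v])
    ultimately show "(\<lambda>n. \<integral>\<omega>. iexp (t \<bullet> (walk X n \<omega> /\<^sub>R sqrt (sigma_sq X n \<omega>))) \<partial>M) \<longlonglongrightarrow> (\<integral>x. iexp (t \<bullet> x) \<partial>gauss v)"
      by (simp add: LIM_zero_iff)
  qed simp
qed

text \<open>The inequality \<open>x y \<le> x\<^sup>2/(2\<epsilon>) + \<epsilon> y\<^sup>2/2\<close> separates \<open>\<delta>\<close>, whose square has vanishing expectation,
  from the power of the scaled clock, whose moments are bounded.\<close>
lemma expectation_null_scaled_moves:
  fixes \<delta> :: "nat \<Rightarrow> real"
  assumes \<delta>: "\<delta> \<longlonglongrightarrow> 0" and pos: "\<And>m. \<delta> m \<ge> 0"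
  shows "(\<lambda>n. \<integral>\<omega>. \<delta> (num_moves n \<omega>) * scaled_moves n \<omega> ^ k \<partial>M) \<longlonglongrightarrow> 0"
proof -
  obtain C where C: "\<And>n. (\<integral>\<omega>. scaled_moves n \<omega> ^ (2 * k) \<partial>M) \<le> C" "C > 0"
    using convergent_imp_Bseq[OF convergentI[OF scaled_moment[of "2 * k"]]] unfolding Bseq_def by (auto simp: abs_le_iff)
  show ?thesis
  proof (rule LIMSEQ_I)
    fix e :: real assume e: "e > 0"
    \<comment> \<open>Then the term with the moment of the clock contributes at most \<open>e / 4\<close>, and the other one at most \<open>e / 2\<close>.\<close>
    define \<epsilon> where "\<epsilon> = e / (2 * C)"
    have \<epsilon>: "\<epsilon> > 0" using e C by (simp add: \<epsilon>_def)
    have "(\<lambda>m. (\<delta> m)\<^sup>2) \<longlonglongrightarrow> 0\<^sup>2" by (intro tendsto_power \<delta>)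
    then have "(\<lambda>n. \<integral>\<omega>. (\<delta> (num_moves n \<omega>))\<^sup>2 \<partial>M) \<longlonglongrightarrow> 0"
      by (intro expectation_null_sequence) auto
    from order_tendstoD(2)[OF this, of "\<epsilon> * e"] e \<epsilon>
    have "\<forall>\<^sub>F n in sequentially. (\<integral>\<omega>. (\<delta> (num_moves n \<omega>))\<^sup>2 \<partial>M) < \<epsilon> * e" by simp
    then have "\<forall>\<^sub>F n in sequentially. norm ((\<integral>\<omega>. \<delta> (num_moves n \<omega>) * scaled_moves n \<omega> ^ k \<partial>M) - 0) < e"
    proof eventually_elim
      case (elim n)
      let ?f = "\<lambda>m. \<delta> m * (real m / real n powr \<alpha>) ^ k"
      let ?F = "\<integral>\<omega>. \<delta> (num_moves n \<omega>) * scaled_moves n \<omega> ^ k \<partial>M"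
      have i1: "integrable M (\<lambda>\<omega>. \<delta> (num_moves n \<omega>) * scaled_moves n \<omega> ^ k)"
        unfolding scaled_moves_def by (rule integrable_num_moves[of ?f])
      have "?F \<le> (\<integral>\<omega>. 1 / (2 * \<epsilon>) * (\<delta> (num_moves n \<omega>))\<^sup>2 + \<epsilon> / 2 * scaled_moves n \<omega> ^ (2 * k) \<partial>M)"
      proof (rule integral_mono[OF i1])
        show "integrable M (\<lambda>\<omega>. 1 / (2 * \<epsilon>) * (\<delta> (num_moves n \<omega>))\<^sup>2 + \<epsilon> / 2 * scaled_moves n \<omega> ^ (2 * k))"
          by (intro Bochner_Integration.integrable_add integrable_mult_right integrable_num_moves[of "\<lambda>m. (\<delta> m)\<^sup>2"] integrable_scaled_moves[of "\<lambda>z. z ^ (2 * k)"])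
        fix \<omega>
        let ?x = "\<delta> (num_moves n \<omega>)" and ?y = "scaled_moves n \<omega> ^ k"
        have "0 \<le> (?x - \<epsilon> * ?y)\<^sup>2 / (2 * \<epsilon>)" using \<epsilon> by simp
        also have "\<dots> = 1 / (2 * \<epsilon>) * ?x\<^sup>2 + \<epsilon> / 2 * ?y\<^sup>2 - ?x * ?y"
          using \<epsilon> by (simp add: power2_eq_square field_simps)
        finally show "?x * ?y \<le> 1 / (2 * \<epsilon>) * ?x\<^sup>2 + \<epsilon> / 2 * scaled_moves n \<omega> ^ (2 * k)"
          by (simp add: power_mult mult.commute[of 2] flip: power_mult)
      qed
      also have "\<dots> = 1 / (2 * \<epsilon>) * (\<integral>\<omega>. (\<delta> (num_moves n \<omega>))\<^sup>2 \<partial>M) + \<epsilon> / 2 * (\<integral>\<omega>. scaled_moves n \<omega> ^ (2 * k) \<partial>M)"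
        unfolding integral_mult_right_zero[symmetric]
        by (intro Bochner_Integration.integral_add integrable_mult_right integrable_num_moves[of "\<lambda>m. (\<delta> m)\<^sup>2"] integrable_scaled_moves[of "\<lambda>z. z ^ (2 * k)"])
      also have "\<dots> < 1 / (2 * \<epsilon>) * (\<epsilon> * e) + \<epsilon> / 2 * C"
        using elim C(1)[of n] \<epsilon> by (intro add_less_le_mono mult_strict_left_mono mult_left_mono) auto
      also have "\<dots> \<le> e" using \<epsilon> C e by (simp add: \<epsilon>_def)
      finally have "?F < e" .
      moreover have "0 \<le> ?F" using pos scaled_moves_nonneg by (intro Bochner_Integration.integral_nonneg) simp
      ultimately show ?case by simp
    qed
    then show "\<exists>no. \<forall>n\<ge>no. norm ((\<integral>\<omega>. \<delta> (num_moves n \<omega>) * scaled_moves n \<omega> ^ k \<partial>M) - 0) < e" by (simp add: eventually_sequentially)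
  qed
qed

text \<open>With \<open>s = \<surd>(m/n\<^sup>\<alpha>) t\<close>, the error bound \<open>\<rho>\<^sub>m (|s|\<^sup>2 + |s|\<^sup>4)\<close> of the urn is \<open>\<rho>\<^sub>m\<close> times a polynomial in
  the scaled clock, and its expectation vanishes; the Gaussian factor becomes a Laplace transform of
  the scaled clock.\<close>
lemma char_walk_scaled:
  assumes mem: "memory < 1 / 2"
  defines "v \<equiv> 1 / (real CARD('n) * (1 - 2 * memory))"
  shows "(\<lambda>n. \<integral>\<omega>. iexp (t \<bullet> (walk X n \<omega> /\<^sub>R sqrt (real n powr \<alpha>))) \<partial>M)
    \<longlonglongrightarrow> complex_of_real (\<Sum>k. (- (v * (norm t)\<^sup>2 / 2)) ^ k / Gamma (1 + real k * \<alpha>))"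
proof -
  interpret urn: elephant_urn "TYPE('n)" memory "real CARD('n)" by (rule elephant_urn_memory[OF mem])
  have v: "v > 0" and lv: "urn.limit_var = v" using urn.limit_var_pos by (auto simp: v_def urn.limit_var_def)
  define \<theta> where "\<theta> = v * (norm t)\<^sup>2 / 2"
  have \<theta>: "\<theta> \<ge> 0" using v by (simp add: \<theta>_def)
  let ?E = "\<lambda>n. \<integral>\<omega>. iexp (t \<bullet> (walk X n \<omega> /\<^sub>R sqrt (real n powr \<alpha>))) \<partial>M"
  let ?G = "\<lambda>n. \<integral>\<omega>. exp (- (\<theta> * scaled_moves n \<omega>)) \<partial>M"
  let ?R = "\<lambda>n \<omega>. urn.gap_rate (num_moves n \<omega>)"
  have "(\<lambda>n. ?E n - complex_of_real (?G n)) \<longlonglongrightarrow> 0"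
  proof (rule Lim_null_comparison)
    have "(\<lambda>n. (norm t)\<^sup>2 * (\<integral>\<omega>. ?R n \<omega> * scaled_moves n \<omega> ^ 1 \<partial>M) + norm t ^ 4 * (\<integral>\<omega>. ?R n \<omega> * scaled_moves n \<omega> ^ 2 \<partial>M)) \<longlonglongrightarrow> (norm t)\<^sup>2 * 0 + norm t ^ 4 * 0"
      by (intro tendsto_intros expectation_null_scaled_moves urn.gap_rate_tendsto_0 urn.gap_rate_nonneg)
    then show "(\<lambda>n. (norm t)\<^sup>2 * (\<integral>\<omega>. ?R n \<omega> * scaled_moves n \<omega> ^ 1 \<partial>M) + norm t ^ 4 * (\<integral>\<omega>. ?R n \<omega> * scaled_moves n \<omega> ^ 2 \<partial>M)) \<longlonglongrightarrow> 0" by simp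
    show "\<forall>\<^sub>F n in sequentially. norm (?E n - complex_of_real (?G n))
       \<le> (norm t)\<^sup>2 * (\<integral>\<omega>. ?R n \<omega> * scaled_moves n \<omega> ^ 1 \<partial>M) + norm t ^ 4 * (\<integral>\<omega>. ?R n \<omega> * scaled_moves n \<omega> ^ 2 \<partial>M)"
      using eventually_ge_at_top[of 1]
    proof eventually_elim
      case (elim n)
      define N where "N = real n powr \<alpha>"
      have N: "N > 0" using elim by (simp add: N_def)
      let ?\<phi> = "\<lambda>m. urn_char memory m (t /\<^sub>R sqrt N)"
      let ?g = "\<lambda>m. complex_of_real (exp (- (\<theta> * (real m / N))))"
      let ?b = "\<lambda>m. (norm t)\<^sup>2 * (urn.gap_rate m * (real m / N) ^ 1) + norm t ^ 4 * (urn.gap_rate m * (real m / N) ^ 2)"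
      have "?E n - complex_of_real (?G n) = (\<integral>\<omega>. ?\<phi> (num_moves n \<omega>) \<partial>M) - (\<integral>\<omega>. ?g (num_moves n \<omega>) \<partial>M)"
        using char_walk_decomposition[OF mem elim _, of "\<lambda>_. inverse (sqrt N)" t]
        by (simp add: N_def scaled_moves_def)
      also have "\<dots> = (\<integral>\<omega>. ?\<phi> (num_moves n \<omega>) - ?g (num_moves n \<omega>) \<partial>M)"
        by (intro Bochner_Integration.integral_diff[symmetric] integrable_num_moves[of ?\<phi>] integrable_num_moves[of ?g])
      also have "norm \<dots> \<le> (\<integral>\<omega>. norm (?\<phi> (num_moves n \<omega>) - ?g (num_moves n \<omega>)) \<partial>M)" by (rule integral_norm_bound)
      also have "\<dots> \<le> (\<integral>\<omega>. ?b (num_moves n \<omega>) \<partial>M)"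
      proof (rule integral_mono_AE)
        show "AE \<omega> in M. norm (?\<phi> (num_moves n \<omega>) - ?g (num_moves n \<omega>)) \<le> ?b (num_moves n \<omega>)"
          using AE_num_moves_pos[OF elim]
        proof eventually_elim
          case m: (elim \<omega>)
          let ?m = "num_moves n \<omega>"
          define s where "s = sqrt (real ?m / N) *\<^sub>R t"
          have "s /\<^sub>R sqrt (real ?m) = t /\<^sub>R sqrt N"
            using m N by (simp add: s_def real_sqrt_divide inverse_eq_divide)
          moreover have s2: "(norm s)\<^sup>2 = (norm t)\<^sup>2 * (real ?m / N)"
            using N by (simp add: s_def power_mult_distrib)
          moreover have "norm s ^ 4 = norm t ^ 4 * (real ?m / N) ^ 2"
          proof -
            have "norm s ^ 4 = ((norm s)\<^sup>2)\<^sup>2" by simp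
            also have "\<dots> = norm t ^ 4 * (real ?m / N) ^ 2" unfolding s2 power_mult_distrib by simp
            finally show ?thesis .
          qed
          moreover have "v * (norm s)\<^sup>2 / 2 = \<theta> * (real ?m / N)" unfolding s2 by (simp add: \<theta>_def)
          ultimately show ?case
            using urn.gap_le[OF m, of s] unfolding urn.gap_def lv by (simp add: algebra_simps)
        qed
      qed (rule integrable_num_moves[of "\<lambda>m. norm (?\<phi> m - ?g m)"] integrable_num_moves[of ?b])+
      also have "\<dots> = (norm t)\<^sup>2 * (\<integral>\<omega>. ?R n \<omega> * scaled_moves n \<omega> ^ 1 \<partial>M) + norm t ^ 4 * (\<integral>\<omega>. ?R n \<omega> * scaled_moves n \<omega> ^ 2 \<partial>M)"
        unfolding scaled_moves_def N_def[symmetric] integral_mult_right_zero[symmetric]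
        by (intro Bochner_Integration.integral_add integrable_mult_right integrable_num_moves[of "\<lambda>m. urn.gap_rate m * (real m / N) ^ 1"] integrable_num_moves[of "\<lambda>m. urn.gap_rate m * (real m / N) ^ 2"])
      finally show ?case .
    qed
  qed
  moreover have "(\<lambda>n. complex_of_real (?G n)) \<longlonglongrightarrow> complex_of_real (\<Sum>k. (- \<theta>) ^ k / Gamma (1 + real k * \<alpha>))"
    by (intro tendsto_of_real laplace_tendsto_mittag_leffler \<theta>)
  ultimately have "(\<lambda>n. (?E n - complex_of_real (?G n)) + complex_of_real (?G n)) \<longlonglongrightarrow> 0 + complex_of_real (\<Sum>k. (- \<theta>) ^ k / Gamma (1 + real k * \<alpha>))"
    by (rule tendsto_add)
  then show ?thesis by (simp add: \<theta>_def)
qed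

end

text \<open>Conditionally on \<open>S\<close>, the vector is Gaussian with variance \<open>v S\<close>.\<close>
lemma char_variance_mixture:
  fixes S :: "'b \<Rightarrow> real" and Z :: "'b \<Rightarrow> 'c::euclidean_space"
  assumes N: "prob_space N" and S[measurable]: "S \<in> borel_measurable N" and pos: "AE \<omega> in N. S \<omega> > 0"
    and Z[measurable]: "Z \<in> borel_measurable N" and law: "distr N borel Z = gauss v" and v: "v > 0"
    and indep: "prob_space.indep_set N (sets (vimage_algebra (space N) S borel)) (sets (vimage_algebra (space N) Z borel))"
  shows "(\<integral>\<omega>. iexp (t \<bullet> (sqrt (S \<omega>) *\<^sub>R Z \<omega>)) \<partial>N) = complex_of_real (\<integral>\<omega>. exp (- (v * (norm t)\<^sup>2 / 2) * S \<omega>) \<partial>N)"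
proof -
  interpret N: prob_space N by (rule N)
  interpret PS: prob_space "distr N borel S" by (rule N.prob_space_distr[OF S])
  interpret PZ: prob_space "gauss v :: 'c measure" by (rule prob_space_gauss[OF v])
  have joint: "distr N borel S \<Otimes>\<^sub>M distr N borel Z = distr N (borel \<Otimes>\<^sub>M borel) (\<lambda>\<omega>. (S \<omega>, Z \<omega>))"
  proof (rule pair_measure_eqI)
    show "sigma_finite_measure (distr N borel S)" by standard
    show "sigma_finite_measure (distr N borel Z)" unfolding law by standard
    fix B C assume B: "B \<in> sets (distr N borel S)" and C: "C \<in> sets (distr N borel Z)"
    have "N.prob ((S -` B \<inter> space N) \<inter> (Z -` C \<inter> space N)) = N.prob (S -` B \<inter> space N) * N.prob (Z -` C \<inter> space N)"
      using B C by (intro N.indep_setD[OF indep] in_vimage_algebra) auto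
    moreover have "(S -` B \<inter> space N) \<inter> (Z -` C \<inter> space N) = (\<lambda>\<omega>. (S \<omega>, Z \<omega>)) -` (B \<times> C) \<inter> space N" by auto
    ultimately show "emeasure (distr N borel S) B * emeasure (distr N borel Z) C = emeasure (distr N (borel \<Otimes>\<^sub>M borel) (\<lambda>\<omega>. (S \<omega>, Z \<omega>))) (B \<times> C)"
      using B C by (simp add: emeasure_distr N.emeasure_eq_measure ennreal_mult'')
  qed simp
  interpret P: pair_prob_space "distr N borel S" "gauss v :: 'c measure" ..
  let ?F = "\<lambda>(s, z). iexp (t \<bullet> (sqrt s *\<^sub>R z)) :: complex"
  have "(\<integral>\<omega>. iexp (t \<bullet> (sqrt (S \<omega>) *\<^sub>R Z \<omega>)) \<partial>N) = (\<integral>x. ?F x \<partial>distr N (borel \<Otimes>\<^sub>M borel) (\<lambda>\<omega>. (S \<omega>, Z \<omega>)))"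
    by (subst integral_distr) (auto simp: split_beta)
  also have "\<dots> = (\<integral>x. ?F x \<partial>(distr N borel S \<Otimes>\<^sub>M gauss v))"
    unfolding joint[symmetric] law ..
  also have "\<dots> = (\<integral>s. (\<integral>z. ?F (s, z) \<partial>gauss v) \<partial>distr N borel S)"
  proof (rule P.integral_fst'[symmetric])
    show "integrable (distr N borel S \<Otimes>\<^sub>M gauss v) ?F"
      by (intro P.P.integrable_const_bound[of _ 1]) (auto simp: split_beta)
  qed
  also have "\<dots> = (\<integral>s. complex_of_real (exp (- v * (norm (sqrt s *\<^sub>R t))\<^sup>2 / 2)) \<partial>distr N borel S)"
  proof (intro Bochner_Integration.integral_cong refl)
    fix s
    show "(\<integral>z. ?F (s, z) \<partial>gauss v) = complex_of_real (exp (- v * (norm (sqrt s *\<^sub>R t))\<^sup>2 / 2))"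
      using gauss_char[OF v, of "sqrt s *\<^sub>R t"] by simp
  qed
  also have "\<dots> = (\<integral>\<omega>. complex_of_real (exp (- v * (norm (sqrt (S \<omega>) *\<^sub>R t))\<^sup>2 / 2)) \<partial>N)"
    by (subst integral_distr) auto
  also have "\<dots> = (\<integral>\<omega>. complex_of_real (exp (- (v * (norm t)\<^sup>2 / 2) * S \<omega>)) \<partial>N)"
  proof (rule Bochner_Integration.integral_cong_AE)
    show "AE \<omega> in N. complex_of_real (exp (- v * (norm (sqrt (S \<omega>) *\<^sub>R t))\<^sup>2 / 2)) = complex_of_real (exp (- (v * (norm t)\<^sup>2 / 2) * S \<omega>))"
      using pos by eventually_elim (simp add: power_mult_distrib mult_ac)
  qed measurable
  finally show ?thesis by simp
qed

theorem theorem3p3: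
  fixes M :: "'a measure"
    and lab :: "nat \<Rightarrow> 'n::finite"
    and p q r v2 :: real
    and X :: "nat \<Rightarrow> 'a \<Rightarrow> real ^ 'n"
    and A :: "nat \<Rightarrow> 'a \<Rightarrow> real ^ 'n ^ 'n"
    and U :: "nat \<Rightarrow> 'a \<Rightarrow> nat"
  assumes merws: "merws M lab p q r X A U"
    and diffusive: "p < (2 * real CARD('n) + 1) / (4 * real CARD('n)) * (1 - r)"
    and v2: "v2 = (2 * real CARD('n) - 1) * (1 - r) /
                (real CARD('n) * ((2 * real CARD('n) + 1) * (1 - r) - 4 * real CARD('n) * p))"
  shows "converges_in_distribution M
           (\<lambda>n \<omega>. walk X n \<omega> /\<^sub>R sqrt (sigma_sq X n \<omega>)) (gaussian 0 (mat v2))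
       \<and> (\<forall>(N :: 'b measure) (\<Sigma>' :: 'b \<Rightarrow> real) (Z :: 'b \<Rightarrow> real ^ 'n).
           prob_space N \<and>
           has_mittag_leffler_law N (1 - r) \<Sigma>' \<and>
           Z \<in> borel_measurable N \<and> distr N borel Z = gaussian 0 (mat v2) \<and>
           prob_space.indep_set N (sets (vimage_algebra (space N) \<Sigma>' borel))
             (sets (vimage_algebra (space N) Z borel)) \<longrightarrow>
           converges_in_distribution M
             (\<lambda>n \<omega>. walk X n \<omega> /\<^sub>R sqrt (real n powr (1 - r)))
             (distr N borel (\<lambda>\<omega>. sqrt (\<Sigma>' \<omega>) *\<^sub>R Z \<omega>)))"
proof -
  interpret merws M lab p q r X A U by (rule merws)
  define d where "d = real CARD('n)"
  have d: "d \<ge> 1" by (simp add: d_def)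
  have \<alpha>_eq: "\<alpha> = 1 - r" by (rule \<alpha>_def)
  have diff: "4 * d * p < (2 * d + 1) * \<alpha>"
    using diffusive d unfolding d_def[symmetric] \<alpha>_eq[symmetric] by (simp add: field_simps)
  \<comment> \<open>This identity translates the diffusive regime into \<open>memory < 1/2\<close> and identifies the variance.\<close>
  have mem_eq: "(1 - 2 * memory) * ((2 * d - 1) * \<alpha>) = (2 * d + 1) * \<alpha> - 4 * d * p"
  proof -
    have "(2 * d - 1) * (memory * \<alpha>) = (2 * d - 1) * (p - q)" using \<alpha> by (simp add: memory_def)
    also have "\<dots> = 2 * d * p - \<alpha>" using weights_sum unfolding d_def[symmetric] by (simp add: algebra_simps)
    finally show ?thesis by (simp add: algebra_simps)
  qed
  have pos: "(2 * d - 1) * \<alpha> > 0" using d \<alpha> by simp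
  have "0 < (1 - 2 * memory) * ((2 * d - 1) * \<alpha>)" unfolding mem_eq using diff by simp
  then have mem: "memory < 1 / 2" using pos by (simp add: zero_less_mult_iff)
  have v2_eq: "v2 = 1 / (real CARD('n) * (1 - 2 * memory))"
  proof -
    have "v2 = ((2 * d - 1) * \<alpha>) / (d * ((1 - 2 * memory) * ((2 * d - 1) * \<alpha>)))"
      unfolding mem_eq unfolding v2 d_def \<alpha>_eq by simp
    also have "\<dots> = 1 / (d * (1 - 2 * memory))"
    proof -
      have "c / (x * (y * c)) = 1 / (x * y)" if "c > 0" for c x y :: real using that by simp
      from this[OF pos] show ?thesis .
    qed
    finally show ?thesis by (simp add: d_def)
  qed
  have v2_pos: "v2 > 0" unfolding v2_eq using mem by simp
  note gaussian = gaussian_eq_gauss[OF v2_pos, where 'n='n]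
  show ?thesis
  proof (intro conjI allI impI; (elim conjE)?)
    show "converges_in_distribution M (\<lambda>n \<omega>. walk X n \<omega> /\<^sub>R sqrt (sigma_sq X n \<omega>)) (gaussian 0 (mat v2))"
      unfolding gaussian unfolding v2_eq by (rule walk_clt[OF mem])
  next
    fix N :: "'b measure" and S :: "'b \<Rightarrow> real" and Z :: "'b \<Rightarrow> real ^ 'n"
    assume N: "prob_space N" and mlaw: "has_mittag_leffler_law N (1 - r) S" and Z: "Z \<in> borel_measurable N"
      and law: "distr N borel Z = gaussian 0 (mat v2)"
      and indep: "prob_space.indep_set N (sets (vimage_algebra (space N) S borel)) (sets (vimage_algebra (space N) Z borel))"
    have S: "S \<in> borel_measurable N" and S_pos: "AE \<omega> in N. S \<omega> > 0"
      and mgf: "(\<integral>\<omega>. exp (t * S \<omega>) \<partial>N) = (\<Sum>k. t ^ k / Gamma (1 + real k * (1 - r)))" for t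
      using mlaw by (auto simp: has_mittag_leffler_law_def has_bochner_integral_integral_eq)
    have mix: "(\<lambda>\<omega>. sqrt (S \<omega>) *\<^sub>R Z \<omega>) \<in> borel_measurable N" using S Z by measurable
    show "converges_in_distribution M (\<lambda>n \<omega>. walk X n \<omega> /\<^sub>R sqrt (real n powr (1 - r))) (distr N borel (\<lambda>\<omega>. sqrt (S \<omega>) *\<^sub>R Z \<omega>))"
    proof (rule weak_conv_by_char)
      show "(\<lambda>\<omega>. walk X n \<omega> /\<^sub>R sqrt (real n powr (1 - r))) \<in> borel_measurable M" for n
        using walk_measurable[of n] by measurable
      show "prob_space (distr N borel (\<lambda>\<omega>. sqrt (S \<omega>) *\<^sub>R Z \<omega>))" by (rule prob_space.prob_space_distr[OF N mix])
      fix t :: "real ^ 'n"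
      have "(\<integral>x. iexp (t \<bullet> x) \<partial>distr N borel (\<lambda>\<omega>. sqrt (S \<omega>) *\<^sub>R Z \<omega>)) = (\<integral>\<omega>. iexp (t \<bullet> (sqrt (S \<omega>) *\<^sub>R Z \<omega>)) \<partial>N)"
        by (subst integral_distr[OF mix]) auto
      also have "\<dots> = complex_of_real (\<Sum>k. (- (v2 * (norm t)\<^sup>2 / 2)) ^ k / Gamma (1 + real k * \<alpha>))"
        unfolding char_variance_mixture[OF N S S_pos Z law[unfolded gaussian] v2_pos indep] mgf \<alpha>_eq ..
      finally show "(\<lambda>n. \<integral>\<omega>. iexp (t \<bullet> (walk X n \<omega> /\<^sub>R sqrt (real n powr (1 - r)))) \<partial>M)
         \<longlonglongrightarrow> (\<integral>x. iexp (t \<bullet> x) \<partial>distr N borel (\<lambda>\<omega>. sqrt (S \<omega>) *\<^sub>R Z \<omega>))"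
        using char_walk_scaled[OF mem, of t] unfolding v2_eq \<alpha>_eq by simp
    qed simp
  qed
qed

end
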